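(* Let $X$ be a complex vector space with $\dim_{\mathbb{C}}X\ge2$, $Y\ne\{0\}$ a sequentially complete Hausdorff complex locally convex space, and $K\subset\Omega\subset X$ such that $\Omega$ and $\Omega\setminus K$ are $2$-open and $\Omega\setminus K$ is polygonally connected. Assume there exists $u\in X\setminus\{0\}$ such that: (i) for all $a\in\Omega$ and $v\in X$ there is $\varepsilon>0$ such that $K\cap L_a(u,v[\varepsilon])$ is compact in $L_a(u,v)$; (ii) $K\cap L_c(u)=\emptyset$ for some $c\in\Omega$. Then every $f\in\mathcal{H}_G(\Omega\setminus K,Y)$ has a unique extension $\tilde f\in\mathcal{H}_G(\Omega,Y)$, and $\tilde f(\Omega)\subset\overline{\mathrm{co}}(f(\Omega\setminus K))$. If $Y=\mathbb{C}$, then $\tilde f(\Omega)=f(\Omega\setminus K)$.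
   Context: $L_a(u):=a+\mathbb{C}u$, $L_a(u,v):=a+\mathbb{C}u+\mathbb{C}v$ (with Euclidean topology), and $L_a(u,v[\varepsilon]):=L_a(u)+\{\lambda\in\mathbb{C}:|\lambda|\le\varepsilon\}\cdot v$. $A\subset X$ is $2$-open if $A\cap L$ is open in $L$ for every complex affine subspace $L$ of dimension $1$ or $2$. Polygonally connected: any two points joined by a polygonal chain in the set. $\mathcal{H}_G(U,Y)$: maps with $\lambda\mapsto\varphi(f(a+\lambda v))$ holomorphic near $0$ for all $a\in U,v\in X,\varphi\in Y^*$. $\overline{\mathrm{co}}$: closed convex hull. *)

theory Defs
  imports "HOL-Complex_Analysis.Complex_Analysis"
begin

text \<open>Complex vector spaces are modelled via the locale vector_space with complex scalars:
  sX :: complex => 'a => 'a is the scalar multiplication of X.\<close>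

definition lineL :: "(complex \<Rightarrow> 'a \<Rightarrow> 'a::ab_group_add) \<Rightarrow> 'a \<Rightarrow> 'a \<Rightarrow> 'a set" where
  "lineL sX a u = {a + sX l u | l. True}"

definition planeL :: "(complex \<Rightarrow> 'a \<Rightarrow> 'a::ab_group_add) \<Rightarrow> 'a \<Rightarrow> 'a \<Rightarrow> 'a \<Rightarrow> 'a set" where
  "planeL sX a u v = {a + sX l u + sX m v | l m. True}"

definition planeL_eps :: "(complex \<Rightarrow> 'a \<Rightarrow> 'a::ab_group_add) \<Rightarrow> 'a \<Rightarrow> 'a \<Rightarrow> 'a \<Rightarrow> real \<Rightarrow> 'a set" where
  "planeL_eps sX a u v e = {a + sX l u + sX m v | l m. cmod m \<le> e}"

text \<open>Compactness of S in the finite-dimensional affine subspace L_a(u,v) with its Euclidean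
  topology: S is the image of a compact subset of C^2 under the (continuous, surjective,
  linear-affine) parametrisation (l,m) |-> a + l u + m v.  This is equivalent to compactness
  in the Euclidean topology of L_a(u,v) whether or not u,v are independent.\<close>
definition compact_in_plane :: "(complex \<Rightarrow> 'a \<Rightarrow> 'a::ab_group_add) \<Rightarrow> 'a \<Rightarrow> 'a \<Rightarrow> 'a \<Rightarrow> 'a set \<Rightarrow> bool" where
  "compact_in_plane sX a u v S \<longleftrightarrow>
     (\<exists>C :: (complex \<times> complex) set. compact C \<and> S = (\<lambda>p. a + sX (fst p) u + sX (snd p) v) ` C)"

definition two_open :: "(complex \<Rightarrow> 'a \<Rightarrow> 'a::ab_group_add) \<Rightarrow> 'a set \<Rightarrow> bool" where
  "two_open sX A \<longleftrightarrow>
     (\<forall>a u. u \<noteq> 0 \<longrightarrow> open {l::complex. a + sX l u \<in> A}) \<and>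
     (\<forall>a u v. u \<noteq> v \<and> \<not> module.dependent sX {u, v} \<longrightarrow>
         open {p :: complex \<times> complex. a + sX (fst p) u + sX (snd p) v \<in> A})"

definition segX :: "(complex \<Rightarrow> 'a \<Rightarrow> 'a::ab_group_add) \<Rightarrow> 'a \<Rightarrow> 'a \<Rightarrow> 'a set" where
  "segX sX x y = {sX (complex_of_real (1 - t)) x + sX (complex_of_real t) y | t. 0 \<le> t \<and> t \<le> 1}"

definition polygonally_connected :: "(complex \<Rightarrow> 'a \<Rightarrow> 'a::ab_group_add) \<Rightarrow> 'a set \<Rightarrow> bool" where
  "polygonally_connected sX A \<longleftrightarrow>
     (\<forall>p\<in>A. \<forall>q\<in>A. \<exists>xs. xs \<noteq> [] \<and> hd xs = p \<and> last xs = q \<and>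
        (\<forall>i. Suc i < length xs \<longrightarrow> segX sX (xs ! i) (xs ! Suc i) \<subseteq> A))"

text \<open>Locally convex space Y given by scalar multiplication sY and a family of seminorms P.\<close>
definition seminorm_family :: "(complex \<Rightarrow> 'b \<Rightarrow> 'b::ab_group_add) \<Rightarrow> ('i \<Rightarrow> 'b \<Rightarrow> real) \<Rightarrow> bool" where
  "seminorm_family sY P \<longleftrightarrow>
     (\<forall>i x y. P i (x + y) \<le> P i x + P i y) \<and> (\<forall>i c x. P i (sY c x) = cmod c * P i x)"

definition lc_hausdorff :: "('i \<Rightarrow> 'b::ab_group_add \<Rightarrow> real) \<Rightarrow> bool" where
  "lc_hausdorff P \<longleftrightarrow> (\<forall>y. y \<noteq> 0 \<longrightarrow> (\<exists>i. P i y \<noteq> 0))"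

definition lc_seq_complete :: "('i \<Rightarrow> 'b::ab_group_add \<Rightarrow> real) \<Rightarrow> bool" where
  "lc_seq_complete P \<longleftrightarrow>
     (\<forall>x :: nat \<Rightarrow> 'b.
        (\<forall>i e. e > 0 \<longrightarrow> (\<exists>N. \<forall>m n. N \<le> m \<and> N \<le> n \<longrightarrow> P i (x m - x n) < e)) \<longrightarrow>
        (\<exists>y. \<forall>i e. e > 0 \<longrightarrow> (\<exists>N. \<forall>n. N \<le> n \<longrightarrow> P i (x n - y) < e)))"

definition lc_nbhd :: "('i \<Rightarrow> 'b::ab_group_add \<Rightarrow> real) \<Rightarrow> 'i set \<Rightarrow> real \<Rightarrow> 'b \<Rightarrow> 'b set" where
  "lc_nbhd P F e y = {z. \<forall>i\<in>F. P i (z - y) < e}"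

definition lc_closure :: "('i \<Rightarrow> 'b::ab_group_add \<Rightarrow> real) \<Rightarrow> 'b set \<Rightarrow> 'b set" where
  "lc_closure P S = {y. \<forall>F e. finite F \<and> e > 0 \<longrightarrow> lc_nbhd P F e y \<inter> S \<noteq> {}}"

definition lc_closed :: "('i \<Rightarrow> 'b::ab_group_add \<Rightarrow> real) \<Rightarrow> 'b set \<Rightarrow> bool" where
  "lc_closed P S \<longleftrightarrow> lc_closure P S \<subseteq> S"

definition convexY :: "(complex \<Rightarrow> 'b \<Rightarrow> 'b::ab_group_add) \<Rightarrow> 'b set \<Rightarrow> bool" where
  "convexY sY C \<longleftrightarrow> (\<forall>x\<in>C. \<forall>y\<in>C. \<forall>t::real. 0 \<le> t \<and> t \<le> 1 \<longrightarrow>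
      sY (complex_of_real (1 - t)) x + sY (complex_of_real t) y \<in> C)"

definition closed_convex_hull :: "(complex \<Rightarrow> 'b \<Rightarrow> 'b::ab_group_add) \<Rightarrow> ('i \<Rightarrow> 'b \<Rightarrow> real) \<Rightarrow> 'b set \<Rightarrow> 'b set" where
  "closed_convex_hull sY P S = \<Inter>{C. S \<subseteq> C \<and> convexY sY C \<and> lc_closed P C}"

definition lc_dual :: "(complex \<Rightarrow> 'b \<Rightarrow> 'b::ab_group_add) \<Rightarrow> ('i \<Rightarrow> 'b \<Rightarrow> real) \<Rightarrow> ('b \<Rightarrow> complex) set" where
  "lc_dual sY P = {\<phi>. Vector_Spaces.linear sY (*) \<phi> \<and>
     (\<forall>y e. e > 0 \<longrightarrow> (\<exists>F d. finite F \<and> d > 0 \<and> (\<forall>z\<in>lc_nbhd P F d y. cmod (\<phi> z - \<phi> y) < e)))}"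

definition H_G :: "(complex \<Rightarrow> 'a \<Rightarrow> 'a::ab_group_add) \<Rightarrow> (complex \<Rightarrow> 'b \<Rightarrow> 'b::ab_group_add) \<Rightarrow>
    ('i \<Rightarrow> 'b \<Rightarrow> real) \<Rightarrow> 'a set \<Rightarrow> ('a \<Rightarrow> 'b) set" where
  "H_G sX sY P U = {f. \<forall>a\<in>U. \<forall>v. \<forall>\<phi>\<in>lc_dual sY P.
      \<exists>r>0. (\<lambda>l. \<phi> (f (a + sX l v))) holomorphic_on ball 0 r}"

end

theory Submission
  imports Defs
begin

text \<open>
  For scalar \<open>f\<close>, the extension at \<open>a\<close> is the Cauchy integral of \<open>f (a + l u) / l\<close> over the boundary,
  in the \<open>l\<close>-plane, of a union of small squares of a dyadic grid covering \<open>0\<close> and the compact set of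
  those \<open>l\<close> with \<open>a + l u \<in> K\<close>. It does not depend on the grid, and by the slab condition one grid serves
  all \<open>a + m v\<close> with \<open>m\<close> small, so the extension is holomorphic in \<open>m\<close>; joint continuity of \<open>f\<close> on planes,
  needed for this, is Hartogs' theorem on separate analyticity. By Cauchy's formula the extension agrees
  with \<open>f\<close> near the line that avoids \<open>K\<close>, hence on all of \<open>\<Omega> - K\<close> by the identity theorem along
  polygonal chains. Cauchy's formula also gives uniqueness, and a value \<open>w\<close> attained only by the extension
  is excluded by extending \<open>1 / (f - w)\<close>.

  For vector-valued \<open>f\<close>, the Riemann sums of the integrals converge at a geometric rate when tested
  against any functional; by uniform boundedness they are then Cauchy for every seminorm, so sequential
  completeness provides the value of the extension. As \<open>\<psi> \<circ> f\<close> and its extension have the same range for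
  each functional \<open>\<psi>\<close>, the Hahn-Banach theorem puts the values into the closed convex hull.
\<close>

section \<open>Hartogs' theorem on separate analyticity\<close>

text \<open>\<open>X\<close> carries no topology, and membership in \<open>H_G\<close> controls
  \<open>f\<close> only along single complex lines. All analysis therefore takes place on planes
  \<open>a + l u + m v\<close>, where \<open>f\<close> is separately holomorphic but a priori not
  even locally bounded; hence Hartogs' theorem has to come first. For \<open>a\<close> outside
  \<open>K\<close> the contour still encloses the whole section of \<open>K\<close> on the line
  \<open>a + l u\<close>, so nothing local forces the integral to return \<open>f a\<close>. The
  value is pinned only where such sections are empty and must be carried over from there. The
  contour stays a formal sum over squares: the sections of \<open>K\<close> are arbitrary compact
  sets that vary with \<open>a\<close>, so an explicit cycle around them is awkward, whereas two
  grids can be compared by shrinking the enclosed set and halving the mesh, using only Cauchy's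
  theorem on a square and the cancellation of inner edges. For vector-valued \<open>f\<close> only
  the functions \<open>\<phi> \<circ> f\<close> are known to be regular, and no seminorm estimate of
  \<open>f\<close> is at hand; a rate of convergence of the Riemann sums takes its place.\<close>

lemma lborel_complex_eq_distr_vec:
  "(lborel :: complex measure) = distr (lborel :: (real^2) measure) borel (\<lambda>v. Complex (v $ 1) (v $ 2))"
    (is "_ = distr _ _ ?j")
proof (rule lborel_eqI)
  have j: "?j = (\<lambda>v. of_real (v $ 1) + \<i> * of_real (v $ 2))"
    by (simp add: fun_eq_iff complex_eq_iff)
  have "continuous_on UNIV ?j"
    unfolding j by (intro continuous_intros)
  then have [measurable]: "?j \<in> borel_measurable borel"
    by (rule borel_measurable_continuous_onI)
  show "sets (distr (lborel :: (real^2) measure) borel ?j) = sets borel" by simp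
  fix l u :: complex assume le: "\<And>b. b \<in> Basis \<Longrightarrow> l \<bullet> b \<le> u \<bullet> b"
  then have le': "Re l \<le> Re u" "Im l \<le> Im u" using le[of 1] le[of \<i>] by (simp_all add: Basis_complex_def)
  have Bas: "(Basis :: (real^2) set) = {axis 1 1, axis 2 1}"
    by (auto simp: Basis_vec_def UNIV_2)
  have ne: "axis 1 1 \<noteq> (axis 2 1 :: real^2)" by (simp add: axis_eq_axis)
  have box: "?j -` box l u = box (vector [Re l, Im l] :: real^2) (vector [Re u, Im u])"
    by (auto simp: in_box_complex_iff mem_box_cart forall_2 vector_2)
  have "emeasure (distr (lborel :: (real^2) measure) borel ?j) (box l u)
      = emeasure lborel (box (vector [Re l, Im l] :: real^2) (vector [Re u, Im u]))"
    by (subst emeasure_distr) (auto simp: box)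
  also have "\<dots> = (\<Prod>b\<in>Basis. (u - l) \<bullet> b)"
    by (subst emeasure_lborel_box)
       (use le' in \<open>auto simp: Bas ne Basis_complex_def inner_axis vector_2\<close>)
  finally show "emeasure (distr (lborel :: (real^2) measure) borel ?j) (box l u)
      = ennreal (\<Prod>b\<in>Basis. (u - l) \<bullet> b)" .
qed

text \<open>A linear map that scales the measure of all boxes by one factor scales every measurable
  set by it, so boxes suffice. Their images are compact, hence Borel, and can be moved to
  \<open>real^2\<close>, where multiplication by \<open>z\<close> is an orthogonal
  transformation.\<close>

lemma
  fixes z :: complex
  assumes z: "cmod z = 1" and S: "S \<in> lmeasurable"
  shows measurable_complex_rotation: "(\<lambda>q. q * z) ` S \<in> lmeasurable"
    and measure_complex_rotation: "measure lebesgue ((\<lambda>q. q * z) ` S) = measure lebesgue S"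
proof -
  let ?j = "\<lambda>v::real^2. Complex (v $ 1) (v $ 2)"
  let ?i = "\<lambda>q::complex. vector [Re q, Im q] :: real^2"
  let ?r = "\<lambda>v. ?i (?j v * z)"
  have ij: "?i (?j v) = v" for v by (simp add: vec_eq_iff forall_2 vector_2)
  have ji: "?j (?i q) = q" for q by (simp add: vector_2)
  have orth: "orthogonal_transformation ?r"
    unfolding orthogonal_transformation
  proof (intro conjI allI)
    show "linear ?r"
      by (intro linearI) (auto simp: vec_eq_iff forall_2 vector_2 algebra_simps)
    have nj: "norm (?i q) = cmod q" for q
      by (simp add: norm_vec_def L2_set_def sum_2 vector_2 cmod_def)
    have "norm (?r v) = cmod (?j v * z)" for v by (rule nj)
    moreover have "norm v = cmod (?j v)" for v using nj[of "?j v"] by (simp only: ij)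
    ultimately show "norm (?r v) = norm v" for v by (simp add: norm_mult z)
  qed
  have [measurable]: "?j \<in> borel_measurable borel"
  proof -
    have j: "?j = (\<lambda>v. of_real (v $ 1) + \<i> * of_real (v $ 2))"
      by (simp add: fun_eq_iff complex_eq_iff)
    have "continuous_on UNIV ?j"
      unfolding j by (intro continuous_intros)
    then show ?thesis by (rule borel_measurable_continuous_onI)
  qed
  have meas: "measure lebesgue T = measure lebesgue (?i ` T)" if "compact T" for T :: "complex set"
  proof -
    have Tb: "T \<in> sets borel" using that by (simp add: borel_closed compact_imp_closed)
    have pre: "?j -` T = ?i ` T"
      using ij ji by (auto simp: image_iff) (metis ij)
    have Tb': "?i ` T \<in> sets borel"
      using measurable_sets_borel[OF \<open>?j \<in> borel_measurable borel\<close> Tb] by (simp add: pre)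
    have "measure lebesgue T = measure lborel T" using Tb by simp
    also have "\<dots> = measure lborel (?j -` T)"
      by (subst lborel_complex_eq_distr_vec, subst measure_distr) (use Tb in auto)
    also have "\<dots> = measure lebesgue (?i ` T)" using Tb' by (simp add: pre)
    finally show ?thesis .
  qed
  have lin: "linear (\<lambda>q. q * z)" by (intro linearI) (auto simp: algebra_simps)
  have box: "measure lebesgue ((\<lambda>q. q * z) ` cbox a b) = 1 * measure lebesgue (cbox a b)" for a b
  proof -
    have comp: "compact ((\<lambda>q. q * z) ` cbox a b)"
      by (intro compact_continuous_image continuous_intros compact_cbox)
    have im: "?i ` cbox a b \<in> lmeasurable"
    proof -
      have "v \<in> ?i ` cbox a b" if "v \<in> cbox (?i a) (?i b)" for v
        by (rule image_eqI[where x = "?j v"], rule ij[symmetric])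
           (use that in \<open>auto simp: in_cbox_complex_iff mem_box_cart forall_2 vector_2\<close>)
      moreover have "?i q \<in> cbox (?i a) (?i b)" if "q \<in> cbox a b" for q
        using that by (auto simp: in_cbox_complex_iff mem_box_cart forall_2 vector_2)
      ultimately have "?i ` cbox a b = cbox (?i a) (?i b)" by blast
      then show ?thesis by simp
    qed
    have "?i ` (\<lambda>q. q * z) ` cbox a b = ?r ` ?i ` cbox a b"
      by (simp add: image_image vector_2)
    then have "measure lebesgue ((\<lambda>q. q * z) ` cbox a b) = measure lebesgue (?r ` ?i ` cbox a b)"
      using meas[OF comp] by simp
    also have "\<dots> = measure lebesgue (?i ` cbox a b)"
      by (rule measure_orthogonal_image[OF orth im])
    finally show ?thesis using meas[of "cbox a b"] by simp
  qed
  show "(\<lambda>q. q * z) ` S \<in> lmeasurable" "measure lebesgue ((\<lambda>q. q * z) ` S) = measure lebesgue S"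
    using measure_linear_sufficient[OF lin S box] by auto
qed

section \<open>A mean value inequality for the logarithm of the modulus\<close>

lemma ln_le_of_le_exp: "0 < y \<Longrightarrow> y \<le> exp x \<Longrightarrow> ln y \<le> (x::real)"
  by (metis exp_ln exp_le_cancel_iff)

lemma norm_cis_diff_le: "cmod (cis x - cis y) \<le> \<bar>x - y\<bar>"
proof -
  have "cis x - cis y = cis y * (exp (\<i> * of_real (x - y)) - 1)"
    by (simp add: cis_conv_exp algebra_simps exp_diff)
  then have "cmod (cis x - cis y) = 2 * \<bar>sin ((x - y) / 2)\<bar>"
    by (simp only: norm_mult dist_exp_i_1 norm_cis mult_1)
  also have "\<dots> \<le> \<bar>x - y\<bar>"
    using abs_sin_x_le_abs_x[of "(x - y) / 2"] by simp
  finally show ?thesis .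
qed

lemma root_of_unity_near:
  assumes "N > 0" "cmod l = 1"
  obtains w where "w ^ N = 1" "cmod (l - w) \<le> 2 * pi / real N"
proof -
  obtain t where t: "l = cis t"
    using assms(2) by (metis cis_Arg_unique complex_norm_eq_1_exp cis_conv_exp)
  define m where "m = \<lfloor>t * real N / (2 * pi)\<rfloor>"
  define w where "w = cis (2 * pi * of_int m / real N)"
  have "w ^ N = cis (real N * (2 * pi * of_int m / real N))"
    unfolding w_def by (rule Complex.DeMoivre)
  also have "real N * (2 * pi * of_int m / real N) = 2 * pi * of_int m"
    using assms(1) by simp
  also have "cis (2 * pi * of_int m) = 1"
    by (rule cis_multiple_2pi) simp
  finally have 1: "w ^ N = 1" .
  have "\<bar>t - 2 * pi * of_int m / real N\<bar> = (2 * pi / real N) * \<bar>t * real N / (2 * pi) - of_int m\<bar>"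
  proof -
    have "t - 2 * pi * of_int m / real N = (2 * pi / real N) * (t * real N / (2 * pi) - of_int m)"
      using assms(1) by (simp add: field_simps)
    then show ?thesis by (simp add: abs_mult)
  qed
  also have "\<dots> \<le> (2 * pi / real N) * 1"
    by (intro mult_left_mono) (unfold m_def, linarith, simp)
  finally have "cmod (l - w) \<le> 2 * pi / real N"
    using norm_cis_diff_le[of t "2 * pi * of_int m / real N"] by (simp add: t w_def)
  with 1 that show thesis by blast
qed

lemma norm_root_of_unity: "w ^ N = 1 \<Longrightarrow> N > 0 \<Longrightarrow> cmod w = 1"
  by (metis power_eq_1_iff less_irrefl_nat)

text \<open>The product of \<open>c (w + q * z * l)\<close> over the \<open>N\<close>-th roots of
  unity \<open>z\<close> is holomorphic in \<open>l\<close> with value \<open>c w ^ N\<close> at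
  \<open>0\<close>, so the maximum principle bounds it by its values on the unit circle. There
  \<open>l\<close> is close to a root \<open>v\<close>; uniform continuity of \<open>F\<close>
  allows replacing \<open>l\<close> by \<open>v\<close> at the cost \<open>e\<close> per factor, and
  multiplication by \<open>v\<close> permutes the roots. Zeros of \<open>c\<close> and integrability
  of its logarithm never come up.\<close>

lemma log_mean_roots_of_unity:
  fixes c :: "complex \<Rightarrow> complex" and F :: "complex \<Rightarrow> real"
  assumes r: "r > 0" and hol: "c holomorphic_on ball w r" and contc: "continuous_on (cball w r) c"
    and contF: "continuous_on (cball w r) F"
    and le: "\<And>q. q \<in> cball w r \<Longrightarrow> cmod (c q) \<le> exp (F q)" and e: "e > 0"
  obtains N where "N > 0"
    "\<And>q. q \<in> cball 0 r \<Longrightarrow> cmod (c w) ^ N \<le> exp ((\<Sum>z | z ^ N = 1. F (w + q * z)) + real N * e)"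
proof -
  have "uniformly_continuous_on (cball w r) F"
    by (simp add: compact_uniformly_continuous contF)
  then obtain d where d: "d > 0"
    and dF: "\<And>x y. x \<in> cball w r \<Longrightarrow> y \<in> cball w r \<Longrightarrow> dist x y < d \<Longrightarrow> dist (F x) (F y) < e"
    unfolding uniformly_continuous_on_def using e by metis
  obtain N :: nat where N: "real N > 2 * pi * r / d"
    using reals_Archimedean2 by blast
  have N0: "N > 0"
    using N r d by (metis divide_pos_pos less_trans mult_pos_pos of_nat_0_less_iff pi_gt_zero zero_less_numeral)
  define R where "R = {z::complex. z ^ N = 1}"
  have finR: "finite R" unfolding R_def using N0 by (rule finite_nth_roots)
  have cardR: "card R = N" unfolding R_def using N0 by (rule card_roots_unity_eq)
  have normR: "cmod z = 1" if "z \<in> R" for z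
    using that N0 by (auto simp: R_def norm_root_of_unity)
  have main: "cmod (c w) ^ N \<le> exp ((\<Sum>z\<in>R. F (w + q * z)) + real N * e)" if q: "q \<in> cball 0 r" for q
  proof -
    define g where "g = (\<lambda>l. \<Prod>z\<in>R. c (w + q * z * l))"
    have inc: "w + q * z * l \<in> cball w r" if "z \<in> R" "cmod l \<le> 1" for z l
      using q normR[OF that(1)] that(2) mult_mono[of "cmod q" r "cmod l" 1] r
      by (simp add: dist_norm norm_mult)
    have inb: "w + q * z * l \<in> ball w r" if "z \<in> R" "cmod l < 1" for z l
    proof -
      have "cmod q * cmod l \<le> r * cmod l" using q by (simp add: mult_right_mono)
      also have "\<dots> < r" using that r by simp
      finally show ?thesis using normR[OF that(1)] by (simp add: dist_norm norm_mult)
    qed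
    have "norm (g 0) \<le> exp ((\<Sum>z\<in>R. F (w + q * z)) + real N * e)"
    proof (rule maximum_modulus_frontier[where S = "cball 0 1" and f = g])
      show "g holomorphic_on interior (cball 0 1)"
      proof -
        have "(\<lambda>l. c (w + q * z * l)) holomorphic_on ball 0 1" if z: "z \<in> R" for z
          by (rule holomorphic_on_compose_gen[OF _ hol, unfolded o_def])
             (use inb[OF z] in \<open>auto intro!: holomorphic_intros simp del: mem_ball\<close>)
        then show ?thesis
          unfolding g_def interior_cball by (intro holomorphic_on_prod)
      qed
      show "continuous_on (closure (cball 0 1)) g"
      proof -
        have "continuous_on (closure (cball 0 1)) (\<lambda>l. c (w + q * z * l))" if z: "z \<in> R" for z
          by (rule continuous_on_compose2[OF contc])
             (use inc[OF z] in \<open>auto intro!: continuous_intros simp del: mem_cball simp: dist_norm\<close>)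
        then show ?thesis
          unfolding g_def by (intro continuous_on_prod)
      qed
      show "bounded (cball (0::complex) 1)" by simp
      show "(0::complex) \<in> cball 0 1" by simp
      fix l :: complex assume "l \<in> frontier (cball 0 1)"
      then have l: "cmod l = 1" by (simp add: dist_norm)
      obtain v where v: "v ^ N = 1" "cmod (l - v) \<le> 2 * pi / real N"
        using root_of_unity_near[OF N0 l] by blast
      have vR: "v \<in> R" using v by (simp add: R_def)
      have "norm (g l) = (\<Prod>z\<in>R. cmod (c (w + q * z * l)))"
        by (simp add: g_def prod_norm)
      also have "\<dots> \<le> (\<Prod>z\<in>R. exp (F (w + q * (v * z)) + e))"
      proof (rule prod_mono, intro conjI norm_ge_zero)
        fix z assume z: "z \<in> R"
        have "dist (w + q * z * l) (w + q * z * v) = cmod q * cmod (l - v)"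
          using normR[OF z] by (simp add: dist_norm norm_mult flip: right_diff_distrib)
        also have "\<dots> \<le> r * (2 * pi / real N)"
          using q v r by (intro mult_mono) auto
        also have "\<dots> < d" using N d N0 r by (simp add: field_simps)
        finally have "dist (F (w + q * z * l)) (F (w + q * z * v)) < e"
          using dF inc[OF z] l normR[OF vR] by simp
        then have "\<bar>F (w + q * z * l) - F (w + q * z * v)\<bar> < e"
          by (simp only: dist_real_def)
        moreover have "q * z * v = q * (v * z)" by simp
        ultimately have "F (w + q * z * l) \<le> F (w + q * (v * z)) + e"
          by simp
        then show "cmod (c (w + q * z * l)) \<le> exp (F (w + q * (v * z)) + e)"
          by (intro order_trans[OF le[OF inc[OF z]]]) (use l in auto)
      qed
      also have "\<dots> = exp (\<Sum>z\<in>R. F (w + q * (v * z)) + e)"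
        by (simp add: exp_sum finR)
      also have "(\<Sum>z\<in>R. F (w + q * (v * z)) + e) = (\<Sum>z\<in>R. F (w + q * (v * z))) + real N * e"
        by (simp add: sum.distrib cardR)
      also have "(\<Sum>z\<in>R. F (w + q * (v * z))) = (\<Sum>z\<in>R. F (w + q * z))"
      proof (rule sum.reindex_bij_witness[where i = "\<lambda>z. z / v" and j = "\<lambda>z. v * z"])
        have "v \<noteq> 0" using normR[OF vR] by auto
        then show "v * z / v = z" "v * (z' / v) = z'" for z z' by auto
        show "v * z \<in> R" if "z \<in> R" for z using that v by (simp add: R_def power_mult_distrib)
        show "z / v \<in> R" if "z \<in> R" for z using that v by (simp add: R_def power_divide)
      qed auto
      finally show "norm (g l) \<le> exp ((\<Sum>z\<in>R. F (w + q * z)) + real N * e)" .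
    qed
    moreover have "norm (g 0) = cmod (c w) ^ N"
      by (simp add: g_def cardR norm_power)
    ultimately show ?thesis by simp
  qed
  show thesis
    by (rule that[OF N0]) (use main in \<open>simp add: R_def\<close>)
qed

text \<open>Averaging the preceding inequality over \<^term>\<open>q\<close> needs only the rotation invariance of
  Lebesgue measure.\<close>

lemma log_mean_measure:
  fixes c :: "complex \<Rightarrow> complex"
  assumes r: "r > 0" and hol: "c holomorphic_on ball w r" and contc: "continuous_on (cball w r) c"
    and bad: "bad \<in> lmeasurable" and b: "b \<ge> 0"
    and good: "\<And>q. q \<in> cball w r \<Longrightarrow> q \<notin> bad \<Longrightarrow> cmod (c q) \<le> exp a"
    and all: "\<And>q. q \<in> cball w r \<Longrightarrow> cmod (c q) \<le> exp (a + b)"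
  shows "cmod (c w) \<le> exp (a + b * (measure lebesgue bad / measure lebesgue (cball w r)))"
proof (cases "c w = 0")
  case False
  define L where "L = ln (cmod (c w))"
  define D where "D = cball (0::complex) r"
  define m where "m = measure lebesgue D"
  have m: "m > 0" using content_cball_pos[OF r, of "0::complex"] by (simp add: m_def D_def)
  \<comment> \<open>The truncation at \<open>exp a\<close> keeps the logarithm continuous at the
    zeros of \<open>c\<close>.\<close>
  define F where "F = (\<lambda>q. ln (max (cmod (c q)) (exp a)))"
  have pos: "max (cmod (c q)) (exp a) > 0" for q by (simp add: less_max_iff_disj)
  have contF: "continuous_on (cball w r) F"
    unfolding F_def by (intro continuous_intros contc) (use pos in \<open>auto simp: less_le\<close>)
  have leF: "cmod (c q) \<le> exp (F q)" for q
    using pos[of q] by (simp add: F_def)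
  have Fa: "F q \<le> a + b * indicator bad q" if "q \<in> cball w r" for q
  proof (cases "q \<in> bad")
    case True
    then show ?thesis using all[OF that] b pos[of q]
      unfolding F_def by (intro ln_le_of_le_exp) auto
  next
    case False
    then show ?thesis using good[OF that] by (simp add: F_def max_def)
  qed
  have key: "(L - a - e) * m \<le> b * measure lebesgue bad" if e: "e > 0" for e
  proof -
    obtain N where N: "N > 0"
      and *: "\<And>q. q \<in> cball 0 r \<Longrightarrow> cmod (c w) ^ N \<le> exp ((\<Sum>z | z ^ N = 1. F (w + q * z)) + real N * e)"
      using log_mean_roots_of_unity[OF r hol contc contF leF e] by blast
    define R where "R = {z::complex. z ^ N = 1}"
    have finR: "finite R" unfolding R_def using N by (rule finite_nth_roots)
    have cardR: "card R = N" unfolding R_def using N by (rule card_roots_unity_eq)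
    \<comment> \<open>Up to a translation and a rotation, \<open>A z\<close> is the part of
      \<open>bad\<close> inside the disc, so its measure is at most that of \<open>bad\<close> for
      every root \<open>z\<close>.\<close>
    define A where "A = (\<lambda>z. {q \<in> D. w + q * z \<in> bad})"
    have A: "A z \<in> lmeasurable \<and> measure lebesgue (A z) \<le> measure lebesgue bad" if "z \<in> R" for z
    proof -
      have z1: "cmod z = 1" using that N by (auto simp: R_def norm_root_of_unity)
      then have z0: "z \<noteq> 0" by auto
      define B where "B = (+) (- w) ` (bad \<inter> cball w r)"
      have bm: "bad \<inter> cball w r \<in> lmeasurable" using bad by (simp add: fmeasurable.Int)
      have B: "B \<in> lmeasurable" "measure lebesgue B = measure lebesgue (bad \<inter> cball w r)"
        unfolding B_def by (rule measurable_translation[OF bm], rule measure_translation)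
      have iz: "cmod (inverse z) = 1" by (simp add: norm_inverse z1)
      have "A z = (\<lambda>q. q * inverse z) ` B"
      proof (intro set_eqI iffI)
        fix q assume "q \<in> A z"
        then have "q * z \<in> B" unfolding A_def B_def D_def
          by (auto simp: z1 norm_mult dist_norm intro!: image_eqI[where x = "w + q * z"])
        then show "q \<in> (\<lambda>q. q * inverse z) ` B"
          by (intro image_eqI[where x = "q * z"]) (use z0 in auto)
      next
        fix q assume "q \<in> (\<lambda>q. q * inverse z) ` B"
        then obtain p where p: "p \<in> bad" "p \<in> cball w r" "q = (p - w) * inverse z"
          unfolding B_def by auto
        moreover have "w + q * z = p" using p z0 by (simp add: field_simps)
        ultimately show "q \<in> A z"
          using z0 by (auto simp: A_def D_def dist_norm norm_mult norm_inverse z1 norm_minus_commute)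
      qed
      then have "A z \<in> lmeasurable" "measure lebesgue (A z) = measure lebesgue B"
        using measurable_complex_rotation[OF iz B(1)] measure_complex_rotation[OF iz B(1)] by auto
      moreover have "measure lebesgue (bad \<inter> cball w r) \<le> measure lebesgue bad"
        using bad bm by (intro measure_mono_fmeasurable) auto
      ultimately show ?thesis using B by simp
    qed
    \<comment> \<open>Each root contributes \<open>a\<close> to the sum of \<open>F\<close>, and
      \<open>b\<close> more only if it moves \<open>q\<close> into \<open>bad\<close>. Integrating
      over \<open>q\<close> bounds the total excess by \<open>N * b\<close> times the measure of
      \<open>bad\<close>.\<close>
    have pt: "(real N * (L - a - e)) * indicat_real D q \<le> b * (\<Sum>z\<in>R. indicat_real (A z) q)" for q
    proof (cases "q \<in> D")
      case True
      have "real N * L = ln (cmod (c w) ^ N)"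
        using False by (simp add: L_def ln_realpow)
      also have "\<dots> \<le> (\<Sum>z\<in>R. F (w + q * z)) + real N * e"
        using * True False by (intro ln_le_of_le_exp) (auto simp: R_def D_def)
      also have "(\<Sum>z\<in>R. F (w + q * z)) \<le> (\<Sum>z\<in>R. a + b * indicat_real (A z) q)"
      proof (rule sum_mono)
        fix z assume z: "z \<in> R"
        then have "cmod z = 1" using N by (auto simp: R_def norm_root_of_unity)
        then have "w + q * z \<in> cball w r" using True by (simp add: D_def norm_mult dist_norm)
        from Fa[OF this] show "F (w + q * z) \<le> a + b * indicat_real (A z) q"
          using True by (simp add: A_def indicator_def)
      qed
      also have "\<dots> = real N * a + b * (\<Sum>z\<in>R. indicat_real (A z) q)"
        by (simp add: sum.distrib cardR sum_distrib_left)
      finally show ?thesis using True by (simp add: algebra_simps)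
    next
      case False
      then show ?thesis using b by (auto intro!: mult_nonneg_nonneg sum_nonneg)
    qed
    have Dm: "D \<in> lmeasurable" by (simp add: D_def)
    have iA: "integrable lebesgue (indicat_real (A z))" if "z \<in> R" for z
      using A[OF that] lmeasurable_iff_integrable by blast
    have iD: "integrable lebesgue (indicat_real D)"
      using Dm lmeasurable_iff_integrable by blast
    have "(real N * (L - a - e)) * m = (\<integral>q. (real N * (L - a - e)) * indicat_real D q \<partial>lebesgue)"
      using Dm by (simp add: m_def)
    also have "\<dots> \<le> (\<integral>q. b * (\<Sum>z\<in>R. indicat_real (A z) q) \<partial>lebesgue)"
      by (intro integral_mono integrable_mult_right Bochner_Integration.integrable_sum iA iD pt)
    also have "\<dots> = b * (\<Sum>z\<in>R. measure lebesgue (A z))"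
    proof -
      have "(\<integral>q. (\<Sum>z\<in>R. indicat_real (A z) q) \<partial>lebesgue)
          = (\<Sum>z\<in>R. (\<integral>q. indicat_real (A z) q \<partial>lebesgue))"
        by (rule Bochner_Integration.integral_sum[OF iA])
      then show ?thesis by simp
    qed
    also have "\<dots> \<le> b * (\<Sum>z\<in>R. measure lebesgue bad)"
      using A b by (intro mult_left_mono sum_mono) auto
    also have "\<dots> = real N * (b * measure lebesgue bad)" by (simp add: cardR)
    finally have "real N * ((L - a - e) * m) \<le> real N * (b * measure lebesgue bad)"
      by (simp add: mult_ac)
    then show ?thesis using N by simp
  qed
  have "L \<le> a + b * (measure lebesgue bad / m)"
  proof (rule field_le_epsilon)
    fix e :: real assume "e > 0"
    from key[OF this] have "L - a - e \<le> b * measure lebesgue bad / m"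
      using m by (simp add: pos_le_divide_eq)
    then show "L \<le> a + b * (measure lebesgue bad / m) + e" by simp
  qed
  moreover have "measure lebesgue (cball w r) = m"
    using r by (simp add: m_def D_def content_cball)
  ultimately have "exp L \<le> exp (a + b * (measure lebesgue bad / measure lebesgue (cball w r)))"
    by simp
  then show ?thesis using False by (simp add: L_def)
qed simp

section \<open>From pointwise to locally uniform growth rates\<close>

text \<open>The open sets where the rate \<open>B\<close> fails for some index from \<open>N\<close>
  on decrease to the empty set, so their measures tend to \<open>0\<close>. Averaged over discs of
  radius \<open>R / 2\<close>, the crude global rate is felt only on such a small set, and its
  effect fits into the gap between \<open>ln B\<close> and \<open>ln B'\<close>.\<close>

lemma hartogs_lemma:
  fixes c :: "nat \<Rightarrow> complex \<Rightarrow> complex"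
  assumes R: "R > 0" and hol: "\<And>n. c n holomorphic_on ball w0 R"
    and bound: "\<And>n w. w \<in> ball w0 R \<Longrightarrow> cmod (c n w) \<le> k * M ^ n" and M: "M \<ge> 0"
    and pointwise: "\<And>w. w \<in> ball w0 R \<Longrightarrow> \<exists>N. \<forall>n\<ge>N. cmod (c n w) \<le> B ^ n"
    and B: "0 < B" "B < B'"
  obtains N where "\<And>n w. n \<ge> N \<Longrightarrow> w \<in> ball w0 (R / 2) \<Longrightarrow> cmod (c n w) \<le> B' ^ n"
proof -
  \<comment> \<open>Absorbs the constant \<open>k\<close> into the base of the power, which is
    possible only for exponents \<open>n \<ge> 1\<close>.\<close>
  define k1 M1 M' where "k1 = max 1 k" and "M1 = max 1 M" and "M' = max B (k1 * M1)"
  have bound': "cmod (c n w) \<le> M' ^ n" if "w \<in> ball w0 R" "n \<ge> 1" for n w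
  proof -
    have "k * M ^ n \<le> k1 * M1 ^ n"
      using M by (intro mult_mono power_mono) (auto simp: k1_def M1_def)
    also have "\<dots> \<le> k1 ^ n * M1 ^ n"
      using that(2) by (intro mult_right_mono self_le_power) (auto simp: k1_def M1_def)
    also have "\<dots> \<le> M' ^ n"
      unfolding power_mult_distrib[symmetric] by (intro power_mono) (auto simp: M'_def k1_def M1_def)
    finally show ?thesis using bound[OF that(1), of n] by linarith
  qed
  have M': "M' \<ge> B" "M' > 0" using B by (auto simp: M'_def)
  define b where "b = ln M' - ln B"
  have b: "b \<ge> 0" using M' B by (simp add: b_def)
  define bad where "bad = (\<lambda>N. \<Union>n\<in>{N..}. {w \<in> ball w0 R. cmod (c n w) > B ^ n})"
  have open_bad: "open (bad N)" for N
    unfolding bad_def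
  proof (intro open_UN ballI)
    fix n
    have "continuous_on (ball w0 R) (\<lambda>w. cmod (c n w))"
      by (intro continuous_intros holomorphic_on_imp_continuous_on hol)
    then have "open (ball w0 R \<inter> (\<lambda>w. cmod (c n w)) -` {B ^ n<..})"
      by (intro continuous_open_preimage) auto
    moreover have "ball w0 R \<inter> (\<lambda>w. cmod (c n w)) -` {B ^ n<..} = {w \<in> ball w0 R. cmod (c n w) > B ^ n}"
      by auto
    ultimately show "open {w \<in> ball w0 R. cmod (c n w) > B ^ n}" by simp
  qed
  have bad_meas: "bad N \<in> lmeasurable" for N
  proof (rule lmeasurable_open[OF _ open_bad])
    show "bounded (bad N)" by (rule bounded_subset[OF bounded_ball[of w0 R]]) (auto simp: bad_def)
  qed
  define m where "m = measure lebesgue (cball w0 (R / 2))"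
  have m: "m > 0" using content_cball_pos[of "R / 2" w0] R by (simp add: m_def)
  have "(\<lambda>N. measure lebesgue (bad N)) \<longlonglongrightarrow> measure lebesgue (\<Inter>N. bad N)"
  proof (rule Lim_measure_decseq)
    show "range bad \<subseteq> sets lebesgue" using bad_meas by auto
    show "decseq bad" unfolding decseq_def bad_def by (intro allI impI UN_mono) auto
    show "emeasure lebesgue (bad i) \<noteq> \<infinity>" for i
      using fmeasurableD2[OF bad_meas] by simp
  qed
  also have "(\<Inter>N. bad N) = {}"
  proof -
    have "w \<notin> (\<Inter>N. bad N)" for w
    proof
      assume w: "w \<in> (\<Inter>N. bad N)"
      then have "w \<in> ball w0 R" by (auto simp: bad_def)
      then obtain N where "\<forall>n\<ge>N. cmod (c n w) \<le> B ^ n" using pointwise by blast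
      moreover have "w \<in> bad N" using w by blast
      ultimately show False unfolding bad_def by force
    qed
    then show ?thesis by blast
  qed
  finally have "(\<lambda>N. measure lebesgue (bad N)) \<longlonglongrightarrow> 0" by simp
  \<comment> \<open>The summand \<open>1\<close> in the denominator covers the case
    \<open>b = 0\<close>, that is \<open>M' = B\<close>.\<close>
  moreover have "(ln B' - ln B) * m / (b + 1) > 0" using B b m by simp
  ultimately have "eventually (\<lambda>N. measure lebesgue (bad N) < (ln B' - ln B) * m / (b + 1)) sequentially"
    by (rule order_tendstoD(2))
  then obtain N where N: "measure lebesgue (bad N) < (ln B' - ln B) * m / (b + 1)"
    by (meson eventually_sequentially order_refl)
  have small: "b * (measure lebesgue (bad N) / m) \<le> ln B' - ln B"
  proof -
    have "b * measure lebesgue (bad N) \<le> (b + 1) * measure lebesgue (bad N)"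
      by (simp add: mult_right_mono)
    also have "\<dots> \<le> (ln B' - ln B) * m" using N b by (simp add: field_simps)
    finally show ?thesis using m by (simp add: field_simps)
  qed
  show thesis
  \<comment> \<open>The successor guarantees \<open>n \<ge> 1\<close>, as \<open>bound'\<close>
    demands.\<close>
  proof (rule that[of "Suc N"])
    fix n w assume n: "n \<ge> Suc N" and w: "w \<in> ball w0 (R / 2)"
    have sub: "cball w (R / 2) \<subseteq> ball w0 R"
    proof
      fix x assume "x \<in> cball w (R / 2)"
      then show "x \<in> ball w0 R" using w dist_triangle[of w0 x w] by simp
    qed
    have eq: "exp (real n * ln x) = x ^ n" if "x > 0" for x
      using that by (metis exp_ln exp_of_nat_mult)
    have "cmod (c n w) \<le> exp (real n * ln B + real n * b * (measure lebesgue (bad N) / measure lebesgue (cball w (R / 2))))"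
    proof (rule log_mean_measure[OF _ _ _ bad_meas])
      show "c n holomorphic_on ball w (R / 2)"
        by (rule holomorphic_on_subset[OF hol]) (use sub in force)
      show "continuous_on (cball w (R / 2)) (c n)"
        by (rule continuous_on_subset[OF holomorphic_on_imp_continuous_on[OF hol] sub])
      show "0 \<le> real n * b" using b by simp
      fix q assume q: "q \<in> cball w (R / 2)"
      then have q': "q \<in> ball w0 R" using sub by blast
      show "cmod (c n q) \<le> exp (real n * ln B)" if "q \<notin> bad N"
      proof -
        have "n \<in> {N..}" using n by simp
        then have "\<not> cmod (c n q) > B ^ n"
          using that q' unfolding bad_def by blast
        then show ?thesis unfolding eq[OF B(1)] by simp
      qed
      have "real n * ln B + real n * b = real n * ln M'" by (simp add: b_def algebra_simps)
      then show "cmod (c n q) \<le> exp (real n * ln B + real n * b)"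
        using bound'[OF q', of n] n eq[OF M'(2)] by simp
    qed (use R in auto)
    also have "measure lebesgue (cball w (R / 2)) = m"
      using R by (simp add: m_def content_cball)
    also have "real n * ln B + real n * b * (measure lebesgue (bad N) / m)
        = real n * (ln B + b * (measure lebesgue (bad N) / m))" by (simp add: algebra_simps)
    also have "exp \<dots> \<le> exp (real n * ln B')"
      using small by (simp add: mult_left_mono)
    also have "\<dots> = B' ^ n" using B by (intro eq) simp
    finally show "cmod (c n w) \<le> B' ^ n" .
  qed
qed

section \<open>Joint continuity of separately holomorphic functions\<close>

text \<open>A geometric tail of ratio at most \<open>1 / 2\<close>, whence the factor
  \<open>2\<close>. It makes the recovery of Taylor coefficients from difference quotients uniform
  in a parameter.\<close>

lemma power_series_tail_bound:
  fixes a :: "nat \<Rightarrow> complex"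
  assumes sums: "(\<lambda>m. a m * x ^ m) sums y" and a: "\<And>m. cmod (a m) \<le> C / s ^ m"
    and s: "s > 0" and x: "cmod x \<le> s / 2"
  shows "cmod (y - (\<Sum>m<n. a m * x ^ m)) \<le> 2 * C * (cmod x / s) ^ n"
proof -
  define q where "q = cmod x / s"
  have q: "0 \<le> q" "q \<le> 1 / 2" using s x by (auto simp: q_def field_simps)
  have C: "C \<ge> 0" using order_trans[OF norm_ge_zero a[of 0]] by simp
  have "(\<lambda>m. a (m + n) * x ^ (m + n)) sums (y - (\<Sum>m<n. a m * x ^ m))"
    using sums by (rule sums_split_initial_segment)
  moreover have "(\<lambda>m. C * q ^ n * q ^ m) sums (C * q ^ n * (1 / (1 - q)))"
    using q by (intro sums_mult geometric_sums) auto
  moreover have "cmod (a (m + n) * x ^ (m + n)) \<le> C * q ^ n * q ^ m" for m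
  proof -
    have "cmod (a (m + n) * x ^ (m + n)) \<le> C / s ^ (m + n) * cmod x ^ (m + n)"
      unfolding norm_mult norm_power by (intro mult_right_mono a) auto
    also have "\<dots> = C * q ^ n * q ^ m" by (simp add: q_def power_divide power_add mult_ac)
    finally show ?thesis .
  qed
  ultimately have "cmod (y - (\<Sum>m<n. a m * x ^ m)) \<le> C * q ^ n * (1 / (1 - q))"
    by (metis (no_types, lifting) sums_iff norm_suminf_le)
  also have "\<dots> \<le> C * q ^ n * 2"
    using q C by (intro mult_left_mono) (auto simp: field_simps)
  finally show ?thesis by (simp add: q_def mult_ac)
qed

text \<open>Baire's theorem yields a small disc around some \<open>z1\<close> near \<open>z0\<close>
  over which \<open>f\<close> is bounded uniformly in \<open>w\<close>. The Taylor series in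
  \<open>z\<close> at \<open>z1\<close> then has coefficients holomorphic in \<open>w\<close>, and
  it converges on a large disc for each \<open>w\<close>; Hartogs' lemma makes this convergence
  uniform on a bidisc that reaches \<open>(z0, w0)\<close>. The radii descend from
  \<open>4 * R\<close> to \<open>3 * R\<close> because \<open>z1\<close> is within \<open>R\<close>
  of \<open>z0\<close>.\<close>

lemma hartogs_polydisc:
  fixes f :: "complex \<Rightarrow> complex \<Rightarrow> complex"
  assumes R: "R > 0"
    and h1: "\<And>w. w \<in> ball w0 (4 * R) \<Longrightarrow> (\<lambda>z. f z w) holomorphic_on ball z0 (4 * R)"
    and h2: "\<And>z. z \<in> ball z0 (4 * R) \<Longrightarrow> f z holomorphic_on ball w0 (4 * R)"
  shows "isCont (\<lambda>p. f (fst p) (snd p)) (z0, w0)"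
proof -
  define A where "A = cball z0 R"
  define E where "E = (\<lambda>k::nat. {z \<in> A. \<forall>w \<in> cball w0 (3 * R). cmod (f z w) \<le> real k})"
  have AR: "A \<subseteq> ball z0 (4 * R)" using R by (auto simp: A_def)
  have W3: "cball w0 (3 * R) \<subseteq> ball w0 (4 * R)" using R by auto
  have closedE: "closed (E k)" for k
  proof -
    have *: "closed {z \<in> A. cmod (f z w) \<le> real k}" if "w \<in> cball w0 (3 * R)" for w
    proof -
      have "continuous_on A (\<lambda>z. cmod (f z w))"
        by (intro continuous_intros continuous_on_subset[OF holomorphic_on_imp_continuous_on[OF h1] AR])
           (use W3 that in auto)
      then have "closed (A \<inter> (\<lambda>z. cmod (f z w)) -` {..real k})"
        by (intro continuous_closed_preimage) (auto simp: A_def)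
      moreover have "A \<inter> (\<lambda>z. cmod (f z w)) -` {..real k} = {z \<in> A. cmod (f z w) \<le> real k}" by auto
      ultimately show ?thesis by simp
    qed
    have "E k = (\<Inter>w\<in>cball w0 (3 * R). {z \<in> A. cmod (f z w) \<le> real k})"
    proof -
      have "w0 \<in> cball w0 (3 * R)" using R by simp
      then show ?thesis unfolding E_def by blast
    qed
    then show ?thesis using * by auto
  qed
  have covE: "A \<subseteq> (\<Union>k. E k)"
  proof
    fix z assume z: "z \<in> A"
    have "continuous_on (cball w0 (3 * R)) (f z)"
      by (rule continuous_on_subset[OF holomorphic_on_imp_continuous_on[OF h2] W3]) (use z AR in auto)
    then have "bounded (f z ` cball w0 (3 * R))"
      by (intro compact_imp_bounded compact_continuous_image) auto
    then obtain b where b: "\<And>w. w \<in> cball w0 (3 * R) \<Longrightarrow> cmod (f z w) \<le> b"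
      unfolding bounded_iff by blast
    obtain k :: nat where "b \<le> real k" using real_arch_simple by blast
    then have "z \<in> E k" using z b by (force simp: E_def)
    then show "z \<in> (\<Union>k. E k)" by blast
  qed
  \<comment> \<open>If every \<open>E k\<close> had dense complement in the closed disc
    \<open>A\<close>, the intersection of these complements would be dense in \<open>A\<close>; it
    is empty.\<close>
  have "\<exists>k. \<not> A \<subseteq> closure (A - E k)"
  proof (rule ccontr)
    assume "\<nexists>k. \<not> A \<subseteq> closure (A - E k)"
    then have "A \<subseteq> closure (\<Inter>(range (\<lambda>k. A - E k)))"
    proof (intro Baire)
      show "closed A" by (simp add: A_def)
      fix T assume "T \<in> range (\<lambda>k. A - E k)"
      then obtain k where k: "T = A - E k" by blast
      have "closedin (top_of_set A) (E k)"
        by (rule closed_subset[OF _ closedE]) (auto simp: E_def)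
      then show "openin (top_of_set A) T \<and> A \<subseteq> closure T"
        using k \<open>\<nexists>k. \<not> A \<subseteq> closure (A - E k)\<close> by auto
    qed simp
    moreover have "(\<Inter>(range (\<lambda>k. A - E k))) = {}" using covE by auto
    ultimately have "A \<subseteq> closure {}" by (simp only:)
    then show False using R by (simp add: A_def)
  qed
  then obtain k z where z: "z \<in> A" "z \<notin> closure (A - E k)" by blast
  then obtain s where s: "s > 0" "ball z s \<inter> (A - E k) = {}"
  proof -
    obtain s where "s > 0" "\<And>y. y \<in> A - E k \<Longrightarrow> \<not> dist y z < s"
      using z(2) unfolding closure_approachable by blast
    then show thesis by (intro that[of s]) (auto simp: dist_commute)
  qed
  have "z \<in> closure (ball z0 R)" using z R by (simp add: A_def)
  then obtain z1 where z1: "z1 \<in> ball z0 R" "z1 \<in> ball z s"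
    using s(1) by (metis closure_approachable dist_commute mem_ball)
  then have "z1 \<in> ball z0 R \<inter> ball z s" "open (ball z0 R \<inter> ball z s)" by auto
  then obtain t where t: "t > 0" "cball z1 t \<subseteq> ball z0 R \<inter> ball z s"
    using open_contains_cball by blast
  have tE: "cmod (f x w) \<le> real k" if "x \<in> cball z1 t" "w \<in> cball w0 (3 * R)" for x w
  proof -
    have "x \<in> A" "x \<in> ball z s" using that t by (auto simp: A_def less_imp_le)
    then have "x \<in> E k" using s by blast
    then show ?thesis using that by (simp add: E_def)
  qed
  have B3: "ball z1 (3 * R) \<subseteq> ball z0 (4 * R)"
  proof
    fix x assume "x \<in> ball z1 (3 * R)"
    then show "x \<in> ball z0 (4 * R)" using z1(1) dist_triangle[of z0 x z1] by simp
  qed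
  have tR: "cball z1 t \<subseteq> ball z0 (4 * R)" using t R by force
  define c where "c = (\<lambda>n w. (deriv ^^ n) (\<lambda>z. f z w) z1 / fact n)"
  have W: "w \<in> ball w0 (4 * R)" if "w \<in> ball w0 (3 * R)" for w using that R by auto
  have c_bound: "cmod (c n w) \<le> real k / t ^ n" if "w \<in> ball w0 (3 * R)" for n w
  proof -
    have "cmod ((deriv ^^ n) (\<lambda>z. f z w) z1) \<le> fact n * real k / t ^ n"
    proof (rule Cauchy_inequality)
      show "(\<lambda>z. f z w) holomorphic_on ball z1 t"
        by (rule holomorphic_on_subset[OF h1[OF W[OF that]]]) (use tR in force)
      show "continuous_on (cball z1 t) (\<lambda>z. f z w)"
        by (rule continuous_on_subset[OF holomorphic_on_imp_continuous_on[OF h1[OF W[OF that]]] tR])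
      show "cmod (f x w) \<le> real k" if "cmod (z1 - x) = t" for x
        using that \<open>w \<in> ball w0 (3 * R)\<close> by (intro tE) (auto simp: dist_norm)
    qed (rule t)
    then show ?thesis by (simp add: c_def norm_divide field_simps)
  qed
  have c_sums: "(\<lambda>n. c n w * (x - z1) ^ n) sums f x w"
    if "w \<in> ball w0 (3 * R)" "x \<in> ball z1 (3 * R)" for w x
    unfolding c_def
    by (rule holomorphic_power_series[where r = "3 * R"])
       (use that B3 in \<open>auto intro: holomorphic_on_subset[OF h1[OF W]]\<close>)
  have t3: "t < 3 * R"
  proof -
    have "z1 + of_real t \<in> cball z1 t" using t by (simp add: dist_norm)
    then have "z1 + of_real t \<in> ball z0 R" using t by blast
    then have "dist z1 (z1 + of_real t) < R + R"
      using z1(1) dist_triangle2[of z1 "z1 + of_real t" z0] by (simp add: dist_commute)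
    then show ?thesis using t R by (simp add: dist_norm)
  qed
  \<comment> \<open>Without joint continuity there is no differentiating in \<open>z\<close> under
    an integral. Instead \<open>c n\<close> is a uniform limit of difference quotients built from
    \<open>f (z1 + h)\<close> and the earlier coefficients, all holomorphic in \<open>w\<close>; by
    the tail bound, applicable since \<open>h j \<le> t / 2\<close>, the error is of order
    \<open>h j\<close>.\<close>
  have c_hol: "c n holomorphic_on ball w0 (3 * R)" for n
  proof (induction n rule: less_induct)
    case (less n)
    define h where "h = (\<lambda>j. t / 2 / real (Suc j))"
    have h: "0 < h j" "h j \<le> t / 2" for j
      using t by (auto simp: h_def divide_simps)
    define g where "g = (\<lambda>j w. (f (z1 + of_real (h j)) w - (\<Sum>m<n. c m w * of_real (h j) ^ m)) / of_real (h j) ^ n)"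
    have hz: "z1 + of_real (h j) \<in> ball z1 (3 * R)" for j
      using h[of j] t3 t by (simp add: dist_norm)
    have ghol: "g j holomorphic_on ball w0 (3 * R)" for j
      unfolding g_def
    proof (intro holomorphic_intros less)
      show "f (z1 + of_real (h j)) holomorphic_on ball w0 (3 * R)"
        by (rule holomorphic_on_subset[OF h2[OF subsetD[OF B3 hz]]]) (use W in blast)
      show "complex_of_real (h j) ^ n \<noteq> 0" using h(1)[of j] by simp
    qed simp
    have err: "cmod (g j w - c n w) \<le> 2 * real k / t ^ Suc n * h j" if w: "w \<in> ball w0 (3 * R)" for j w
    proof -
      define x where "x = complex_of_real (h j)"
      have x: "cmod x = h j" using h[of j] by (simp add: x_def)
      have "g j w - c n w = (f (z1 + x) w - (\<Sum>m<Suc n. c m w * x ^ m)) / x ^ n"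
        using h[of j] by (simp add: g_def x_def field_simps)
      also have "cmod \<dots> = cmod (f (z1 + x) w - (\<Sum>m<Suc n. c m w * x ^ m)) / h j ^ n"
        by (simp only: norm_divide norm_power x)
      also have "\<dots> \<le> 2 * real k * (cmod x / t) ^ Suc n / h j ^ n"
      proof (intro divide_right_mono power_series_tail_bound[OF _ _ t(1)])
        show "(\<lambda>m. c m w * x ^ m) sums f (z1 + x) w"
          using c_sums[OF w hz[of j]] by (simp add: x_def)
        show "cmod (c m w) \<le> real k / t ^ m" for m using c_bound[OF w] .
      qed (use x h[of j] in auto)
      also have "\<dots> = 2 * real k / t ^ Suc n * h j"
        using h[of j] t(1) by (simp only: x power_divide) (simp add: field_simps)
      finally show ?thesis .
    qed
    have hlim: "(\<lambda>j. 2 * real k / t ^ Suc n * h j) \<longlonglongrightarrow> 0"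
    proof -
      have "(\<lambda>j. 2 * real k / t ^ Suc n * (t / 2) * (1 / real (Suc j))) \<longlonglongrightarrow> 2 * real k / t ^ Suc n * (t / 2) * 0"
        by (intro tendsto_intros LIMSEQ_Suc[OF lim_1_over_n])
      then show ?thesis by (simp add: h_def)
    qed
    have ulim: "uniform_limit (ball w0 (3 * R)) g (c n) sequentially"
    proof (rule uniform_limitI)
      fix e :: real assume "e > 0"
      from order_tendstoD(2)[OF hlim this]
      show "\<forall>\<^sub>F j in sequentially. \<forall>x\<in>ball w0 (3 * R). dist (g j x) (c n x) < e"
      proof eventually_elim
        case (elim j)
        show ?case
        proof
          fix x assume "x \<in> ball w0 (3 * R)"
          from err[OF this, of j] elim show "dist (g j x) (c n x) < e" by (simp add: dist_norm)
        qed
      qed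
    qed
    show ?case
    proof (rule holomorphic_uniform_sequence[OF open_ball ghol])
      fix x assume "x \<in> ball w0 (3 * R)"
      then obtain d where "d > 0" "cball x d \<subseteq> ball w0 (3 * R)"
        using open_contains_cball open_ball by blast
      then show "\<exists>d>0. cball x d \<subseteq> ball w0 (3 * R) \<and> uniform_limit (cball x d) g (c n) sequentially"
        using uniform_limit_on_subset[OF ulim] by blast
    qed
  qed
  \<comment> \<open>Convergence up to radius \<open>3 * R\<close> makes the terms at radius
    \<open>5 / 2 * R\<close> tend to \<open>0\<close>, which is the pointwise rate; the lemma trades
    it for the uniform rate belonging to \<open>2 * R\<close>.\<close>
  obtain N where N: "\<And>n w. n \<ge> N \<Longrightarrow> w \<in> ball w0 (3 * R / 2) \<Longrightarrow> cmod (c n w) \<le> (1 / (2 * R)) ^ n"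
  proof (rule hartogs_lemma[where R = "3 * R" and c = c and ?w0.0 = w0 and k = "real k" and M = "1 / t"
        and B = "1 / (5 / 2 * R)" and B' = "1 / (2 * R)"])
    show "cmod (c n w) \<le> real k * (1 / t) ^ n" if "w \<in> ball w0 (3 * R)" for n w
      using c_bound[OF that, of n] by (simp add: power_divide)
    fix w assume w: "w \<in> ball w0 (3 * R)"
    have "z1 + of_real (5 / 2 * R) \<in> ball z1 (3 * R)" using R by (simp add: dist_norm)
    from sums_summable[OF c_sums[OF w this]]
    have "(\<lambda>n. c n w * of_real (5 / 2 * R) ^ n) \<longlonglongrightarrow> 0"
      by (intro summable_LIMSEQ_zero) simp
    then have "eventually (\<lambda>n. dist (c n w * of_real (5 / 2 * R) ^ n) 0 < 1) sequentially"
      by (rule tendstoD) simp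
    then obtain N where N: "\<And>n. n \<ge> N \<Longrightarrow> cmod (c n w * of_real (5 / 2 * R) ^ n) < 1"
      unfolding eventually_sequentially by (auto simp del: of_real_mult)
    have "cmod (c n w) \<le> (1 / (5 / 2 * R)) ^ n" if "n \<ge> N" for n
    proof -
      have "cmod (c n w) * (5 / 2 * R) ^ n \<le> 1"
        using N[OF that] R by (simp only: norm_mult norm_power norm_of_real)
      then show ?thesis using R by (simp only: power_divide power_one pos_le_divide_eq zero_less_power)
    qed
    then show "\<exists>N. \<forall>n\<ge>N. cmod (c n w) \<le> (1 / (5 / 2 * R)) ^ n" by blast
  next
    fix N assume "\<And>n w. N \<le> n \<Longrightarrow> w \<in> ball w0 (3 * R / 2) \<Longrightarrow> cmod (c n w) \<le> (1 / (2 * R)) ^ n"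
    then show thesis by (rule that)
  qed (use R t c_hol in \<open>simp_all add: field_simps\<close>)
  \<comment> \<open>With radius \<open>3 * R / 2\<close> the terms are eventually below
    \<open>(3 / 4) ^ n\<close>, and \<open>z0\<close> is still covered because
    \<open>dist z1 z0 < R\<close>.\<close>
  define P where "P = ball z1 (3 * R / 2) \<times> ball w0 (3 * R / 2)"
  have Pin: "snd p \<in> ball w0 (3 * R)" "fst p \<in> ball z1 (3 * R)" if "p \<in> P" for p
    using that R by (auto simp: P_def)
  have "uniform_limit P (\<lambda>n p. \<Sum>i<n. c i (snd p) * (fst p - z1) ^ i)
         (\<lambda>p. \<Sum>i. c i (snd p) * (fst p - z1) ^ i) sequentially"
  proof (rule Weierstrass_m_test_ev)
    show "\<forall>\<^sub>F n in sequentially. \<forall>p\<in>P. cmod (c n (snd p) * (fst p - z1) ^ n) \<le> (3 / 4) ^ n"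
      unfolding eventually_sequentially
    proof (intro exI[of _ N] allI impI ballI)
      fix n p assume n: "N \<le> n" and p: "p \<in> P"
      have "cmod (c n (snd p) * (fst p - z1) ^ n) = cmod (c n (snd p)) * cmod (fst p - z1) ^ n"
        by (simp add: norm_mult norm_power)
      also have "\<dots> \<le> (1 / (2 * R)) ^ n * (3 * R / 2) ^ n"
        using p n R by (intro mult_mono power_mono N) (auto simp: P_def dist_norm norm_minus_commute)
      also have "\<dots> = (3 / 4) ^ n"
        using R by (simp flip: power_mult_distrib)
      finally show "cmod (c n (snd p) * (fst p - z1) ^ n) \<le> (3 / 4) ^ n" .
    qed
  qed (simp add: summable_geometric)
  then have "continuous_on P (\<lambda>p. \<Sum>i. c i (snd p) * (fst p - z1) ^ i)"
  proof (rule uniform_limit_theorem[rotated])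
    show "\<forall>\<^sub>F n in sequentially. continuous_on P (\<lambda>p. \<Sum>i<n. c i (snd p) * (fst p - z1) ^ i)"
    proof (intro always_eventually allI continuous_intros)
      fix i
      show "continuous_on P (\<lambda>p. c i (snd p))"
        by (rule continuous_on_compose2[OF holomorphic_on_imp_continuous_on[OF c_hol[of i]]])
           (use Pin in \<open>auto intro!: continuous_intros simp del: mem_ball\<close>)
    qed
  qed simp
  then have "continuous_on P (\<lambda>p. f (fst p) (snd p))"
    by (rule continuous_on_eq) (use c_sums Pin in \<open>auto simp: sums_iff simp del: mem_ball\<close>)
  moreover have "open P" unfolding P_def by (intro open_Times open_ball)
  moreover have "(z0, w0) \<in> P" using z1 R by (auto simp: P_def dist_commute)
  ultimately show ?thesis by (simp add: continuous_on_eq_continuous_at)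
qed

theorem separately_holomorphic_imp_continuous:
  fixes f :: "complex \<Rightarrow> complex \<Rightarrow> complex"
  assumes U: "open U"
    and h1: "\<And>z w. (z, w) \<in> U \<Longrightarrow> (\<lambda>z. f z w) field_differentiable at z"
    and h2: "\<And>z w. (z, w) \<in> U \<Longrightarrow> f z field_differentiable at w"
  shows "continuous_on U (\<lambda>p. f (fst p) (snd p))"
proof (rule continuous_at_imp_continuous_on, rule ballI)
  fix p assume p: "p \<in> U"
  obtain z0 w0 where zw: "p = (z0, w0)" by (cases p)
  obtain A B where AB: "open A" "open B" "p \<in> A \<times> B" "A \<times> B \<subseteq> U"
    using open_prod_elim[OF U p] by blast
  obtain a b where ab: "a > 0" "b > 0" "ball z0 a \<subseteq> A" "ball w0 b \<subseteq> B"
    using AB zw openE by (metis mem_Sigma_iff)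
  define R where "R = min a b / 4"
  have R: "R > 0" "4 * R \<le> a" "4 * R \<le> b" using ab by (auto simp: R_def)
  have sub: "(z, w) \<in> U" if "z \<in> ball z0 (4 * R)" "w \<in> ball w0 (4 * R)" for z w
  proof -
    have "z \<in> ball z0 a" "w \<in> ball w0 b" using that R by auto
    then show ?thesis using ab AB by blast
  qed
  have "isCont (\<lambda>p. f (fst p) (snd p)) (z0, w0)"
  proof (rule hartogs_polydisc[OF R(1)])
    show "(\<lambda>z. f z w) holomorphic_on ball z0 (4 * R)" if "w \<in> ball w0 (4 * R)" for w
      unfolding holomorphic_on_def using h1[OF sub[OF _ that]] field_differentiable_at_within by blast
    show "f z holomorphic_on ball w0 (4 * R)" if "z \<in> ball z0 (4 * R)" for z
      unfolding holomorphic_on_def using h2[OF sub[OF that]] field_differentiable_at_within by blast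
  qed
  then show "isCont (\<lambda>p. f (fst p) (snd p)) p" by (simp add: zw)
qed

section \<open>Functionals on locally convex spaces\<close>

locale complex_vector_space = vector_space sc for sc :: "complex \<Rightarrow> 'b \<Rightarrow> 'b::ab_group_add"
begin

abbreviation rscale :: "real \<Rightarrow> 'b \<Rightarrow> 'b" where
  "rscale t x \<equiv> sc (complex_of_real t) x"

definition sublinear :: "('b \<Rightarrow> real) \<Rightarrow> bool" where
  "sublinear q \<longleftrightarrow> (\<forall>x y. q (x + y) \<le> q x + q y) \<and> (\<forall>t x. t \<ge> 0 \<longrightarrow> q (rscale t x) = t * q x)"

lemma sublinear_add: "sublinear q \<Longrightarrow> q (x + y) \<le> q x + q y"
  and sublinear_scale: "sublinear q \<Longrightarrow> t \<ge> 0 \<Longrightarrow> q (rscale t x) = t * q x"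
  by (simp_all add: sublinear_def)

lemma sublinear_zero: "sublinear q \<Longrightarrow> q 0 = 0"
  using sublinear_scale[of q 0 0] by simp

lemma sublinear_minus: "sublinear q \<Longrightarrow> - q (- x) \<le> q x"
  using sublinear_add[of q x "- x"] sublinear_zero[of q] by simp

lemma sublinearI:
  assumes add: "\<And>x y. q (x + y) \<le> q x + q y"
    and scale: "\<And>t x. t > 0 \<Longrightarrow> q (rscale t x) \<le> t * q x"
  shows "sublinear q"
  unfolding sublinear_def
proof (intro conjI allI impI add)
  fix t x assume t: "(t::real) \<ge> 0"
  show "q (rscale t x) = t * q x"
  proof (cases "t = 0")
    case True
    have "q 0 \<le> 1 / 2 * q 0" using scale[of "1 / 2" 0] by simp
    moreover have "q 0 \<le> q 0 + q 0" using add[of 0 0] by simp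
    ultimately show ?thesis using True by simp
  next
    case False
    then have t: "t > 0" using t by simp
    have "q x = q (rscale (1 / t) (rscale t x))" using t by simp
    also have "\<dots> \<le> 1 / t * q (rscale t x)" by (rule scale) (use t in simp)
    finally have "t * q x \<le> q (rscale t x)" using t by (simp add: field_simps)
    with scale[OF t, of x] show ?thesis by simp
  qed
qed

text \<open>For sublinear \<open>q\<close> this is the largest sublinear functional below
  \<open>q\<close> whose value at \<open>- y\<close> is at most \<open>- q y\<close>: it pushes
  \<open>q\<close> towards linearity along \<open>y\<close>.\<close>

definition shift :: "('b \<Rightarrow> real) \<Rightarrow> 'b \<Rightarrow> 'b \<Rightarrow> real" where
  "shift q y x = (INF t\<in>{0..}. q (x + rscale t y) - t * q y)"

lemma
  assumes q: "sublinear q"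
  shows sublinear_shift: "sublinear (shift q y)"
    and shift_le: "t \<ge> 0 \<Longrightarrow> shift q y x \<le> q (x + rscale t y) - t * q y"
proof -
  \<comment> \<open>A bound independent of \<open>t\<close>, which makes the infimum finite.\<close>
  have lb: "- q (- x) \<le> q (x + rscale t y) - t * q y" if "t \<ge> 0" for t x
  proof -
    have "t * q y = q ((x + rscale t y) + (- x))" using sublinear_scale[OF q that] by simp
    also have "\<dots> \<le> q (x + rscale t y) + q (- x)" by (rule sublinear_add[OF q])
    finally show ?thesis by simp
  qed
  have bdd: "bdd_below ((\<lambda>t. q (x + rscale t y) - t * q y) ` {0..})" for x
    using lb by (intro bdd_belowI2[where m = "- q (- x)"]) auto
  have le: "shift q y x \<le> q (x + rscale t y) - t * q y" if "t \<ge> 0" for t x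
    unfolding shift_def by (rule cINF_lower[OF bdd]) (use that in simp)
  show "t \<ge> 0 \<Longrightarrow> shift q y x \<le> q (x + rscale t y) - t * q y" by (rule le)
  have ge: "b \<le> shift q y x" if "\<And>t. t \<ge> 0 \<Longrightarrow> b \<le> q (x + rscale t y) - t * q y" for b x
    unfolding shift_def by (rule cINF_greatest) (use that in auto)
  show "sublinear (shift q y)"
  proof (rule sublinearI)
    fix x x'
    have "shift q y (x + x') \<le> (q (x + rscale t y) - t * q y) + (q (x' + rscale t' y) - t' * q y)"
      if "t \<ge> 0" "t' \<ge> 0" for t t'
    proof -
      have "shift q y (x + x') \<le> q (x + x' + rscale (t + t') y) - (t + t') * q y"
        by (rule le) (use that in simp)
      also have "x + x' + rscale (t + t') y = (x + rscale t y) + (x' + rscale t' y)"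
        by (simp add: scale_left_distrib algebra_simps)
      also have "q \<dots> \<le> q (x + rscale t y) + q (x' + rscale t' y)" by (rule sublinear_add[OF q])
      finally show ?thesis by (simp add: algebra_simps)
    qed
    then have "shift q y (x + x') - (q (x' + rscale t' y) - t' * q y) \<le> shift q y x" if "t' \<ge> 0" for t'
      using that by (intro ge) (simp add: algebra_simps)
    then have "shift q y (x + x') - shift q y x \<le> shift q y x'"
      by (intro ge) (simp add: algebra_simps)
    then show "shift q y (x + x') \<le> shift q y x + shift q y x'" by simp
  next
    fix s :: real and x assume s: "s > 0"
    have "shift q y (rscale s x) \<le> s * (q (x + rscale t y) - t * q y)" if "t \<ge> 0" for t
    proof -
      have "shift q y (rscale s x) \<le> q (rscale s x + rscale (s * t) y) - s * t * q y"
        by (rule le) (use that s in simp)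
      also have "rscale s x + rscale (s * t) y = rscale s (x + rscale t y)"
        by (simp add: scale_right_distrib)
      also have "q \<dots> = s * q (x + rscale t y)" using s by (intro sublinear_scale[OF q]) simp
      finally show ?thesis by (simp add: algebra_simps)
    qed
    then have "shift q y (rscale s x) / s \<le> shift q y x"
      using s by (intro ge) (simp add: field_simps)
    then show "shift q y (rscale s x) \<le> s * shift q y x" using s by (simp add: field_simps)
  qed
qed

lemma shift_le_self: "sublinear q \<Longrightarrow> shift q y x \<le> q x"
  using shift_le[of q 0 y x] by simp

text \<open>A minimal sublinear functional \<^term>\<open>m\<close> is additive, since \<^term>\<open>shift m y\<close> cannot be smaller.\<close>

lemma hahn_banach_sublinear:
  assumes p: "sublinear p"
  obtains \<phi> where "\<And>x y. \<phi> (x + y) = \<phi> x + \<phi> y" "\<And>t x. \<phi> (rscale t x) = t * \<phi> x"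
    "\<And>x. \<phi> x \<le> p x" "\<phi> y0 = p y0"
proof -
  \<comment> \<open>Everything below the shifted functional has value at most \<open>- p y0\<close>
    at \<open>- y0\<close>, so a linear minorant is forced to equal \<open>p\<close> at
    \<open>y0\<close>.\<close>
  define p0 where "p0 = shift p y0"
  have p0: "sublinear p0" "\<And>x. p0 x \<le> p x"
    unfolding p0_def using sublinear_shift[OF p] shift_le_self[OF p] by auto
  define A where "A = {q. sublinear q \<and> q \<le> p0}"
  have "\<exists>m\<in>A. \<forall>q\<in>A. q \<le> m \<longrightarrow> q = m"
  proof (rule predicate_Zorn[where P = "\<lambda>q q'. q' \<le> q"])
    show "partial_order_on A (relation_of (\<lambda>q q'. q' \<le> q) A)"
      by (rule partial_order_on_relation_ofI) auto
  next
    fix C assume "C \<in> Chains (relation_of (\<lambda>q q'. q' \<le> q) A)"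
    then have CA: "C \<subseteq> A" and ch: "\<And>q q'. q \<in> C \<Longrightarrow> q' \<in> C \<Longrightarrow> q \<le> q' \<or> q' \<le> q"
      by (auto simp: Chains_def relation_of_def)
    show "\<exists>u\<in>A. \<forall>q\<in>C. u \<le> q"
    proof (cases "C = {}")
      case True
      then show ?thesis using p0 by (auto simp: A_def)
    next
      case False
      define u where "u = (\<lambda>x. INF q\<in>C. q x)"
      have lb: "- p0 (- x) \<le> q x" if "q \<in> C" for q x
      proof -
        have q: "sublinear q" "q (- x) \<le> p0 (- x)" using CA that by (auto simp: A_def le_fun_def)
        show ?thesis using sublinear_minus[OF q(1), of x] q(2) by simp
      qed
      have bdd: "bdd_below ((\<lambda>q. q x) ` C)" for x
        by (rule bdd_belowI2[where m = "- p0 (- x)"]) (rule lb)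
      have le: "u x \<le> q x" if "q \<in> C" for q x
        unfolding u_def using that by (rule cINF_lower[OF bdd])
      have ge: "b \<le> u x" if "\<And>q. q \<in> C \<Longrightarrow> b \<le> q x" for b x
        unfolding u_def using False that by (rule cINF_greatest)
      have "sublinear u"
      proof (rule sublinearI)
        fix x y
        have "u (x + y) \<le> q x + q' y" if qq: "q \<in> C" "q' \<in> C" for q q'
        proof -
          obtain r where r: "r \<in> C" "r \<le> q" "r \<le> q'"
            using ch[OF qq] qq order_refl[of q] order_refl[of q'] by blast
          have "u (x + y) \<le> r (x + y)" by (rule le[OF r(1)])
          also have "\<dots> \<le> r x + r y" using r CA by (intro sublinear_add) (auto simp: A_def)
          also have "\<dots> \<le> q x + q' y" using r by (intro add_mono) (auto simp: le_fun_def)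
          finally show ?thesis .
        qed
        then have "u (x + y) - q' y \<le> u x" if "q' \<in> C" for q'
          using that by (intro ge) (simp add: algebra_simps)
        then have "u (x + y) - u x \<le> u y" by (intro ge) (simp add: algebra_simps)
        then show "u (x + y) \<le> u x + u y" by simp
      next
        fix t :: real and x assume t: "t > 0"
        have "u (rscale t x) / t \<le> q x" if q: "q \<in> C" for q
        proof -
          have "q (rscale t x) = t * q x" using q CA t by (intro sublinear_scale) (auto simp: A_def)
          then show ?thesis using le[OF q, of "rscale t x"] t by (simp add: field_simps)
        qed
        then have "u (rscale t x) / t \<le> u x" by (rule ge)
        then show "u (rscale t x) \<le> t * u x" using t by (simp add: field_simps)
      qed
      moreover have "u \<le> p0"
      proof (rule le_funI)
        fix x
        obtain q where q: "q \<in> C" using False by blast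
        then have "q \<le> p0" using CA by (auto simp: A_def)
        then show "u x \<le> p0 x" using le[OF q, of x] by (meson le_funD order_trans)
      qed
      ultimately show ?thesis using le by (auto simp: A_def le_fun_def)
    qed
  qed
  then obtain m where m: "sublinear m" "m \<le> p0"
    and min: "\<And>q. sublinear q \<Longrightarrow> q \<le> m \<Longrightarrow> q = m"
    unfolding A_def using order_trans by blast
  have sh: "shift m y = m" for y
    by (rule min) (auto simp: sublinear_shift m le_fun_def intro: shift_le_self)
  have add: "m (x + y) = m x + m y" for x y
    using sublinear_add[OF m(1), of x y] shift_le[OF m(1), of 1 y x] sh[of y] by simp
  have neg: "m (- x) = - m x" for x
    using add[of x "- x"] sublinear_zero[OF m(1)] by simp
  have scale: "m (rscale t x) = t * m x" for t x
  proof (cases "t \<ge> 0")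
    case True
    then show ?thesis by (rule sublinear_scale[OF m(1)])
  next
    case False
    then have "m (rscale (- t) x) = - t * m x" by (intro sublinear_scale[OF m(1)]) simp
    then show ?thesis using neg[of "rscale t x"] by simp
  qed
  have le: "m x \<le> p x" for x using m(2) p0(2)[of x] by (meson le_funD order_trans)
  have "m (- y0) \<le> p0 (- y0)" using m(2) by (simp add: le_funD)
  also have "\<dots> \<le> p (- y0 + rscale 1 y0) - 1 * p y0" unfolding p0_def by (rule shift_le[OF p]) simp
  also have "\<dots> = - p y0" using sublinear_zero[OF p] by simp
  finally have "m y0 = p y0" using neg[of y0] le[of y0] by simp
  with add scale le show thesis by (intro that)
qed

end

section \<open>Duality for families of seminorms\<close>

locale seminormed_space = complex_vector_space sY for sY :: "complex \<Rightarrow> 'b \<Rightarrow> 'b::ab_group_add" +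
  fixes P :: "'i \<Rightarrow> 'b \<Rightarrow> real"
  assumes seminorm: "seminorm_family sY P"
begin

lemma P_add: "P i (x + y) \<le> P i x + P i y"
  and P_scale: "P i (sY c x) = cmod c * P i x"
  using seminorm by (simp_all add: seminorm_family_def)

lemma P_zero [simp]: "P i 0 = 0"
  using P_scale[of i 0 0] by simp

lemma P_minus [simp]: "P i (- x) = P i x"
  using P_scale[of i "- 1" x] by simp

lemma P_nonneg [simp]: "P i x \<ge> 0"
  using P_add[of i x "- x"] by simp

lemma P_minus_commute: "P i (x - y) = P i (y - x)"
  using P_minus[of i "x - y"] by simp

lemma P_diff_triangle: "P i (x - z) \<le> P i (x - y) + P i (y - z)"
  using P_add[of i "x - y" "y - z"] by simp

abbreviation PF :: "'i set \<Rightarrow> 'b \<Rightarrow> real" where "PF F x \<equiv> (\<Sum>i\<in>F. P i x)"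

lemma PF_add: "PF F (x + y) \<le> PF F x + PF F y"
  unfolding sum.distrib[symmetric] by (intro sum_mono P_add)

lemma PF_scale: "PF F (sY c x) = cmod c * PF F x"
  by (simp add: P_scale sum_distrib_left)

lemma PF_nonneg: "PF F x \<ge> 0"
  by (simp add: sum_nonneg)

abbreviation dual :: "('b \<Rightarrow> complex) set" where "dual \<equiv> lc_dual sY P"

lemma dual_add: "\<phi> \<in> dual \<Longrightarrow> \<phi> (x + y) = \<phi> x + \<phi> y"
  and dual_scale: "\<phi> \<in> dual \<Longrightarrow> \<phi> (sY c x) = c * \<phi> x"
  by (simp_all add: lc_dual_def Vector_Spaces.linear_iff)

lemma dual_zero: "\<phi> \<in> dual \<Longrightarrow> \<phi> 0 = 0"
  using dual_scale[of \<phi> 0 0] by simp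

lemma dual_minus: "\<phi> \<in> dual \<Longrightarrow> \<phi> (- x) = - \<phi> x"
  using dual_scale[of \<phi> "- 1" x] by simp

lemma dual_diff: "\<phi> \<in> dual \<Longrightarrow> \<phi> (x - y) = \<phi> x - \<phi> y"
  using dual_add[of \<phi> x "- y"] dual_minus[of \<phi> y] by simp

lemma dual_sum: "\<phi> \<in> dual \<Longrightarrow> \<phi> (\<Sum>i\<in>I. x i) = (\<Sum>i\<in>I. \<phi> (x i))"
  by (induction I rule: infinite_finite_induct) (simp_all add: dual_zero dual_add)

lemma dualI:
  assumes add: "\<And>x y. \<phi> (x + y) = \<phi> x + \<phi> y" and scale: "\<And>c x. \<phi> (sY c x) = c * \<phi> x"
    and F: "finite F" and bound: "\<And>x. cmod (\<phi> x) \<le> C * PF F x" and C: "C \<ge> 0"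
  shows "\<phi> \<in> dual"
proof -
  have "vector_space ((*) :: complex \<Rightarrow> _)" by unfold_locales (auto simp: algebra_simps)
  then have lin: "Vector_Spaces.linear sY (*) \<phi>"
    using vector_space_axioms by (simp add: Vector_Spaces.linear_iff add scale)
  have diff: "\<phi> (x - y) = \<phi> x - \<phi> y" for x y
    using add[of x "- y"] scale[of "- 1" y] by simp
  have "\<exists>F d. finite F \<and> d > 0 \<and> (\<forall>z\<in>lc_nbhd P F d y. cmod (\<phi> z - \<phi> y) < e)" if e: "e > 0" for y e
  proof (intro exI conjI ballI)
    \<comment> \<open>The summand \<open>1\<close> covers an empty \<open>F\<close> and
      \<open>C = 0\<close>.\<close>
    define d where "d = e / (C * real (card F) + 1)"
    have pos: "C * real (card F) + 1 > 0" using C by (simp add: add_nonneg_pos)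
    show d: "d > 0" using pos e by (simp add: d_def)
    fix z assume z: "z \<in> lc_nbhd P F d y"
    have "cmod (\<phi> z - \<phi> y) \<le> C * PF F (z - y)" using bound[of "z - y"] by (simp add: diff)
    also have "\<dots> \<le> C * (\<Sum>i\<in>F. d)"
      using z C by (intro mult_left_mono sum_mono) (auto simp: lc_nbhd_def less_imp_le)
    also have "\<dots> = (C * real (card F)) * d" by simp
    also have "\<dots> < (C * real (card F) + 1) * d" using d by simp
    also have "\<dots> = e" using pos by (simp add: d_def)
    finally show "cmod (\<phi> z - \<phi> y) < e" .
  qed (rule F)
  with lin show ?thesis by (simp add: lc_dual_def)
qed

text \<open>A complex linear functional is determined by its real part through
  \<open>\<psi> x = \<phi> x - \<i> * \<phi> (\<i> x)\<close>. The factor \<open>2\<close> comes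
  from estimating the modulus by the sum of the two parts.\<close>

lemma complexify_dual:
  assumes add: "\<And>x y. \<phi> (x + y) = \<phi> x + \<phi> y" and scale: "\<And>t x. \<phi> (rscale t x) = t * \<phi> x"
    and F: "finite F" and bound: "\<And>x. \<phi> x \<le> C * PF F x" and C: "C \<ge> 0"
  obtains \<psi> where "\<psi> \<in> dual" "\<And>x. Re (\<psi> x) = \<phi> x" "\<And>x. cmod (\<psi> x) \<le> 2 * C * PF F x"
proof -
  define \<psi> where "\<psi> = (\<lambda>x. Complex (\<phi> x) (- \<phi> (sY \<i> x)))"
  have neg: "\<phi> (- x) = - \<phi> x" for x using scale[of "- 1" x] by simp
  have abs: "\<bar>\<phi> x\<bar> \<le> C * PF F x" for x
    using bound[of x] bound[of "- x"] by (simp add: neg abs_le_iff)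
  have nb: "cmod (\<psi> x) \<le> 2 * C * PF F x" for x
  proof -
    have "cmod (\<psi> x) \<le> \<bar>\<phi> x\<bar> + \<bar>\<phi> (sY \<i> x)\<bar>" using cmod_le[of "\<psi> x"] by (simp add: \<psi>_def)
    also have "\<dots> \<le> C * PF F x + C * PF F (sY \<i> x)" by (intro add_mono abs)
    finally show ?thesis by (simp add: PF_scale P_scale)
  qed
  have "\<psi> \<in> dual"
  proof (rule dualI[OF _ _ F nb])
    show "\<psi> (x + y) = \<psi> x + \<psi> y" for x y
      by (simp add: \<psi>_def scale_right_distrib add complex_eq_iff)
    fix c x
    have c: "sY c x = rscale (Re c) x + rscale (Im c) (sY \<i> x)"
      by (simp add: complex_eq mult.commute flip: scale_left_distrib)
    have ic: "sY \<i> (sY c x) = rscale (Re c) (sY \<i> x) + rscale (- Im c) x"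
    proof -
      have "\<i> * c = of_real (Re c) * \<i> + of_real (- Im c)" by (simp add: complex_eq_iff)
      then have "sY \<i> (sY c x) = sY (of_real (Re c) * \<i> + of_real (- Im c)) x"
        by (simp only: scale_scale)
      then show ?thesis by (simp only: scale_scale scale_left_distrib)
    qed
    show "\<psi> (sY c x) = c * \<psi> x"
      unfolding \<psi>_def ic unfolding c add scale by (simp add: complex_eq_iff)
  qed (use C in simp)
  moreover have "Re (\<psi> x) = \<phi> x" for x by (simp add: \<psi>_def)
  ultimately show thesis using nb that by blast
qed

text \<open>Hahn-Banach for the single seminorm \<open>P i\<close>, made complex; it lets the dual
  detect the size of \<open>P i\<close> at a prescribed vector.\<close>

lemma norming_functional:
  obtains \<psi> where "\<psi> \<in> dual" "\<And>x. cmod (\<psi> x) \<le> 2 * P i x" "P i y \<le> cmod (\<psi> y)"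
proof -
  have "sublinear (P i)" by (rule sublinearI) (auto simp: P_add P_scale)
  then obtain \<phi> where \<phi>: "\<And>x y. \<phi> (x + y) = \<phi> x + \<phi> y" "\<And>t x. \<phi> (rscale t x) = t * \<phi> x"
    "\<And>x. \<phi> x \<le> P i x" "\<phi> y = P i y"
    by (rule hahn_banach_sublinear[where ?y0.0 = y]) blast
  obtain \<psi> where \<psi>: "\<psi> \<in> dual" "\<And>x. Re (\<psi> x) = \<phi> x" "\<And>x. cmod (\<psi> x) \<le> 2 * 1 * PF {i} x"
    by (rule complexify_dual[where F = "{i}" and C = 1, OF \<phi>(1,2)]) (use \<phi>(3) in auto)
  have "P i y \<le> cmod (\<psi> y)" using complex_Re_le_cmod[of "\<psi> y"] by (simp add: \<psi>(2) \<phi>(4))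
  with \<psi> show thesis by (intro that) auto
qed

text \<open>Uniform boundedness for a sequence. If \<open>P i\<close> were unbounded on it,
  functionals norming ever larger members could be superposed with weights \<open>1 / 8 ^ k\<close>
  into one continuous functional that is unbounded on the sequence.\<close>

lemma weakly_bounded_imp_bounded:
  fixes y :: "nat \<Rightarrow> 'b"
  assumes weak: "\<And>\<phi>. \<phi> \<in> dual \<Longrightarrow> \<exists>C. \<forall>n. cmod (\<phi> (y n)) \<le> C"
  shows "\<exists>C. \<forall>n. P i (y n) \<le> C"
proof (rule ccontr)
  assume "\<nexists>C. \<forall>n. P i (y n) \<le> C"
  then have "\<forall>k. \<exists>n. P i (y n) > 16 ^ k" by (meson not_le)
  \<comment> \<open>Growth \<open>16 ^ k\<close> against the weight \<open>1 / 8 ^ k\<close> leaves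
    \<open>2 ^ k\<close>. The terms after the \<open>k\<close>-th sum to at most
    \<open>2 / 7\<close> of what the \<open>k\<close>-th secures at \<open>v k\<close>, so
    \<open>5 / 7\<close> of it survives.\<close>
  then obtain n where n: "\<And>k::nat. P i (y (n k)) > 16 ^ k" by metis
  define v where "v = (\<lambda>k. y (n k))"
  have "\<exists>\<psi>. \<psi> \<in> dual \<and> (\<forall>x. cmod (\<psi> x) \<le> 2 * P i x) \<and> P i (v k) \<le> cmod (\<psi> (v k))" for k
    by (rule norming_functional[of i "v k"]) blast
  then obtain \<psi> where \<psi>: "\<And>k. \<psi> k \<in> dual" "\<And>k x. cmod (\<psi> k x) \<le> 2 * P i x"
    "\<And>k. P i (v k) \<le> cmod (\<psi> k (v k))"
    by metis
  text \<open>Gliding hump: the signs \<open>e k\<close> are chosen so that the \<open>k\<close>-th term is not cancelled at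
    \<^term>\<open>v k\<close> by the previous ones; the later ones are too small to cancel it.\<close>
  define e where "e = (\<lambda>S k. if cmod (S (v k) + \<psi> k (v k) / 8 ^ k) \<ge> P i (v k) / 8 ^ k then 1 else (- 1 :: complex))"
  define T where "T = rec_nat (\<lambda>x. 0) (\<lambda>k S x. S x + e S k * (\<psi> k x / 8 ^ k))"
  have T0: "T 0 x = 0" and TS: "T (Suc k) x = T k x + e (T k) k * (\<psi> k x / 8 ^ k)" for k x
    by (simp_all add: T_def)
  define a where "a = (\<lambda>k x. e (T k) k * (\<psi> k x / 8 ^ k))"
  have Tsum: "T k x = (\<Sum>j<k. a j x)" for k x
    by (induction k) (simp_all add: T0 TS a_def)
  have ne: "cmod (e S k) = 1" for S k by (simp add: e_def)
  have a_bound: "cmod (a k x) \<le> 2 * P i x * (1 / 8) ^ k" for k x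
    using \<psi>(2)[of k x] by (simp add: a_def norm_mult ne norm_divide norm_power power_divide field_simps)
  have summ: "summable (\<lambda>k. a k x)" for x
  proof (rule summable_comparison_test'[OF _ a_bound])
    show "summable (\<lambda>k. 2 * P i x * (1 / 8) ^ k)"
      by (intro summable_mult summable_geometric) simp
  qed
  define \<Psi> where "\<Psi> = (\<lambda>x. \<Sum>k. a k x)"
  have tail: "cmod (\<Psi> x - (\<Sum>j<m. a j x)) \<le> 16 / 7 * P i x / 8 ^ m" for x m
  proof -
    have "(\<lambda>k. a (k + m) x) sums (\<Psi> x - (\<Sum>j<m. a j x))"
      unfolding \<Psi>_def by (rule sums_split_initial_segment[OF summable_sums[OF summ]])
    moreover have "(\<lambda>k. 2 * P i x / 8 ^ m * (1 / 8) ^ k) sums (2 * P i x / 8 ^ m * (1 / (1 - 1 / 8)))"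
      by (intro sums_mult geometric_sums) simp
    moreover have "cmod (a (k + m) x) \<le> 2 * P i x / 8 ^ m * (1 / 8) ^ k" for k
      using a_bound[of "k + m" x] by (simp add: power_add power_divide mult_ac)
    ultimately have "cmod (\<Psi> x - (\<Sum>j<m. a j x)) \<le> 2 * P i x / 8 ^ m * (1 / (1 - 1 / 8))"
      by (metis (no_types, lifting) sums_iff norm_suminf_le)
    then show ?thesis by simp
  qed
  have "\<Psi> \<in> dual"
  proof (rule dualI[where F = "{i}" and C = "16 / 7"])
    show "\<Psi> (x + x') = \<Psi> x + \<Psi> x'" for x x'
    proof -
      have "a k (x + x') = a k x + a k x'" for k
        by (simp add: a_def dual_add[OF \<psi>(1)] add_divide_distrib distrib_left)
      then show ?thesis unfolding \<Psi>_def by (simp add: suminf_add[OF summ summ])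
    qed
    show "\<Psi> (sY c x) = c * \<Psi> x" for c x
    proof -
      have "a k (sY c x) = c * a k x" for k
        by (simp add: a_def dual_scale[OF \<psi>(1)])
      then show ?thesis unfolding \<Psi>_def by (simp add: suminf_mult[OF summ])
    qed
    show "cmod (\<Psi> x) \<le> 16 / 7 * PF {i} x" for x using tail[of x 0] by simp
  qed simp_all
  then obtain C where C: "\<And>n. cmod (\<Psi> (y n)) \<le> C" using weak by blast
  have big: "cmod (\<Psi> (v k)) \<ge> 5 / 7 * 2 ^ k" for k
  proof -
    define b where "b = \<psi> k (v k) / 8 ^ k"
    have b: "cmod b \<ge> P i (v k) / 8 ^ k"
      using \<psi>(3)[of k] by (simp add: b_def norm_divide norm_power divide_right_mono)
    have "cmod (T (Suc k) (v k)) \<ge> P i (v k) / 8 ^ k"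
    proof (cases "cmod (T k (v k) + b) \<ge> P i (v k) / 8 ^ k")
      case True
      then show ?thesis by (simp add: TS e_def b_def)
    next
      case False
      have "2 * cmod b = cmod ((T k (v k) + b) - (T k (v k) - b))"
        by (simp add: norm_mult flip: mult_2)
      also have "\<dots> \<le> cmod (T k (v k) + b) + cmod (T k (v k) - b)" by (rule norm_triangle_ineq4)
      finally have "cmod (T k (v k) - b) \<ge> P i (v k) / 8 ^ k" using b False by simp
      then show ?thesis using False by (simp add: TS e_def b_def)
    qed
    moreover have "cmod (T (Suc k) (v k)) \<le> cmod (\<Psi> (v k)) + cmod (\<Psi> (v k) - T (Suc k) (v k))"
      by (metis norm_triangle_sub norm_minus_commute)
    moreover have "cmod (\<Psi> (v k) - T (Suc k) (v k)) \<le> 2 / 7 * (P i (v k) / 8 ^ k)"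
      using tail[of "v k" "Suc k"] unfolding Tsum by simp
    ultimately have "cmod (\<Psi> (v k)) \<ge> 5 / 7 * (P i (v k) / 8 ^ k)" by simp
    moreover have "P i (v k) / 8 ^ k \<ge> 2 ^ k"
    proof -
      have "(2::real) ^ k * 8 ^ k = 16 ^ k" by (simp flip: power_mult_distrib)
      then show ?thesis using n[of k] by (simp add: v_def pos_le_divide_eq)
    qed
    ultimately show ?thesis by simp
  qed
  obtain k :: nat where "7 / 5 * C < 2 ^ k" using real_arch_pow[of 2 "7 / 5 * C"] by auto
  then show False using big[of k] C[of "n k"] by (simp add: v_def)
qed

lemma dual_separates:
  assumes "lc_hausdorff P" and "\<And>\<phi>. \<phi> \<in> dual \<Longrightarrow> \<phi> x = \<phi> y"
  shows "x = y"
proof (rule ccontr)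
  assume "x \<noteq> y"
  then obtain i where i: "P i (x - y) \<noteq> 0" 
    using assms(1) unfolding lc_hausdorff_def by (metis right_minus_eq)
  obtain \<psi> where "\<psi> \<in> dual" "P i (x - y) \<le> cmod (\<psi> (x - y))"
    by (rule norming_functional[of i "x - y"])
  with assms(2)[of \<psi>] have "P i (x - y) \<le> 0" by (simp add: dual_diff)
  with i show False using P_nonneg[of i "x - y"] by simp
qed

text \<open>Turns a limit computed functional by functional into an element of the space, provided that it
  is approached at a geometric rate.\<close>

lemma weak_limit_exists:
  fixes y :: "nat \<Rightarrow> 'b"
  assumes compl: "lc_seq_complete P"
    and lim: "\<And>\<phi>. \<phi> \<in> dual \<Longrightarrow> \<exists>C. \<forall>n. cmod (\<phi> (y n) - L \<phi>) \<le> C / 2 ^ n"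
  shows "\<exists>v. \<forall>\<phi>\<in>dual. \<phi> v = L \<phi>"
proof -
  \<comment> \<open>The geometric rate enters here: the rescaled increments are still weakly
    bounded, hence bounded in every seminorm, which makes the sequence Cauchy. Weak convergence
    alone would not give this.\<close>
  define u where "u = (\<lambda>n. rscale (2 ^ n) (y (Suc n) - y n))"
  have "\<exists>C. \<forall>n. P i (u n) \<le> C" for i
  proof (rule weakly_bounded_imp_bounded)
    fix \<phi> assume \<phi>: "\<phi> \<in> dual"
    then obtain C where C: "\<And>n. cmod (\<phi> (y n) - L \<phi>) \<le> C / 2 ^ n" using lim by blast
    have "cmod (\<phi> (u n)) \<le> 2 * C" for n
    proof -
      have C0: "C \<ge> 0" using order_trans[OF norm_ge_zero C[of 0]] by simp
      have "cmod (\<phi> (y (Suc n)) - \<phi> (y n)) \<le> C / 2 ^ Suc n + C / 2 ^ n"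
        using norm_triangle_le_diff[of "\<phi> (y (Suc n)) - L \<phi>" "\<phi> (y n) - L \<phi>"] C[of n] C[of "Suc n"]
        by simp
      then have "2 ^ n * cmod (\<phi> (y (Suc n)) - \<phi> (y n)) \<le> 2 ^ n * (C / 2 ^ Suc n + C / 2 ^ n)"
        by (intro mult_left_mono) auto
      also have "\<dots> \<le> 2 * C" using C0 by (simp add: field_simps)
      finally show ?thesis by (simp add: u_def dual_scale[OF \<phi>] dual_diff[OF \<phi>] norm_mult norm_power)
    qed
    then show "\<exists>C. \<forall>n. cmod (\<phi> (u n)) \<le> C" by blast
  qed
  then obtain C where C: "\<And>i n. P i (u n) \<le> C i" by metis
  have C0: "C i \<ge> 0" for i using order_trans[OF P_nonneg C[of i 0]] .
  have step: "P i (y (Suc n) - y n) \<le> C i / 2 ^ n" for i n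
    using C[of i n] unfolding u_def P_scale by (simp add: norm_power field_simps)
  \<comment> \<open>Keeping the exact geometric remainder on the right lets the induction
    close.\<close>
  have far: "P i (y (n + k) - y n) \<le> 2 * C i / 2 ^ n - 2 * C i / 2 ^ (n + k)" for i n k
  proof (induction k)
    case (Suc k)
    have "P i (y (n + Suc k) - y n) \<le> P i (y (Suc (n + k)) - y (n + k)) + P i (y (n + k) - y n)"
      using P_diff_triangle[of i "y (Suc (n + k))" "y n" "y (n + k)"] by simp
    also have "\<dots> \<le> C i / 2 ^ (n + k) + (2 * C i / 2 ^ n - 2 * C i / 2 ^ (n + k))"
      by (intro add_mono step Suc)
    also have "\<dots> = 2 * C i / 2 ^ n - 2 * C i / 2 ^ (n + Suc k)" by (simp add: field_simps)
    finally show ?case .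
  qed simp
  have close: "P i (y m - y n) \<le> 2 * C i / 2 ^ N" if "m \<ge> N" "n \<ge> N" for i m n N
  proof -
    have *: "P i (y m - y n) \<le> 2 * C i / 2 ^ N" if "n \<ge> N" "m \<ge> n" for m n
    proof -
      have "P i (y m - y n) \<le> 2 * C i / 2 ^ n - 2 * C i / 2 ^ m"
        using far[of i n "m - n"] that by simp
      also have "\<dots> \<le> 2 * C i / 2 ^ n" using C0 by simp
      also have "\<dots> \<le> 2 * C i / 2 ^ N"
        using that C0 by (intro divide_left_mono power_increasing mult_pos_pos) auto
      finally show ?thesis .
    qed
    show ?thesis
    proof (cases "m \<ge> n")
      case True
      then show ?thesis using * that by blast
    next
      case False
      then show ?thesis using *[of m n] that by (simp add: P_minus_commute)
    qed
  qed
  have "\<exists>N. \<forall>m n. N \<le> m \<and> N \<le> n \<longrightarrow> P i (y m - y n) < e" if "e > 0" for i e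
  proof -
    obtain N :: nat where "2 * C i / e < 2 ^ N" using real_arch_pow[of 2 "2 * C i / e"] by auto
    then have "2 * C i / 2 ^ N < e" using that by (simp add: field_simps)
    then show ?thesis using close[of N _ _ i] by (meson le_less_trans)
  qed
  then obtain v where v: "\<And>i e. e > 0 \<Longrightarrow> \<exists>N. \<forall>n. N \<le> n \<longrightarrow> P i (y n - v) < e"
    using compl unfolding lc_seq_complete_def by blast
  have "\<phi> v = L \<phi>" if \<phi>: "\<phi> \<in> dual" for \<phi>
  proof (rule LIMSEQ_unique)
    show "(\<lambda>n. \<phi> (y n)) \<longlonglongrightarrow> \<phi> v"
    proof (rule tendstoI)
      fix e :: real assume "e > 0"
      then obtain F d where F: "finite F" "d > 0" "\<And>z. z \<in> lc_nbhd P F d v \<Longrightarrow> cmod (\<phi> z - \<phi> v) < e"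
        using \<phi> unfolding lc_dual_def by blast
      have "\<forall>i\<in>F. \<forall>\<^sub>F n in sequentially. P i (y n - v) < d"
        using v[OF F(2)] by (simp add: eventually_sequentially)
      then have "\<forall>\<^sub>F n in sequentially. \<forall>i\<in>F. P i (y n - v) < d"
        using F(1) by (simp add: eventually_ball_finite)
      then show "\<forall>\<^sub>F n in sequentially. dist (\<phi> (y n)) (\<phi> v) < e"
        by eventually_elim (use F(3) in \<open>auto simp: dist_norm lc_nbhd_def\<close>)
    qed
    obtain C where C: "\<And>n. cmod (\<phi> (y n) - L \<phi>) \<le> C / 2 ^ n" using lim[OF \<phi>] by blast
    have "(\<lambda>n. C / 2 ^ n) \<longlonglongrightarrow> 0" by (rule LIMSEQ_divide_realpow_zero) simp
    then show "(\<lambda>n. \<phi> (y n)) \<longlonglongrightarrow> L \<phi>"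
      by (rule Lim_null_comparison[THEN LIM_zero_cancel, rotated])
         (use C in \<open>auto intro: always_eventually\<close>)
  qed
  then show ?thesis by blast
qed

text \<open>The infimal convolution \<open>g x = inf (t + 2 p (x - t z) / d)\<close> over \<open>t \<ge> 0\<close> and \<open>z\<close> in the set
  is at most 1 on the set and stays above 1 at any point of \<open>p\<close>-distance \<open>d\<close> from it.\<close>

lemma closed_convex_separation:
  assumes conv: "convexY sY C" and closed: "lc_closed P C" and C0: "c0 \<in> C" and y: "y \<notin> C"
  obtains \<psi> b where "\<psi> \<in> dual" "\<And>z. z \<in> C \<Longrightarrow> Re (\<psi> z) \<le> b" "Re (\<psi> y) > b"
proof -
  have "y \<notin> lc_closure P C" using closed y by (auto simp: lc_closed_def)
  then obtain F d where F: "finite F" and d: "d > 0" and disj: "lc_nbhd P F d y \<inter> C = {}"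
    by (auto simp: lc_closure_def)
  \<comment> \<open>The sum dominates each of the finitely many seminorms, so one seminorm measures
    the gap between \<open>y\<close> and \<open>C\<close>.\<close>
  define p where "p = PF F"
  have p_add: "p (x + x') \<le> p x + p x'" for x x' unfolding p_def by (rule PF_add)
  have p_scale: "p (sY c x) = cmod c * p x" for c x unfolding p_def by (rule PF_scale)
  have p_nonneg: "p x \<ge> 0" for x unfolding p_def by (rule PF_nonneg)
  have far: "p (y - z) \<ge> d" if "z \<in> C" for z
  proof -
    from that disj obtain i where i: "i \<in> F" "P i (z - y) \<ge> d"
      by (force simp: lc_nbhd_def)
    then have "d \<le> P i (y - z)" by (simp add: P_minus_commute)
    also have "\<dots> \<le> p (y - z)" unfolding p_def using i F by (intro member_le_sum) auto
    finally show ?thesis .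
  qed
  define D where "D = (\<lambda>z. z - c0) ` C"
  have D0: "0 \<in> D" using C0 by (auto simp: D_def)
  have Dconv: "rscale (1 - t) z + rscale t z' \<in> D" if zz: "z \<in> D" "z' \<in> D" and t: "0 \<le> t" "t \<le> 1" for z z' t
  proof -
    obtain x x' where x: "x \<in> C" "x' \<in> C" "z = x - c0" "z' = x' - c0" using zz unfolding D_def by blast
    have "rscale (1 - t) x + rscale t x' \<in> C" using conv x t by (simp add: convexY_def)
    moreover have "rscale (1 - t) z + rscale t z' = (rscale (1 - t) x + rscale t x') - c0"
      by (simp add: x scale_right_diff_distrib scale_left_diff_distrib)
    ultimately show ?thesis by (auto simp: D_def)
  qed
  define w where "w = y - c0"
  have farD: "p (w - z) \<ge> d" if "z \<in> D" for z
    using that far by (auto simp: D_def w_def)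
  define I where "I = {0::real..} \<times> D"
  define h where "h = (\<lambda>x (t, z). t + 2 * p (x - rscale t z) / d)"
  define g where "g = (\<lambda>x. INF a\<in>I. h x a)"
  have ine: "I \<noteq> {}" using D0 by (auto simp: I_def)
  have hpos: "h x a \<ge> 0" if "a \<in> I" for x a
    using that d p_nonneg by (auto simp: I_def h_def)
  have bdd: "bdd_below (h x ` I)" for x
    by (rule bdd_belowI2[where m = 0]) (rule hpos)
  have le: "g x \<le> t + 2 * p (x - rscale t z) / d" if "t \<ge> 0" "z \<in> D" for x t z
  proof -
    have "g x \<le> h x (t, z)" unfolding g_def by (rule cINF_lower[OF bdd]) (use that in \<open>simp add: I_def\<close>)
    then show ?thesis by (simp add: h_def)
  qed
  have ge: "b \<le> g x" if "\<And>t z. t \<ge> 0 \<Longrightarrow> z \<in> D \<Longrightarrow> b \<le> t + 2 * p (x - rscale t z) / d" for b x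
    unfolding g_def by (rule cINF_greatest[OF ine]) (use that in \<open>auto simp: I_def h_def\<close>)
  have sub: "sublinear g"
  proof (rule sublinearI)
    fix x x'
    have "g (x + x') \<le> (t + 2 * p (x - rscale t z) / d) + (t' + 2 * p (x' - rscale t' z') / d)"
      if tz: "t \<ge> 0" "z \<in> D" "t' \<ge> 0" "z' \<in> D" for t z t' z'
    proof -
      define s where "s = t + t'"
      obtain z'' where z'': "z'' \<in> D" "rscale s z'' = rscale t z + rscale t' z'"
      proof (cases "s = 0")
        case True
        then have "t = 0" "t' = 0" using tz by (auto simp: s_def)
        then show thesis using that D0 True by simp
      next
        case False
        then have s: "s > 0" using tz by (simp add: s_def)
        show thesis
        proof (rule that)
          show "rscale (1 - t' / s) z + rscale (t' / s) z' \<in> D"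
            using tz s by (intro Dconv) (auto simp: s_def)
          have "s * (1 - t' / s) = t" "s * (t' / s) = t'" using s by (auto simp: s_def field_simps)
          then show "rscale s (rscale (1 - t' / s) z + rscale (t' / s) z') = rscale t z + rscale t' z'"
            by (simp only: scale_right_distrib scale_scale flip: of_real_mult)
        qed
      qed
      have "g (x + x') \<le> s + 2 * p (x + x' - rscale s z'') / d" using tz z'' by (intro le) (auto simp: s_def)
      also have "x + x' - rscale s z'' = (x - rscale t z) + (x' - rscale t' z')" by (simp add: z'')
      also have "p \<dots> \<le> p (x - rscale t z) + p (x' - rscale t' z')" by (rule p_add)
      finally show ?thesis using d by (simp add: s_def add_divide_distrib divide_right_mono)
    qed
    then have "g (x + x') - (t' + 2 * p (x' - rscale t' z') / d) \<le> g x" if "t' \<ge> 0" "z' \<in> D" for t' z'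
      using that by (intro ge) (simp add: algebra_simps)
    then have "g (x + x') - g x \<le> g x'"
      by (intro ge) (simp add: algebra_simps)
    then show "g (x + x') \<le> g x + g x'" by simp
  next
    fix s :: real and x assume s: "s > 0"
    have "g (rscale s x) / s \<le> t + 2 * p (x - rscale t z) / d" if tz: "t \<ge> 0" "z \<in> D" for t z
    proof -
      have "g (rscale s x) \<le> s * t + 2 * p (rscale s x - rscale (s * t) z) / d"
        using tz s by (intro le) auto
      also have "rscale s x - rscale (s * t) z = rscale s (x - rscale t z)"
        by (simp add: scale_right_diff_distrib)
      also have "p \<dots> = s * p (x - rscale t z)" using s by (simp add: p_scale)
      finally show ?thesis using s d by (simp add: field_simps)
    qed
    then have "g (rscale s x) / s \<le> g x" by (rule ge)
    then show "g (rscale s x) \<le> s * g x" using s by (simp add: field_simps)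
  qed
  have gD: "g z \<le> 1" if "z \<in> D" for z
    using le[of 1 z z] that by (simp add: p_def)
  \<comment> \<open>Scaling \<open>w\<close> by a factor between \<open>1\<close> and
    \<open>1 + \<eta>\<close> moves it by at most \<open>d / 2\<close> in \<open>p\<close>; the
    \<open>1\<close> added to \<open>p w\<close> excludes division by zero.\<close>
  define \<eta> where "\<eta> = min (1 / 2) (d / (2 * (p w + 1)))"
  have pw: "p w + 1 > 0" using p_nonneg[of w] by simp
  have \<eta>: "\<eta> > 0" "\<eta> \<le> 1 / 2" "\<eta> * (p w + 1) \<le> d / 2"
  proof -
    show "\<eta> > 0" using d pw by (auto simp: \<eta>_def)
    show "\<eta> \<le> 1 / 2" unfolding \<eta>_def by (rule min.cobounded1)
    have "\<eta> * (p w + 1) \<le> d / (2 * (p w + 1)) * (p w + 1)"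
      using pw by (intro mult_right_mono) (auto simp: \<eta>_def)
    also have "\<dots> = d / 2" using pw by (simp add: field_simps)
    finally show "\<eta> * (p w + 1) \<le> d / 2" .
  qed
  have gw: "1 + \<eta> \<le> g w"
  proof (rule ge)
    fix t z assume tz: "(t::real) \<ge> 0" "z \<in> D"
    have two: "2 * p (w - rscale t z) / d \<ge> 0" using p_nonneg d by simp
    \<comment> \<open>For \<open>t \<le> 1\<close>, \<open>t z\<close> lies in \<open>D\<close> by
      convexity with \<open>0\<close>, and the second summand is at least \<open>2\<close>. For
      \<open>t\<close> slightly above \<open>1\<close>, comparing with \<open>t (w - z)\<close>
      still leaves half of the gap \<open>d\<close>, and the factor \<open>2\<close> in
      \<open>h\<close> turns this into \<open>1\<close>. Beyond \<open>1 + \<eta>\<close> the first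
      summand suffices.\<close>
    consider "t \<le> 1" | "1 < t" "t \<le> 1 + \<eta>" | "t > 1 + \<eta>" by linarith
    then show "1 + \<eta> \<le> t + 2 * p (w - rscale t z) / d"
    proof cases
      case 1
      have "rscale (1 - t) 0 + rscale t z \<in> D" using Dconv[OF D0 tz(2) tz(1) 1] .
      then have "p (w - rscale t z) \<ge> d" using farD by simp
      then have "2 * p (w - rscale t z) / d \<ge> 2" using d by (simp add: field_simps)
      then show ?thesis using tz \<eta> by linarith
    next
      case 2
      have "t * d \<le> t * p (w - z)" using farD[OF tz(2)] tz by (intro mult_left_mono) auto
      also have "\<dots> = p (rscale t (w - z))" using tz by (simp add: p_scale)
      also have "rscale t (w - z) = (w - rscale t z) + rscale (t - 1) w"
        by (simp add: scale_right_diff_distrib scale_left_diff_distrib)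
      also have "p \<dots> \<le> p (w - rscale t z) + p (rscale (t - 1) w)" by (rule p_add)
      also have "p (rscale (t - 1) w) = (t - 1) * p w" using 2 by (simp add: p_scale del: of_real_diff)
      also have "(t - 1) * p w \<le> \<eta> * (p w + 1)"
        using 2 p_nonneg[of w] \<eta> by (intro mult_mono) auto
      also have "\<dots> \<le> d / 2" by (rule \<eta>)
      finally have "t * d \<le> p (w - rscale t z) + d / 2" by simp
      moreover have "1 * d \<le> t * d" using 2 d by (intro mult_right_mono) auto
      ultimately have "d \<le> 2 * p (w - rscale t z)" by linarith
      then have "2 * p (w - rscale t z) / d \<ge> 1" using d by (simp add: field_simps)
      then show ?thesis using 2 \<eta> by linarith
    next
      case 3
      then show ?thesis using two by linarith
    qed
  qed
  obtain \<phi> where \<phi>: "\<And>x y. \<phi> (x + y) = \<phi> x + \<phi> y" "\<And>t x. \<phi> (rscale t x) = t * \<phi> x"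
    "\<And>x. \<phi> x \<le> g x" "\<phi> w = g w"
    by (rule hahn_banach_sublinear[OF sub, where ?y0.0 = w]) blast
  \<comment> \<open>Continuity is inherited from \<open>g\<close>, by choosing \<open>t = 0\<close>
    and \<open>z = 0\<close> in the infimum.\<close>
  have "\<phi> x \<le> 2 / d * PF F x" for x
    using \<phi>(3)[of x] le[of 0 0 x] D0 by (simp add: p_def)
  then obtain \<psi> where \<psi>: "\<psi> \<in> dual" "\<And>x. Re (\<psi> x) = \<phi> x"
    using complexify_dual[OF \<phi>(1,2) F, of "2 / d"] d
    by (metis divide_nonneg_pos zero_le_numeral)
  show thesis
  proof (rule that[OF \<psi>(1)])
    fix z assume "z \<in> C"
    then have "\<phi> (z - c0) \<le> 1" using \<phi>(3) gD by (force simp: D_def intro: order_trans)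
    moreover have "\<phi> z = \<phi> (z - c0) + \<phi> c0" using \<phi>(1)[of "z - c0" c0] by simp
    ultimately show "Re (\<psi> z) \<le> 1 + \<phi> c0" by (simp add: \<psi>(2))
  next
    have "\<phi> y = \<phi> w + \<phi> c0" using \<phi>(1)[of w c0] by (simp add: w_def)
    then show "Re (\<psi> y) > 1 + \<phi> c0" using gw \<eta>(1) by (simp add: \<psi>(2) \<phi>(4))
  qed
qed

end

section \<open>Cauchy integrals over dyadic grids\<close>

text \<open>The offset is the same on every level, so each square of level \<open>k\<close> splits
  into four squares of level \<open>k + 1\<close>.\<close>

definition gpt :: "nat \<Rightarrow> int \<Rightarrow> int \<Rightarrow> complex" where
  "gpt k i j = Complex (of_int i / 2 ^ k + 1 / 3) (of_int j / 2 ^ k + 1 / 3)"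

definition gsq :: "nat \<Rightarrow> int \<Rightarrow> int \<Rightarrow> complex set" where
  "gsq k i j = cbox (gpt k i j) (gpt k (i + 1) (j + 1))"

definition hseg :: "nat \<Rightarrow> int \<Rightarrow> int \<Rightarrow> complex set" where
  "hseg k i j = closed_segment (gpt k i j) (gpt k (i + 1) j)"

definition vseg :: "nat \<Rightarrow> int \<Rightarrow> int \<Rightarrow> complex set" where
  "vseg k i j = closed_segment (gpt k i j) (gpt k i (j + 1))"

definition hint :: "nat \<Rightarrow> (complex \<Rightarrow> complex) \<Rightarrow> int \<Rightarrow> int \<Rightarrow> complex" where
  "hint k g i j = contour_integral (linepath (gpt k i j) (gpt k (i + 1) j)) g"

definition vint :: "nat \<Rightarrow> (complex \<Rightarrow> complex) \<Rightarrow> int \<Rightarrow> int \<Rightarrow> complex" where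
  "vint k g i j = contour_integral (linepath (gpt k i j) (gpt k i (j + 1))) g"

text \<open>Edges meeting the mask \<open>M\<close> are counted as \<open>0\<close>: this is harmless, because the contributions
  of such an edge to its two adjacent squares, both of which meet \<open>M\<close>, cancel.\<close>

definition mask :: "complex set \<Rightarrow> (int \<Rightarrow> int \<Rightarrow> complex set) \<Rightarrow> (int \<Rightarrow> int \<Rightarrow> complex) \<Rightarrow> int \<Rightarrow> int \<Rightarrow> complex" where
  "mask M seg h i j = (if seg i j \<inter> M = {} then h i j else 0)"

text \<open>Counterclockwise boundary sum of one square. The edge values are arbitrary functions, so
  that masked edges, unions of half edges and differences of such data all fall under one
  cancellation argument.\<close>

definition bdry :: "(int \<Rightarrow> int \<Rightarrow> complex) \<Rightarrow> (int \<Rightarrow> int \<Rightarrow> complex) \<Rightarrow> int \<Rightarrow> int \<Rightarrow> complex" where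
  "bdry h v i j = h i j + v (i + 1) j - h i (j + 1) - v i j"

definition msq :: "nat \<Rightarrow> complex set \<Rightarrow> (int \<times> int) set" where
  "msq k M = {(i, j). gsq k i j \<inter> M \<noteq> {}}"

text \<open>The integral of \<open>g\<close> over the boundary of the union of all squares meeting
  \<open>M\<close>, written square by square; edges shared by two such squares cancel.\<close>

definition grid_integral :: "nat \<Rightarrow> complex set \<Rightarrow> (complex \<Rightarrow> complex) \<Rightarrow> complex" where
  "grid_integral k M g =
     (\<Sum>(i, j)\<in>msq k M. bdry (mask M (hseg k) (hint k g)) (mask M (vseg k) (vint k g)) i j)"

lemma Re_gpt [simp]: "Re (gpt k i j) = of_int i / 2 ^ k + 1 / 3"
  and Im_gpt [simp]: "Im (gpt k i j) = of_int j / 2 ^ k + 1 / 3"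
  by (simp_all add: gpt_def)

lemma mem_gsq: "z \<in> gsq k i j \<longleftrightarrow> Re (gpt k i j) \<le> Re z \<and> Re z \<le> Re (gpt k (i + 1) j)
    \<and> Im (gpt k i j) \<le> Im z \<and> Im z \<le> Im (gpt k i (j + 1))"
  by (auto simp: gsq_def in_cbox_complex_iff)

lemma mem_hseg: "z \<in> hseg k i j \<longleftrightarrow> Im z = Im (gpt k i j) \<and> Re (gpt k i j) \<le> Re z \<and> Re z \<le> Re (gpt k (i + 1) j)"
  unfolding hseg_def by (subst closed_segment_same_Im) (auto simp: closed_segment_eq_real_ivl divide_right_mono)

lemma mem_vseg: "z \<in> vseg k i j \<longleftrightarrow> Re z = Re (gpt k i j) \<and> Im (gpt k i j) \<le> Im z \<and> Im z \<le> Im (gpt k i (j + 1))"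
  unfolding vseg_def by (subst closed_segment_same_Re) (auto simp: closed_segment_eq_real_ivl divide_right_mono)

lemma gcoord_le: "(of_int i :: real) / 2 ^ k + 1 / 3 \<le> of_int (i + 1) / 2 ^ k + 1 / 3"
  by (simp add: divide_right_mono)

lemma hseg_subset: "hseg k i j \<subseteq> gsq k i j" "hseg k i (j + 1) \<subseteq> gsq k i j"
  using gcoord_le[of j k] by (auto simp: mem_hseg mem_gsq)

lemma vseg_subset: "vseg k i j \<subseteq> gsq k i j" "vseg k (i + 1) j \<subseteq> gsq k i j"
  using gcoord_le[of i k] by (auto simp: mem_vseg mem_gsq)

lemma convex_gsq: "convex (gsq k i j)"
  by (simp add: gsq_def convex_box)

lemma dist_gsq: 
  assumes "x \<in> gsq k i j" "y \<in> gsq k i j"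
  shows "dist x y \<le> 2 / 2 ^ k"
proof -
  have "\<bar>Re (x - y)\<bar> \<le> 1 / 2 ^ k" "\<bar>Im (x - y)\<bar> \<le> 1 / 2 ^ k"
    using assms by (auto simp: mem_gsq abs_le_iff add_divide_distrib)
  then show ?thesis using cmod_le[of "x - y"] by (simp add: dist_norm)
qed

lemma finite_msq:
  assumes "bounded M"
  shows "finite (msq k M)"
proof -
  obtain r where r: "\<And>z. z \<in> M \<Longrightarrow> cmod z \<le> r" using assms by (auto simp: bounded_iff)
  define N where "N = \<lceil>(r + 1) * 2 ^ k\<rceil> + 1"
  have *: "- N \<le> i \<and> i \<le> N" if "of_int i / 2 ^ k + 1 / 3 \<le> x" "x \<le> of_int (i + 1) / 2 ^ k + 1 / 3" "\<bar>x\<bar> \<le> r"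
    for i :: int and x :: real
  proof -
    have "of_int i / 2 ^ k \<le> r + 1" using that by simp
    then have "of_int i \<le> (r + 1) * 2 ^ k" by (simp add: field_simps)
    moreover have "- (r + 1) \<le> of_int (i + 1) / 2 ^ k" using that by linarith
    then have "- ((r + 1) * 2 ^ k) \<le> of_int (i + 1)" by (simp add: field_simps)
    ultimately show ?thesis unfolding N_def by linarith
  qed
  have "msq k M \<subseteq> {- N..N} \<times> {- N..N}"
  proof
    fix p assume "p \<in> msq k M"
    then obtain i j z where p: "p = (i, j)" "z \<in> gsq k i j" "z \<in> M" by (auto simp: msq_def)
    have "\<bar>Re z\<bar> \<le> r" "\<bar>Im z\<bar> \<le> r"
      using r[OF p(3)] abs_Re_le_cmod[of z] abs_Im_le_cmod[of z] by auto
    then show "p \<in> {- N..N} \<times> {- N..N}"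
      using *[of i "Re z"] *[of j "Im z"] p(2) unfolding mem_gsq Re_gpt Im_gpt p(1) by auto
  qed
  then show ?thesis by (rule finite_subset) simp
qed

section \<open>Cancellation of edges, change of the mask, and refinement\<close>

lemma bdry_diff: "bdry (\<lambda>i j. h i j - h' i j) (\<lambda>i j. v i j - v' i j) i j = bdry h v i j - bdry h' v' i j"
  by (simp add: bdry_def)

text \<open>Each edge with a nonzero value borders two squares of \<open>S\<close> and enters their
  boundaries with opposite signs.\<close>

lemma bdry_sum_zero:
  assumes S: "finite S"
    and h: "\<And>i j. h i j \<noteq> 0 \<Longrightarrow> (i, j) \<in> S \<and> (i, j - 1) \<in> S"
    and v: "\<And>i j. v i j \<noteq> 0 \<Longrightarrow> (i, j) \<in> S \<and> (i - 1, j) \<in> S"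
  shows "(\<Sum>(i, j)\<in>S. bdry h v i j) = 0"
proof -
  have "(\<Sum>(i, j)\<in>S. h i (j + 1)) = (\<Sum>(i, j)\<in>(\<lambda>(i, j). (i, j + 1)) ` S. h i j)"
    by (subst sum.reindex) (auto simp: inj_on_def case_prod_unfold)
  also have "\<dots> = (\<Sum>(i, j)\<in>{(i, j). h i j \<noteq> 0}. h i j)"
    by (rule sum.mono_neutral_right) (use S h in \<open>force simp: image_iff\<close>)+
  also have "\<dots> = (\<Sum>(i, j)\<in>S. h i j)"
    by (rule sum.mono_neutral_left) (use S h in auto)
  finally have 1: "(\<Sum>(i, j)\<in>S. h i (j + 1)) = (\<Sum>(i, j)\<in>S. h i j)" .
  have "(\<Sum>(i, j)\<in>S. v (i + 1) j) = (\<Sum>(i, j)\<in>(\<lambda>(i, j). (i + 1, j)) ` S. v i j)"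
    by (subst sum.reindex) (auto simp: inj_on_def case_prod_unfold)
  also have "\<dots> = (\<Sum>(i, j)\<in>{(i, j). v i j \<noteq> 0}. v i j)"
    by (rule sum.mono_neutral_right) (use S v in \<open>force simp: image_iff\<close>)+
  also have "\<dots> = (\<Sum>(i, j)\<in>S. v i j)"
    by (rule sum.mono_neutral_left) (use S v in auto)
  finally have 2: "(\<Sum>(i, j)\<in>S. v (i + 1) j) = (\<Sum>(i, j)\<in>S. v i j)" .
  show ?thesis
    unfolding bdry_def using 1 2 by (simp add: case_prod_unfold sum.distrib sum_subtractf)
qed

lemma bdry_eq_rectpath:
  assumes hol: "g holomorphic_on W" and W: "open W"
    and edges: "hseg k i j \<subseteq> W" "hseg k i (j + 1) \<subseteq> W" "vseg k i j \<subseteq> W" "vseg k (i + 1) j \<subseteq> W"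
  shows "bdry (hint k g) (vint k g) i j = contour_integral (rectpath (gpt k i j) (gpt k (i + 1) (j + 1))) g"
proof -
  have eq: "Complex (Re (gpt k (i + 1) (j + 1))) (Im (gpt k i j)) = gpt k (i + 1) j"
      "Complex (Re (gpt k i j)) (Im (gpt k (i + 1) (j + 1))) = gpt k i (j + 1)"
    by (simp_all add: complex_eq_iff)
  have int: "g contour_integrable_on linepath a b" if "closed_segment a b \<subseteq> W" for a b
    using that by (intro contour_integrable_holomorphic_simple[OF hol W]) auto
  have e: "closed_segment (gpt k i j) (gpt k (i + 1) j) \<subseteq> W"
      "closed_segment (gpt k (i + 1) j) (gpt k (i + 1) (j + 1)) \<subseteq> W"
      "closed_segment (gpt k i (j + 1)) (gpt k (i + 1) (j + 1)) \<subseteq> W"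
      "closed_segment (gpt k i j) (gpt k i (j + 1)) \<subseteq> W"
    using edges by (auto simp: hseg_def vseg_def)
  have e': "closed_segment (gpt k (i + 1) (j + 1)) (gpt k i (j + 1)) \<subseteq> W"
      "closed_segment (gpt k i (j + 1)) (gpt k i j) \<subseteq> W"
    using e(3,4) by (simp_all add: closed_segment_commute)
  have "contour_integral (linepath (gpt k (i + 1) (j + 1)) (gpt k i (j + 1))) g = - hint k g i (j + 1)"
    unfolding hint_def by (rule contour_integral_reverse_linepath)
      (intro continuous_on_subset[OF holomorphic_on_imp_continuous_on[OF hol]] e')
  moreover have "contour_integral (linepath (gpt k i (j + 1)) (gpt k i j)) g = - vint k g i j"
    unfolding vint_def by (rule contour_integral_reverse_linepath)
      (intro continuous_on_subset[OF holomorphic_on_imp_continuous_on[OF hol]] e')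
  ultimately show ?thesis
    unfolding rectpath_def Let_def eq
    by (simp add: contour_integral_join int[OF e(1)] int[OF e(2)] int[OF e'(1)] int[OF e'(2)]
        valid_path_join bdry_def hint_def vint_def)
qed

lemma gpt_le: "Re (gpt k i j) \<le> Re (gpt k (i + 1) (j + 1))" "Im (gpt k i j) \<le> Im (gpt k (i + 1) (j + 1))"
  using gcoord_le[of j k] gcoord_le[of i k] by auto

lemma bdry_square_zero:
  assumes hol: "g holomorphic_on W" and W: "open W" and sub: "gsq k i j \<subseteq> W"
  shows "bdry (hint k g) (vint k g) i j = 0"
proof -
  have "(g has_contour_integral 0) (rectpath (gpt k i j) (gpt k (i + 1) (j + 1)))"
  proof (rule Cauchy_theorem_convex_simple)
    show "g holomorphic_on gsq k i j" by (rule holomorphic_on_subset[OF hol sub])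
    show "path_image (rectpath (gpt k i j) (gpt k (i + 1) (j + 1))) \<subseteq> gsq k i j"
      unfolding gsq_def by (rule path_image_rectpath_subset_cbox[OF gpt_le])
  qed (auto simp: convex_gsq)
  moreover have "bdry (hint k g) (vint k g) i j = contour_integral (rectpath (gpt k i j) (gpt k (i + 1) (j + 1))) g"
    by (rule bdry_eq_rectpath[OF hol W]) (use hseg_subset vseg_subset sub in blast)+
  ultimately show ?thesis by (simp add: contour_integral_unique)
qed

lemma bdry_mask_outside:
  assumes "(i, j) \<notin> msq k M"
  shows "bdry (mask M (hseg k) h) (mask M (vseg k) v) i j = bdry h v i j"
  using assms hseg_subset[of k i j] vseg_subset[of k i j]
  by (auto simp: bdry_def mask_def msq_def disjoint_iff subset_iff)

text \<open>Passing from \<open>M\<close> to \<open>M0\<close> has two effects. Edges that become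
  visible meet \<open>M\<close>, so both neighbouring squares are counted and the edge cancels.
  Squares that drop out lie in \<open>W\<close>, where Cauchy's theorem makes their boundary
  integral zero.\<close>

lemma grid_integral_mask:
  assumes hol: "g holomorphic_on W" and W: "open W" and M: "bounded M" "M0 \<subseteq> M"
    and sq: "\<And>i j. (i, j) \<in> msq k M \<Longrightarrow> gsq k i j - M0 \<subseteq> W"
  shows "grid_integral k M g = grid_integral k M0 g"
proof -
  let ?b = "\<lambda>M. bdry (mask M (hseg k) (hint k g)) (mask M (vseg k) (vint k g))"
  have fin: "finite (msq k M)" by (rule finite_msq[OF M(1)])
  have sub: "msq k M0 \<subseteq> msq k M" using M(2) by (auto simp: msq_def)
  have "(\<Sum>(i, j)\<in>msq k M. ?b M0 i j - ?b M i j) = 0"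
    unfolding bdry_diff[symmetric]
  proof (rule bdry_sum_zero[OF fin])
    fix i j
    assume "mask M0 (hseg k) (hint k g) i j - mask M (hseg k) (hint k g) i j \<noteq> 0"
    then have "hseg k i j \<inter> M \<noteq> {}" using M(2) by (auto simp: mask_def split: if_splits)
    then show "(i, j) \<in> msq k M \<and> (i, j - 1) \<in> msq k M"
      using hseg_subset(1)[of k i j] hseg_subset(2)[of k i "j - 1"] by (auto simp: msq_def)
  next
    fix i j
    assume "mask M0 (vseg k) (vint k g) i j - mask M (vseg k) (vint k g) i j \<noteq> 0"
    then have "vseg k i j \<inter> M \<noteq> {}" using M(2) by (auto simp: mask_def split: if_splits)
    then show "(i, j) \<in> msq k M \<and> (i - 1, j) \<in> msq k M"
      using vseg_subset(1)[of k i j] vseg_subset(2)[of k "i - 1" j] by (auto simp: msq_def)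
  qed
  then have "grid_integral k M g = (\<Sum>(i, j)\<in>msq k M. ?b M0 i j)"
    by (simp add: grid_integral_def sum_subtractf case_prod_unfold)
  also have "\<dots> = grid_integral k M0 g"
    unfolding grid_integral_def
  proof (rule sum.mono_neutral_right[OF fin sub], safe)
    fix i j assume ij: "(i, j) \<in> msq k M" "(i, j) \<notin> msq k M0"
    then have "gsq k i j \<subseteq> W" using sq[OF ij(1)] by (auto simp: msq_def)
    then show "?b M0 i j = 0" using bdry_mask_outside[OF ij(2)] bdry_square_zero[OF hol W] by simp
  qed
  finally show ?thesis .
qed

lemma gpt_double: "gpt (Suc k) (2 * i) (2 * j) = gpt k i j"
  by (simp add: gpt_def)

lemma sub_gsq: "gsq (Suc k) i j \<subseteq> gsq k (i div 2) (j div 2)"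
proof -
  have lo: "(of_int (i div 2) :: real) / 2 ^ k + 1 / 3 \<le> of_int i / 2 ^ Suc k + 1 / 3"
    and hi: "(of_int (i + 1) :: real) / 2 ^ Suc k + 1 / 3 \<le> of_int (i div 2 + 1) / 2 ^ k + 1 / 3" for i :: int
  proof -
    have "real_of_int (2 * (i div 2)) \<le> of_int i" "real_of_int (i + 1) \<le> of_int (2 * (i div 2 + 1))"
      unfolding of_int_le_iff by presburger+
    then have "real_of_int (2 * (i div 2)) / 2 ^ Suc k \<le> of_int i / 2 ^ Suc k"
      "real_of_int (i + 1) / 2 ^ Suc k \<le> of_int (2 * (i div 2 + 1)) / 2 ^ Suc k"
      by (intro divide_right_mono; simp)+
    then show "(of_int (i div 2) :: real) / 2 ^ k + 1 / 3 \<le> of_int i / 2 ^ Suc k + 1 / 3"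
      "(of_int (i + 1) :: real) / 2 ^ Suc k + 1 / 3 \<le> of_int (i div 2 + 1) / 2 ^ k + 1 / 3"
      by (simp_all only: of_int_mult power_Suc of_int_numeral)
  qed
  show ?thesis
    using lo[of i] lo[of j] hi[of i] hi[of j] unfolding subset_iff mem_gsq Re_gpt Im_gpt
    by (meson order_trans)
qed

text \<open>Each coarse square is replaced by its four children; children missing \<open>M\<close>
  contribute zero by Cauchy's theorem. What remains compares a coarse edge with its two halves:
  these agree on edges that avoid \<open>M\<close>, and edges that meet \<open>M\<close> cancel
  between their two squares.\<close>

lemma grid_integral_Suc:
  assumes hol: "g holomorphic_on W" and W: "open W" and M: "bounded M"
    and sq: "\<And>i j. (i, j) \<in> msq k M \<Longrightarrow> gsq k i j - M \<subseteq> W"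
  shows "grid_integral (Suc k) M g = grid_integral k M g"
proof -
  define h v where "h = mask M (hseg (Suc k)) (hint (Suc k) g)"
    and "v = mask M (vseg (Suc k)) (vint (Suc k) g)"
  define S where "S = msq k M"
  have fin: "finite S" unfolding S_def by (rule finite_msq[OF M])
  define S' where "S' = (\<lambda>((i, j), a, b). (2 * i + a, 2 * j + b)) ` (S \<times> {0, 1} \<times> {0, 1 :: int})"
  have inj: "inj_on (\<lambda>((i, j), a, b). (2 * i + a, 2 * j + b)) (S \<times> {0, 1} \<times> {0, 1 :: int})"
    by (rule inj_on_inverseI[where g = "\<lambda>(i, j). ((i div 2, j div 2), i mod 2, j mod 2)"]) auto
  have sub: "msq (Suc k) M \<subseteq> S'"
  proof
    fix p assume p: "p \<in> msq (Suc k) M"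
    obtain i j where ij: "p = (i, j)" by (cases p)
    then have "(i div 2, j div 2) \<in> S" using p sub_gsq[of k i j] by (auto simp: S_def msq_def)
    moreover have "i mod 2 \<in> {0, 1}" "j mod 2 \<in> {0, 1}" by auto
    ultimately show "p \<in> S'"
      unfolding S'_def ij by (intro image_eqI[where x = "((i div 2, j div 2), i mod 2, j mod 2)"]) auto
  qed
  have sq': "gsq (Suc k) i j \<subseteq> gsq k (i div 2) (j div 2) \<and> (i div 2, j div 2) \<in> S" if "(i, j) \<in> S'" for i j
    using that sub_gsq[of k i j] unfolding S'_def by auto
  have "grid_integral (Suc k) M g = (\<Sum>(i, j)\<in>S'. bdry h v i j)"
    unfolding grid_integral_def h_def[symmetric] v_def[symmetric]
  proof (rule sum.mono_neutral_left[OF _ sub], safe)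
    show "finite S'" unfolding S'_def using fin by auto
    fix i j assume ij: "(i, j) \<in> S'" "(i, j) \<notin> msq (Suc k) M"
    then have "gsq (Suc k) i j \<subseteq> W" using sq'[OF ij(1)] sq unfolding S_def by (fastforce simp: msq_def)
    then show "bdry h v i j = 0"
      unfolding h_def v_def using bdry_mask_outside[OF ij(2)] bdry_square_zero[OF hol W] by simp
  qed
  also have "\<dots> = (\<Sum>((i, j), a, b)\<in>S \<times> {0, 1} \<times> {0, 1}. bdry h v (2 * i + a) (2 * j + b))"
    unfolding S'_def by (subst sum.reindex[OF inj]) (simp add: case_prod_unfold)
  also have "\<dots> = (\<Sum>(i, j)\<in>S. \<Sum>(a, b)\<in>{0, 1} \<times> {0, 1}. bdry h v (2 * i + a) (2 * j + b))"
    unfolding sum.cartesian_product' by (simp add: case_prod_unfold)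
  \<comment> \<open>The four inner edges of a subdivided square cancel, and its outer half edges
    combine in pairs.\<close>
  also have "\<dots> = (\<Sum>(i, j)\<in>S. bdry (\<lambda>i j. h (2 * i) (2 * j) + h (2 * i + 1) (2 * j))
      (\<lambda>i j. v (2 * i) (2 * j) + v (2 * i) (2 * j + 1)) i j)" (is "_ = (\<Sum>(i, j)\<in>S. bdry ?h ?v i j)")
  proof (intro sum.cong refl, clarify)
    fix i j
    show "(\<Sum>(a, b)\<in>{0, 1} \<times> {0, 1}. bdry h v (2 * i + a) (2 * j + b)) = bdry ?h ?v i j"
      unfolding sum.cartesian_product[symmetric] by (simp add: bdry_def algebra_simps)
  qed
  also have "\<dots> = grid_integral k M g"
  proof -
    let ?h' = "mask M (hseg k) (hint k g)" and ?v' = "mask M (vseg k) (vint k g)"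
    have cont: "continuous_on (closed_segment a b) g" if "closed_segment a b \<subseteq> W" for a b
      by (rule continuous_on_subset[OF holomorphic_on_imp_continuous_on[OF hol] that])
    \<comment> \<open>Set to zero on edges avoiding \<open>M\<close>, because the comparison of an
      edge with its halves is known only for edges of squares in \<open>S\<close>; elsewhere
      \<open>g\<close> need not be holomorphic along the edge.\<close>
    define dh dv where
      "dh = (\<lambda>i j. if hseg k i j \<inter> M = {} then 0 else ?h i j - ?h' i j)" and
      "dv = (\<lambda>i j. if vseg k i j \<inter> M = {} then 0 else ?v i j - ?v' i j)"
    have dh: "dh i j = ?h i j - ?h' i j" if "hseg k i j \<subseteq> gsq k i' j'" "(i', j') \<in> S" for i j i' j'
    proof (cases "hseg k i j \<inter> M = {}")
      case True
      then have W': "hseg k i j \<subseteq> W" using that sq unfolding S_def by blast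
      have mid: "gpt (Suc k) (2 * i + 1) (2 * j) \<in> hseg k i j"
        unfolding mem_hseg Re_gpt Im_gpt by (simp add: field_simps)
      have e: "gpt (Suc k) (2 * i + 1 + 1) (2 * j) = gpt k (i + 1) j"
        using gpt_double[of k "i + 1" j] by (simp add: algebra_simps)
      have sub: "hseg (Suc k) (2 * i) (2 * j) \<subseteq> hseg k i j" "hseg (Suc k) (2 * i + 1) (2 * j) \<subseteq> hseg k i j"
        using mid unfolding hseg_def e gpt_double by (simp_all add: closed_segment_subset)
      have "hint k g i j = hint (Suc k) g (2 * i) (2 * j) + hint (Suc k) g (2 * i + 1) (2 * j)"
        unfolding hint_def e gpt_double
        by (rule contour_integral_split_linepath[OF cont mid[unfolded hseg_def]]) (use W' in \<open>simp add: hseg_def\<close>)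
      moreover have "hseg (Suc k) (2 * i) (2 * j) \<inter> M = {}" "hseg (Suc k) (2 * i + 1) (2 * j) \<inter> M = {}"
        using sub True by blast+
      ultimately show ?thesis using True by (simp add: dh_def h_def mask_def)
    qed (simp add: dh_def)
    have dv: "dv i j = ?v i j - ?v' i j" if "vseg k i j \<subseteq> gsq k i' j'" "(i', j') \<in> S" for i j i' j'
    proof (cases "vseg k i j \<inter> M = {}")
      case True
      then have W': "vseg k i j \<subseteq> W" using that sq unfolding S_def by blast
      have mid: "gpt (Suc k) (2 * i) (2 * j + 1) \<in> vseg k i j"
        unfolding mem_vseg Re_gpt Im_gpt by (simp add: field_simps)
      have e: "gpt (Suc k) (2 * i) (2 * j + 1 + 1) = gpt k i (j + 1)"
        using gpt_double[of k i "j + 1"] by (simp add: algebra_simps)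
      have sub: "vseg (Suc k) (2 * i) (2 * j) \<subseteq> vseg k i j" "vseg (Suc k) (2 * i) (2 * j + 1) \<subseteq> vseg k i j"
        using mid unfolding vseg_def e gpt_double by (simp_all add: closed_segment_subset)
      have "vint k g i j = vint (Suc k) g (2 * i) (2 * j) + vint (Suc k) g (2 * i) (2 * j + 1)"
        unfolding vint_def e gpt_double
        by (rule contour_integral_split_linepath[OF cont mid[unfolded vseg_def]]) (use W' in \<open>simp add: vseg_def\<close>)
      moreover have "vseg (Suc k) (2 * i) (2 * j) \<inter> M = {}" "vseg (Suc k) (2 * i) (2 * j + 1) \<inter> M = {}"
        using sub True by blast+
      ultimately show ?thesis using True by (simp add: dv_def v_def mask_def)
    qed (simp add: dv_def)
    have "(\<Sum>(i, j)\<in>S. bdry ?h ?v i j - bdry ?h' ?v' i j) = (\<Sum>(i, j)\<in>S. bdry dh dv i j)"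
    proof (intro sum.cong refl, clarify)
      fix i j assume ij: "(i, j) \<in> S"
      show "bdry ?h ?v i j - bdry ?h' ?v' i j = bdry dh dv i j"
        using dh[OF hseg_subset(1) ij] dh[OF hseg_subset(2) ij] dv[OF vseg_subset(1) ij] dv[OF vseg_subset(2) ij]
        by (simp add: bdry_def)
    qed
    also have "\<dots> = 0"
    proof (rule bdry_sum_zero[OF fin])
      fix i j assume "dh i j \<noteq> 0"
      then have "hseg k i j \<inter> M \<noteq> {}" by (auto simp: dh_def split: if_splits)
      then show "(i, j) \<in> S \<and> (i, j - 1) \<in> S"
        using hseg_subset(1)[of k i j] hseg_subset(2)[of k i "j - 1"] by (auto simp: msq_def S_def)
    next
      fix i j assume "dv i j \<noteq> 0"
      then have "vseg k i j \<inter> M \<noteq> {}" by (auto simp: dv_def split: if_splits)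
      then show "(i, j) \<in> S \<and> (i - 1, j) \<in> S"
        using vseg_subset(1)[of k i j] vseg_subset(2)[of k "i - 1" j] by (auto simp: msq_def S_def)
    qed
    finally have "(\<Sum>(i, j)\<in>S. bdry ?h ?v i j - bdry ?h' ?v' i j) = 0" .
    then show ?thesis
      by (simp add: grid_integral_def sum_subtractf case_prod_unfold S_def)
  qed
  finally show ?thesis .
qed

text \<open>Both masks are shrunk to the common core \<open>M0\<close>; then the coarser grid is
  refined to the level of the finer one. The condition on squares survives refinement, since a child
  lies in its parent.\<close>

lemma grid_integral_independent:
  assumes hol: "g holomorphic_on W" and W: "open W" and M: "bounded M" "M0 \<subseteq> M" "bounded M'" "M0 \<subseteq> M'"
    and sq: "\<And>i j. (i, j) \<in> msq k M \<Longrightarrow> gsq k i j - M0 \<subseteq> W"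
    and sq': "\<And>i j. (i, j) \<in> msq k' M' \<Longrightarrow> gsq k' i j - M0 \<subseteq> W"
  shows "grid_integral k M g = grid_integral k' M' g"
proof -
  have M0: "bounded M0" using M by (meson bounded_subset)
  have step: "grid_integral (k + d) M0 g = grid_integral k M0 g
      \<and> (\<forall>(i, j)\<in>msq (k + d) M0. gsq (k + d) i j - M0 \<subseteq> W)"
    if sq: "\<And>i j. (i, j) \<in> msq k M0 \<Longrightarrow> gsq k i j - M0 \<subseteq> W" for k d
  proof (induction d)
    case 0
    then show ?case using sq by auto
  next
    case (Suc d)
    then have "grid_integral (Suc (k + d)) M0 g = grid_integral (k + d) M0 g"
      by (intro grid_integral_Suc[OF hol W M0]) auto
    moreover have "gsq (Suc (k + d)) i j - M0 \<subseteq> W" if "(i, j) \<in> msq (Suc (k + d)) M0" for i j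
    proof -
      have "(i div 2, j div 2) \<in> msq (k + d) M0"
        using that sub_gsq[of "k + d" i j] by (auto simp: msq_def)
      then have "gsq (k + d) (i div 2) (j div 2) - M0 \<subseteq> W" using Suc by auto
      then show ?thesis using sub_gsq[of "k + d" i j] by auto
    qed
    ultimately show ?case using Suc by auto
  qed
  have sub: "msq k M0 \<subseteq> msq k M" "msq k' M0 \<subseteq> msq k' M'" using M by (auto simp: msq_def)
  have sqM0: "\<And>i j. (i, j) \<in> msq k M0 \<Longrightarrow> gsq k i j - M0 \<subseteq> W"
      "\<And>i j. (i, j) \<in> msq k' M0 \<Longrightarrow> gsq k' i j - M0 \<subseteq> W"
    using sub sq sq' by blast+
  have "grid_integral k M g = grid_integral k M0 g"
    using grid_integral_mask[OF hol W M(1,2) sq] .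
  also have "grid_integral k M0 g = grid_integral k' M0 g"
  proof (cases "k \<le> k'")
    case True
    then show ?thesis using step[of k "k' - k", OF sqM0(1)] by simp
  next
    case False
    then show ?thesis using step[of k' "k - k'", OF sqM0(2)] by simp
  qed
  also have "\<dots> = grid_integral k' M' g"
    using grid_integral_mask[OF hol W M(3,4) sq'] by simp
  finally show ?thesis .
qed

text \<open>The offset \<open>1/3\<close> keeps the origin off the edges of all the dyadic grids.\<close>

lemma gcoord_nonzero: "(of_int i :: real) / 2 ^ k + 1 / 3 \<noteq> 0"
proof
  assume "(of_int i :: real) / 2 ^ k + 1 / 3 = 0"
  then have "(of_int (3 * i + 2 ^ k) :: real) = 0" by (simp add: field_simps)
  then have "3 * i + 2 ^ k = 0" by (simp only: of_int_eq_0_iff)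
  then have "(3 :: int) dvd 2 ^ k" by (metis add.commute dvd_add_right_iff dvd_triv_left dvd_0_right)
  then have "(3 :: int) dvd 2" by (rule prime_dvd_power[rotated]) simp
  then show False by simp
qed

lemma gcoord_unique:
  fixes i i' :: int
  assumes "of_int i / 2 ^ k + 1 / 3 \<le> (0::real)" "(0::real) \<le> of_int (i + 1) / 2 ^ k + 1 / 3"
    "of_int i' / 2 ^ k + 1 / 3 \<le> (0::real)" "(0::real) \<le> of_int (i' + 1) / 2 ^ k + 1 / 3"
  shows "i = i'"
proof -
  have *: "of_int i / 2 ^ k < (of_int (i' + 1) :: real) / 2 ^ k"
    if "of_int i / 2 ^ k + 1 / 3 \<le> (0::real)" "(0::real) \<le> of_int (i' + 1) / 2 ^ k + 1 / 3" for i i' :: int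
    using that gcoord_nonzero[of i k] by linarith
  have "i < i' + 1" "i' < i + 1"
    using *[OF assms(1,4)] *[OF assms(3,2)] by (simp_all add: divide_less_cancel flip: of_int_add)
  then show ?thesis by simp
qed

lemma gcoord_exists: "\<exists>i::int. of_int i / 2 ^ k + 1 / 3 \<le> (0::real) \<and> (0::real) \<le> of_int (i + 1) / 2 ^ k + 1 / 3"
proof -
  define i where "i = \<lfloor>- (2 ^ k / 3) :: real\<rfloor>"
  have "of_int i \<le> - (2 ^ k / 3 :: real)" "- (2 ^ k / 3 :: real) \<le> of_int (i + 1)"
    unfolding i_def by linarith+
  then have "of_int i / 2 ^ k + 1 / 3 \<le> (0::real)" "(0::real) \<le> of_int (i + 1) / 2 ^ k + 1 / 3"
    by (simp_all add: field_simps)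
  then show ?thesis by blast
qed

text \<open>The mask can be shrunk to the pole alone. Exactly one square then remains, with the pole
  in its interior, and Cauchy's formula for a rectangle applies.\<close>

lemma grid_cauchy_formula:
  assumes hol: "F holomorphic_on U" and U: "open U" and M: "bounded M" "0 \<in> M"
    and sq: "\<And>i j. (i, j) \<in> msq k M \<Longrightarrow> gsq k i j \<subseteq> U"
  shows "grid_integral k M (\<lambda>l. F l / l) = 2 * pi * \<i> * F 0"
proof -
  define W where "W = U - {0}"
  have W: "open W" unfolding W_def using U by (rule open_delete)
  have hol': "(\<lambda>l. F l / l) holomorphic_on W"
    unfolding W_def by (intro holomorphic_intros holomorphic_on_subset[OF hol]) auto
  have "grid_integral k M (\<lambda>l. F l / l) = grid_integral k {0} (\<lambda>l. F l / l)"
    by (rule grid_integral_mask[OF hol' W M(1)]) (use M sq in \<open>auto simp: W_def\<close>)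
  also have "\<dots> = 2 * pi * \<i> * F 0"
  proof -
    obtain i j :: int where i: "of_int i / 2 ^ k + 1 / 3 \<le> (0::real)" "(0::real) \<le> of_int (i + 1) / 2 ^ k + 1 / 3"
      and j: "of_int j / 2 ^ k + 1 / 3 \<le> (0::real)" "(0::real) \<le> of_int (j + 1) / 2 ^ k + 1 / 3"
      using gcoord_exists[of k] by metis
    have m: "msq k {0} = {(i, j)}"
    proof -
      have "0 \<in> gsq k i' j' \<longleftrightarrow> i' = i \<and> j' = j" for i' j'
        using gcoord_unique[OF i, of i'] gcoord_unique[OF j, of j'] i j
        unfolding mem_gsq Re_gpt Im_gpt zero_complex.sel by blast
      then show ?thesis by (auto simp: msq_def)
    qed
    then have "(i, j) \<in> msq k {0}" by simp
    then have "(i, j) \<in> msq k M" using M(2) unfolding msq_def by blast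
    then have sqU: "gsq k i j \<subseteq> U" by (rule sq)
    have lt: "of_int i / 2 ^ k + 1 / 3 < (0::real)" "(0::real) < of_int (i + 1) / 2 ^ k + 1 / 3"
      "of_int j / 2 ^ k + 1 / 3 < (0::real)" "(0::real) < of_int (j + 1) / 2 ^ k + 1 / 3"
      using i j gcoord_nonzero[of i k] gcoord_nonzero[of j k] gcoord_nonzero[of "i + 1" k] gcoord_nonzero[of "j + 1" k]
      by (metis order_le_less)+
    then have box: "0 \<in> box (gpt k i j) (gpt k (i + 1) (j + 1))"
      unfolding in_box_complex_iff Re_gpt Im_gpt zero_complex.sel greaterThanLessThan_iff by blast
    have "0 \<notin> hseg k i j" "0 \<notin> hseg k i (j + 1)" "0 \<notin> vseg k i j" "0 \<notin> vseg k (i + 1) j"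
      using lt unfolding mem_hseg mem_vseg Re_gpt Im_gpt zero_complex.sel by (metis order_less_irrefl)+
    then have edges: "hseg k i j \<inter> {0} = {}" "hseg k i (j + 1) \<inter> {0} = {}"
        "vseg k i j \<inter> {0} = {}" "vseg k (i + 1) j \<inter> {0} = {}"
      by blast+
    have "grid_integral k {0} (\<lambda>l. F l / l) = bdry (hint k (\<lambda>l. F l / l)) (vint k (\<lambda>l. F l / l)) i j"
      unfolding grid_integral_def m using edges by (simp add: bdry_def mask_def)
    also have "\<dots> = contour_integral (rectpath (gpt k i j) (gpt k (i + 1) (j + 1))) (\<lambda>l. F l / l)"
    proof (rule bdry_eq_rectpath[OF hol' W])
      show "hseg k i j \<subseteq> W" "hseg k i (j + 1) \<subseteq> W"
        using edges(1,2) hseg_subset[where k = k and i = i and j = j] sqU unfolding W_def by blast+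
      show "vseg k i j \<subseteq> W" "vseg k (i + 1) j \<subseteq> W"
        using edges(3,4) vseg_subset[where k = k and i = i and j = j] sqU unfolding W_def by blast+
    qed
    also have "\<dots> = 2 * pi * \<i> * F 0"
    proof -
      let ?r = "rectpath (gpt k i j) (gpt k (i + 1) (j + 1))"
      have "((\<lambda>l. F l / (l - 0)) has_contour_integral (2 * pi * \<i> * winding_number ?r 0 * F 0)) ?r"
      proof (rule Cauchy_integral_formula_convex_simple)
        show "F holomorphic_on gsq k i j" by (rule holomorphic_on_subset[OF hol sqU])
        show "0 \<in> interior (gsq k i j)" using box by (simp add: gsq_def interior_cbox)
        show "path_image ?r \<subseteq> gsq k i j - {0}"
        proof -
          have "0 \<notin> path_image ?r" using box by (auto simp: path_image_rectpath_cbox_minus_box[OF gpt_le])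
          then show ?thesis using path_image_rectpath_subset_cbox[OF gpt_le, of k i j] by (auto simp: gsq_def)
        qed
      qed (auto simp: convex_gsq)
      then show ?thesis using winding_number_rectpath[OF box] by (simp add: contour_integral_unique)
    qed
    finally show ?thesis .
  qed
  finally show ?thesis .
qed

section \<open>Gateaux holomorphic functions\<close>

lemma riemann_sum_error:
  fixes H :: "real \<Rightarrow> complex"
  assumes cont: "continuous_on {0..1} H" and N: "N > 0"
    and osc: "\<And>x y. x \<in> {0..1} \<Longrightarrow> y \<in> {0..1} \<Longrightarrow> \<bar>x - y\<bar> \<le> 1 / real N \<Longrightarrow> cmod (H x - H y) \<le> e"
  shows "cmod (integral {0..1} H - (\<Sum>j<N. H (real j / real N)) / of_nat N) \<le> e"
proof -
  have "cmod (integral {0..real m / real N} H - (\<Sum>j<m. H (real j / real N)) / of_nat N) \<le> real m * (e / real N)"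
    if "m \<le> N" for m
    using that
  proof (induction m)
    case (Suc m)
    define a b where "a = real m / real N" and "b = real (Suc m) / real N"
    have ab: "0 \<le> a" "a \<le> b" "b \<le> 1" "b - a = 1 / real N"
      using Suc.prems N by (auto simp: a_def b_def field_simps)
    have sub: "{0..b} \<subseteq> {0..1}" "{a..b} \<subseteq> {0..1}" using ab by auto
    have int: "H integrable_on {0..b}" "H integrable_on {a..b}"
      by (intro integrable_continuous_real continuous_on_subset[OF cont] sub)+
    have split: "integral {0..b} H = integral {0..a} H + integral {a..b} H"
      using Henstock_Kurzweil_Integration.integral_combine[OF ab(1,2) int(1)] by simp
    have "integral {a..b} (\<lambda>x. H x - H a) = integral {a..b} H - of_real (b - a) * H a"
      using int ab by (subst Henstock_Kurzweil_Integration.integral_diff) (auto simp: scaleR_conv_of_real)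
    moreover have "cmod (integral {a..b} (\<lambda>x. H x - H a)) \<le> e * (b - a)"
    proof (rule integral_bound[OF ab(2)])
      show "continuous_on {a..b} (\<lambda>x. H x - H a)"
        by (intro continuous_intros continuous_on_subset[OF cont sub(2)])
      fix x assume x: "x \<in> {a..b}"
      then have "\<bar>x - a\<bar> \<le> 1 / real N" using ab by auto
      then show "cmod (H x - H a) \<le> e" using osc x ab by auto
    qed
    ultimately have step: "cmod (integral {a..b} H - H a / of_nat N) \<le> e / real N"
      by (simp add: ab(4))
    have "integral {0..b} H - (\<Sum>j<Suc m. H (real j / real N)) / of_nat N
        = (integral {0..a} H - (\<Sum>j<m. H (real j / real N)) / of_nat N) + (integral {a..b} H - H a / of_nat N)"
      by (simp add: split a_def add_divide_distrib)
    also have "cmod \<dots> \<le> real m * (e / real N) + e / real N"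
      using Suc.IH Suc.prems step unfolding a_def[symmetric] by (intro norm_triangle_mono) auto
    finally show ?case by (simp add: b_def algebra_simps add_divide_distrib)
  qed simp
  from this[of N] N show ?thesis by simp
qed

definition riemann_sum :: "nat \<Rightarrow> complex \<Rightarrow> complex \<Rightarrow> (complex \<Rightarrow> complex) \<Rightarrow> complex" where
  "riemann_sum N p q g = (q - p) / of_nat N * (\<Sum>j<N. g (linepath p q (real j / real N)))"

lemma linepath_riemann_error:
  assumes cont: "continuous_on (closed_segment p q) g" and N: "N > 0"
    and osc: "\<And>x y. x \<in> closed_segment p q \<Longrightarrow> y \<in> closed_segment p q \<Longrightarrow> cmod (x - y) \<le> cmod (q - p) / real N
        \<Longrightarrow> cmod (g x - g y) \<le> e"
  shows "cmod (contour_integral (linepath p q) g - riemann_sum N p q g) \<le> cmod (q - p) * e"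
proof -
  define H where "H = (\<lambda>t. g (linepath p q t))"
  have seg: "linepath p q t \<in> closed_segment p q" if "t \<in> {0..1}" for t
    using that linepath_in_path by blast
  have contH: "continuous_on {0..1} H" unfolding H_def
    by (rule continuous_on_compose2[OF cont]) (use seg in \<open>auto intro: continuous_on_linepath\<close>)
  have "contour_integral (linepath p q) g = integral {0..1} (\<lambda>t. H t * (q - p))"
    by (simp add: contour_integral_integral H_def)
  also have "\<dots> = integral {0..1} H * (q - p)"
    by simp
  finally have "contour_integral (linepath p q) g - riemann_sum N p q g
      = (q - p) * (integral {0..1} H - (\<Sum>j<N. H (real j / real N)) / of_nat N)"
    by (simp add: riemann_sum_def H_def algebra_simps)
  moreover have "cmod (integral {0..1} H - (\<Sum>j<N. H (real j / real N)) / of_nat N) \<le> e"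
  proof (rule riemann_sum_error[OF contH N])
    fix x y :: real assume xy: "x \<in> {0..1}" "y \<in> {0..1}" "\<bar>x - y\<bar> \<le> 1 / real N"
    have "linepath p q x - linepath p q y = of_real (x - y) * (q - p)"
      by (simp add: linepath_def scaleR_conv_of_real algebra_simps)
    then have "cmod (linepath p q x - linepath p q y) = \<bar>x - y\<bar> * cmod (q - p)"
      by (simp add: norm_mult del: of_real_diff)
    also have "\<dots> \<le> 1 / real N * cmod (q - p)" using xy by (intro mult_right_mono) auto
    finally show "cmod (H x - H y) \<le> e" unfolding H_def using seg xy by (intro osc) auto
  qed
  ultimately show ?thesis by (simp add: norm_mult mult_left_mono)
qed

text \<open>A holomorphic function is Lipschitz on a segment in its domain, so the error is of order
  \<open>1 / N\<close>; along \<open>N = 2 ^ n\<close> this becomes the geometric rate required by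
  \<open>weak_limit_exists\<close>.\<close>

lemma linepath_riemann_rate:
  assumes hol: "g holomorphic_on W" and W: "open W" and sub: "closed_segment p q \<subseteq> W"
  obtains C where "\<And>N. N > 0 \<Longrightarrow> cmod (contour_integral (linepath p q) g - riemann_sum N p q g) \<le> C / real N"
proof -
  have "continuous_on (closed_segment p q) (deriv g)"
    by (rule continuous_on_subset[OF holomorphic_on_imp_continuous_on[OF holomorphic_deriv[OF hol W]] sub])
  then have "bounded (deriv g ` closed_segment p q)"
    by (intro compact_imp_bounded compact_continuous_image) auto
  then obtain B where B: "\<And>x. x \<in> closed_segment p q \<Longrightarrow> cmod (deriv g x) \<le> B"
    unfolding bounded_iff by blast
  have B0: "B \<ge> 0" using order_trans[OF norm_ge_zero B[of p]] by simp
  have lip: "cmod (g x - g y) \<le> B * cmod (x - y)" if "x \<in> closed_segment p q" "y \<in> closed_segment p q" for x y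
  proof (rule field_differentiable_bound[OF convex_closed_segment _ B that])
    fix z assume "z \<in> closed_segment p q"
    then show "(g has_field_derivative deriv g z) (at z within closed_segment p q)"
      using holomorphic_derivI[OF hol W] sub has_field_derivative_at_within by blast
  qed
  show thesis
  proof (rule that)
    fix N :: nat assume N: "N > 0"
    have "cmod (contour_integral (linepath p q) g - riemann_sum N p q g) \<le> cmod (q - p) * (B * (cmod (q - p) / real N))"
    proof (rule linepath_riemann_error[OF _ N])
      show "continuous_on (closed_segment p q) g"
        by (rule continuous_on_subset[OF holomorphic_on_imp_continuous_on[OF hol] sub])
      fix x y assume xy: "x \<in> closed_segment p q" "y \<in> closed_segment p q" "cmod (x - y) \<le> cmod (q - p) / real N"
      show "cmod (g x - g y) \<le> B * (cmod (q - p) / real N)"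
        by (rule order_trans[OF lip[OF xy(1,2)] mult_left_mono[OF xy(3) B0]])
    qed
    then show "cmod (contour_integral (linepath p q) g - riemann_sum N p q g) \<le> cmod (q - p) * B * cmod (q - p) / real N"
      by simp
  qed
qed

text \<open>The Riemann sums are finite sums of functions holomorphic in \<open>m\<close>, and
  uniform continuity on compact sets makes them converge locally uniformly.\<close>

lemma contour_integral_parameter_holomorphic:
  fixes H :: "complex \<Rightarrow> complex \<Rightarrow> complex"
  assumes cont: "continuous_on (closed_segment p q \<times> ball 0 r) (\<lambda>(l, m). H l m)"
    and hol: "\<And>l. l \<in> closed_segment p q \<Longrightarrow> H l holomorphic_on ball 0 r"
  shows "(\<lambda>m. contour_integral (linepath p q) (\<lambda>l. H l m)) holomorphic_on ball 0 r"
proof (rule holomorphic_uniform_sequence[OF open_ball])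
  let ?R = "\<lambda>n m. riemann_sum (Suc n) p q (\<lambda>l. H l m)"
  show "?R n holomorphic_on ball 0 r" for n
    unfolding riemann_sum_def
  proof (intro holomorphic_intros hol)
    fix j assume "j \<in> {..<Suc n}"
    then have "real j / real (Suc n) \<in> {0..1}" by auto
    then show "linepath p q (real j / real (Suc n)) \<in> closed_segment p q" by (rule linepath_in_path)
  qed
  fix m :: complex assume "m \<in> ball 0 r"
  then obtain d where d: "d > 0" "cball m d \<subseteq> ball 0 r"
    using open_contains_cball open_ball by blast
  have "uniform_limit (cball m d) ?R (\<lambda>m. contour_integral (linepath p q) (\<lambda>l. H l m)) sequentially"
  proof (rule uniform_limitI)
    fix e :: real assume e: "e > 0"
    define e' where "e' = e / (cmod (q - p) + 1)"
    have e': "e' > 0" using e by (simp add: e'_def add_nonneg_pos)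
    have le: "cmod (q - p) * e' < e"
    proof -
      have "cmod (q - p) * e' < (cmod (q - p) + 1) * e'" using e' by simp
      also have "\<dots> = e" using norm_ge_zero[of "q - p"] by (simp add: e'_def add_nonneg_eq_0_iff)
      finally show ?thesis .
    qed
    have "compact (closed_segment p q \<times> cball m d)" by (intro compact_Times) auto
    moreover have "continuous_on (closed_segment p q \<times> cball m d) (\<lambda>(l, m). H l m)"
      by (rule continuous_on_subset[OF cont]) (use d in auto)
    ultimately have "uniformly_continuous_on (closed_segment p q \<times> cball m d) (\<lambda>(l, m). H l m)"
      by (rule compact_uniformly_continuous[rotated])
    then obtain \<delta> where \<delta>: "\<delta> > 0"
      and *: "\<And>a b. a \<in> closed_segment p q \<times> cball m d \<Longrightarrow> b \<in> closed_segment p q \<times> cball m d \<Longrightarrow> dist a b < \<delta>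
         \<Longrightarrow> dist ((\<lambda>(l, m). H l m) a) ((\<lambda>(l, m). H l m) b) < e'"
      using e' unfolding uniformly_continuous_on_def by metis
    obtain n0 :: nat where n0: "cmod (q - p) / \<delta> < real n0" using reals_Archimedean2 by blast
    have "dist (?R n x) (contour_integral (linepath p q) (\<lambda>l. H l x)) < e" if n: "n \<ge> n0" and x: "x \<in> cball m d" for n x
    proof -
      have "cmod (q - p) / \<delta> < real (Suc n)" using n0 n by simp
      then have small: "cmod (q - p) / real (Suc n) < \<delta>" using \<delta> by (simp add: field_simps)
      have "cmod (contour_integral (linepath p q) (\<lambda>l. H l x) - ?R n x) \<le> cmod (q - p) * e'"
      proof (rule linepath_riemann_error)
        show "continuous_on (closed_segment p q) (\<lambda>l. H l x)"
        proof -
          have "continuous_on (closed_segment p q) (\<lambda>l. (\<lambda>(l, m). H l m) (l, x))"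
            by (rule continuous_on_compose2[OF cont]) (use d x in \<open>auto intro!: continuous_intros\<close>)
          then show ?thesis by simp
        qed
        fix l l' assume l: "l \<in> closed_segment p q" "l' \<in> closed_segment p q" "cmod (l - l') \<le> cmod (q - p) / real (Suc n)"
        then have "dist (l, x) (l', x) < \<delta>" using small by (simp add: dist_prod_def dist_norm)
        then show "cmod (H l x - H l' x) \<le> e'"
          using *[of "(l, x)" "(l', x)"] l x by (simp add: dist_norm)
      qed simp
      then show ?thesis using le by (simp add: dist_norm norm_minus_commute)
    qed
    then show "\<forall>\<^sub>F n in sequentially. \<forall>x\<in>cball m d. dist (?R n x) (contour_integral (linepath p q) (\<lambda>l. H l x)) < e"
      unfolding eventually_sequentially by blast
  qed
  with d show "\<exists>d>0. cball m d \<subseteq> ball 0 r \<and>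
      uniform_limit (cball m d) ?R (\<lambda>m. contour_integral (linepath p q) (\<lambda>l. H l m)) sequentially"
    by blast
qed

section \<open>Restriction to lines and planes, and the identity theorem\<close>

context complex_vector_space
begin

lemma collinear_or_independent:
  assumes "u \<noteq> 0"
  obtains (collinear) t where "v = sc t u" | (independent) "u \<noteq> v" "\<not> module.dependent sc {u, v}"
proof (cases "v \<in> span {u}")
  case True
  then show thesis using collinear by (auto simp: span_singleton)
next
  case False
  then have "v \<noteq> u" using span_base[of u "{u}"] by auto
  moreover have "independent {v, u}" using False assms by (subst independent_insert) auto
  ultimately show thesis using independent by (auto simp: insert_commute)
qed

text \<open>\<open>two_open\<close> speaks of independent directions. A degenerate parametrisation
  factors through a line, so openness is pulled back from there, and later arguments can treat all
  \<open>v\<close> alike.\<close>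

lemma two_open_plane:
  assumes A: "two_open sc A"
  shows "open {p. a + sc (fst p) u + sc (snd p) v \<in> A}"
proof -
  have line: "open {l. a + sc l w \<in> A}" for w
    using A by (cases "w = 0") (auto simp: two_open_def)
  show ?thesis
  proof (cases "u = 0")
    case True
    then have "{p. a + sc (fst p) u + sc (snd p) v \<in> A} = snd -` {l. a + sc l v \<in> A}" by auto
    then show ?thesis using open_vimage_snd[OF line[of v]] by (simp only:)
  next
    case False
    then show ?thesis
    proof (cases rule: collinear_or_independent[of u v])
      case (collinear t)
      have "{p. a + sc (fst p) u + sc (snd p) v \<in> A} = (\<lambda>p. fst p + snd p * t) -` {l. a + sc l u \<in> A}"
        by (auto simp: collinear scale_left_distrib add.assoc)
      also have "open \<dots>"
        by (rule open_vimage[OF line]) (intro continuous_intros)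
      finally show ?thesis .
    next
      case independent
      then show ?thesis using A by (simp add: two_open_def)
    qed
  qed
qed

lemma two_open_line:
  assumes "two_open sc A"
  shows "open {l. a + sc l w \<in> A}"
  using assms by (cases "w = 0") (auto simp: two_open_def)

definition gateaux_holomorphic :: "('b \<Rightarrow> complex) \<Rightarrow> 'b set \<Rightarrow> bool" where
  "gateaux_holomorphic f A \<longleftrightarrow> (\<forall>a\<in>A. \<forall>v. \<exists>r>0. (\<lambda>l. f (a + sc l v)) holomorphic_on ball 0 r)"

text \<open>Holomorphy near \<open>0\<close> is available at every base point of \<open>A\<close>,
  so the base point is moved to \<open>a + l v\<close>.\<close>

lemma gateaux_differentiable:
  assumes f: "gateaux_holomorphic f A" and l: "a + sc l v \<in> A"
  shows "(\<lambda>l. f (a + sc l v)) field_differentiable at l"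
proof -
  obtain r where r: "r > 0" "(\<lambda>t. f ((a + sc l v) + sc t v)) holomorphic_on ball 0 r"
    using f l unfolding gateaux_holomorphic_def by blast
  then have "(\<lambda>t. f ((a + sc l v) + sc t v)) field_differentiable at (l - l)"
    by (intro holomorphic_on_imp_differentiable_at[OF r(2)]) auto
  moreover have "(\<lambda>t. t - l) field_differentiable at l" by (intro derivative_intros)
  ultimately have "((\<lambda>t. f ((a + sc l v) + sc t v)) \<circ> (\<lambda>t. t - l)) field_differentiable at l"
    by (intro field_differentiable_compose)
  moreover have "(\<lambda>t. f ((a + sc l v) + sc t v)) \<circ> (\<lambda>t. t - l) = (\<lambda>l. f (a + sc l v))"
    by (simp add: fun_eq_iff scale_left_diff_distrib)
  ultimately show ?thesis by simp
qed

lemma gateaux_holomorphic_line: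
  assumes "gateaux_holomorphic f A" "\<And>l. l \<in> S \<Longrightarrow> a + sc l v \<in> A"
  shows "(\<lambda>l. f (a + sc l v)) holomorphic_on S"
  unfolding holomorphic_on_def
  using gateaux_differentiable[OF assms(1)] assms(2) field_differentiable_at_within by blast

lemma gateaux_holomorphic_continuous_plane:
  assumes A: "two_open sc A" and f: "gateaux_holomorphic f A"
  shows "continuous_on {p. a + sc (fst p) u + sc (snd p) v \<in> A} (\<lambda>p. f (a + sc (fst p) u + sc (snd p) v))"
proof (rule separately_holomorphic_imp_continuous[OF two_open_plane[OF A], where f = "\<lambda>l m. f (a + sc l u + sc m v)"])
  fix z w assume zw: "(z, w) \<in> {p. a + sc (fst p) u + sc (snd p) v \<in> A}"
  have eq: "a + sc z u + sc w v = (a + sc w v) + sc z u" for z w by (simp add: add_ac)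
  show "(\<lambda>z. f (a + sc z u + sc w v)) field_differentiable at z"
    unfolding eq by (rule gateaux_differentiable[OF f]) (use zw eq in simp)
  show "(\<lambda>w. f (a + sc z u + sc w v)) field_differentiable at w"
    by (rule gateaux_differentiable[OF f]) (use zw in simp)
qed

lemma gateaux_holomorphic_diff:
  assumes "gateaux_holomorphic f A" "gateaux_holomorphic g A"
  shows "gateaux_holomorphic (\<lambda>x. f x - g x) A"
  unfolding gateaux_holomorphic_def
proof (intro ballI allI)
  fix a v assume "a \<in> A"
  then obtain r r' where r: "r > 0" "(\<lambda>l. f (a + sc l v)) holomorphic_on ball 0 r"
    and r': "r' > 0" "(\<lambda>l. g (a + sc l v)) holomorphic_on ball 0 r'"
    using assms unfolding gateaux_holomorphic_def by meson
  have "(\<lambda>l. f (a + sc l v) - g (a + sc l v)) holomorphic_on ball 0 (min r r')"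
    by (intro holomorphic_intros holomorphic_on_subset[OF r(2)] holomorphic_on_subset[OF r'(2)]) auto
  then show "\<exists>r>0. (\<lambda>l. f (a + sc l v) - g (a + sc l v)) holomorphic_on ball 0 r"
    using r r' by (metis min_less_iff_conj)
qed

lemma gateaux_holomorphic_mult:
  assumes "gateaux_holomorphic f A" "gateaux_holomorphic g A"
  shows "gateaux_holomorphic (\<lambda>x. f x * g x) A"
  unfolding gateaux_holomorphic_def
proof (intro ballI allI)
  fix a v assume "a \<in> A"
  then obtain r r' where r: "r > 0" "(\<lambda>l. f (a + sc l v)) holomorphic_on ball 0 r"
    and r': "r' > 0" "(\<lambda>l. g (a + sc l v)) holomorphic_on ball 0 r'"
    using assms unfolding gateaux_holomorphic_def by meson
  have "(\<lambda>l. f (a + sc l v) * g (a + sc l v)) holomorphic_on ball 0 (min r r')"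
    by (intro holomorphic_intros holomorphic_on_subset[OF r(2)] holomorphic_on_subset[OF r'(2)]) auto
  then show "\<exists>r>0. (\<lambda>l. f (a + sc l v) * g (a + sc l v)) holomorphic_on ball 0 r"
    using r r' by (metis min_less_iff_conj)
qed

lemma gateaux_holomorphic_const: "gateaux_holomorphic (\<lambda>x. c) A"
  unfolding gateaux_holomorphic_def by (auto intro: exI[of _ 1])

text \<open>Vanishing in all directions near \<open>c\<close> propagates along a segment \<open>[c, d]\<close> not only to \<open>d\<close> but
  to all directions at \<open>d\<close>, because \<open>[c, d + s v]\<close> stays in \<open>A\<close> for small \<open>s\<close>.\<close>

lemma gateaux_zero_segment:
  assumes A: "two_open sc A" and f: "gateaux_holomorphic f A"
    and seg: "\<And>t. t \<in> {0..1} \<Longrightarrow> c + rscale t w \<in> A"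
    and zero: "\<And>v. \<exists>r>0. \<forall>m. cmod m < r \<longrightarrow> f (c + sc m v) = 0"
  shows "\<exists>r>0. \<forall>m. cmod m < r \<longrightarrow> f (c + w + sc m v) = 0"
proof -
  have end_zero: "f (c + w) = 0" if seg: "\<And>t. t \<in> {0..1} \<Longrightarrow> c + rscale t w \<in> A" for w
  proof -
    define L where "L = {l. c + sc l w \<in> A}"
    have L: "open L" unfolding L_def by (rule two_open_line[OF A])
    define I where "I = complex_of_real ` {0..1}"
    have IL: "I \<subseteq> L" using seg by (auto simp: I_def L_def)
    have conI: "connected I" unfolding I_def by (intro connected_continuous_image continuous_intros) auto
    have I01: "0 \<in> I" "1 \<in> I" by (auto simp: I_def intro: image_eqI[where x = "0::real"] image_eqI[where x = "1::real"])
    \<comment> \<open>The component of \<open>L\<close> that contains the whole segment is open and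
      connected, so the identity theorem in one variable carries the zeros near \<open>0\<close> to
      \<open>1\<close>.\<close>
    define C where "C = connected_component_set L 0"
    have C: "open C" "connected C" "C \<subseteq> L" "I \<subseteq> C"
      unfolding C_def
      by (rule open_connected_component[OF L], rule connected_connected_component,
          rule connected_component_subset, rule connected_component_maximal[OF I01(1) conI IL])
    obtain r where r: "r > 0" "\<And>m. cmod m < r \<Longrightarrow> f (c + sc m w) = 0" using zero by blast
    have "(\<lambda>l. f (c + sc l w)) 1 = (\<lambda>_. 0) (1::complex)"
    proof (rule analytic_continuation_open[where s = "C \<inter> ball 0 r" and s' = C
            and f = "\<lambda>l. f (c + sc l w)" and g = "\<lambda>_. 0" and z = 1])
      show "(\<lambda>l. f (c + sc l w)) holomorphic_on C"
        by (rule gateaux_holomorphic_line[OF f]) (use C in \<open>auto simp: L_def\<close>)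
      show "C \<inter> ball 0 r \<noteq> {}" using I01 C r by auto
    qed (use C I01 r in auto)
    then show ?thesis by simp
  qed
  define T where "T = {p. c + sc (fst p) w + sc (snd p) v \<in> A}"
  \<comment> \<open>\<open>(t, t * m)\<close> are the plane coordinates of the point at parameter
    \<open>t\<close> on the segment from \<open>c\<close> to \<open>c + w + m v\<close>; compactness
    in \<open>t\<close> gives one radius for all \<open>t\<close>.\<close>
  define \<phi> where "\<phi> = (\<lambda>p::real \<times> complex. (of_real (fst p), of_real (fst p) * snd p) :: complex \<times> complex)"
  have "open (\<phi> -` T)"
    unfolding \<phi>_def T_def by (intro open_vimage two_open_plane[OF A] continuous_intros)
  moreover have "{0..1} \<times> {0} \<subseteq> \<phi> -` T" using seg by (auto simp: \<phi>_def T_def)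
  moreover have "compact ({0..1} \<times> {0} :: (real \<times> complex) set)" by (intro compact_Times) auto
  ultimately obtain e where e: "e > 0" "(\<Union>x\<in>{0..1} \<times> {0}. cball x e) \<subseteq> \<phi> -` T"
    using compact_subset_open_imp_cball_epsilon_subset by metis
  have "f (c + w + sc m v) = 0" if m: "cmod m < e" for m
  proof -
    have "f (c + (w + sc m v)) = 0"
    proof (rule end_zero)
      fix t :: real assume t: "t \<in> {0..1}"
      have "(t, m) \<in> cball (t, 0) e" using m by (simp add: dist_prod_def)
      then have "(t, m) \<in> \<phi> -` T" using e t by blast
      then show "c + rscale t (w + sc m v) \<in> A"
        by (simp add: \<phi>_def T_def scale_right_distrib add.assoc)
    qed
    then show ?thesis by (simp add: add.assoc)
  qed
  with e show ?thesis by blast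
qed

text \<open>The induction along the chain carries vanishing in all directions at each vertex, since
  the next segment may leave in any direction.\<close>

lemma gateaux_identity:
  assumes A: "two_open sc A" and conn: "polygonally_connected sc A" and f: "gateaux_holomorphic f A"
    and c: "c \<in> A" and zero: "\<And>v. \<exists>r>0. \<forall>m. cmod m < r \<longrightarrow> f (c + sc m v) = 0" and x: "x \<in> A"
  shows "f x = 0"
proof -
  obtain xs where xs: "xs \<noteq> []" "hd xs = c" "last xs = x"
    and seg: "\<And>i. Suc i < length xs \<Longrightarrow> segX sc (xs ! i) (xs ! Suc i) \<subseteq> A"
    using conn c x unfolding polygonally_connected_def by blast
  have "\<forall>v. \<exists>r>0. \<forall>m. cmod m < r \<longrightarrow> f (xs ! i + sc m v) = 0" if "i < length xs" for i
    using that
  proof (induction i)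
    case 0
    then show ?case using zero xs by (simp add: hd_conv_nth)
  next
    case (Suc i)
    have "xs ! i + rscale t (xs ! Suc i - xs ! i) \<in> A" if "t \<in> {0..1}" for t
    proof -
      have "xs ! i + rscale t (xs ! Suc i - xs ! i) = rscale (1 - t) (xs ! i) + rscale t (xs ! Suc i)"
        by (simp add: scale_left_diff_distrib scale_right_diff_distrib)
      also have "\<dots> \<in> segX sc (xs ! i) (xs ! Suc i)" using that unfolding segX_def by auto
      finally show ?thesis using seg[OF Suc.prems] by blast
    qed
    from gateaux_zero_segment[OF A f this] Suc show ?case by simp
  qed
  from this[of "length xs - 1"] have "\<forall>v. \<exists>r>0. \<forall>m. cmod m < r \<longrightarrow> f (x + sc m v) = 0"
    using xs(1) unfolding xs(3)[symmetric] last_conv_nth[OF xs(1)] by simp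
  then obtain r where r: "r > 0" "\<And>m. cmod m < r \<Longrightarrow> f (x + sc m 0) = 0" by blast
  from r(2)[of 0] r(1) show ?thesis by simp
qed

end

section \<open>The extension of scalar functions\<close>

text \<open>An induction principle: a property stable under sums and differences passes from
  integrals over edges to the grid integral. It is applied to holomorphy in a parameter, to equality
  of two integrals, and to weak representability by a vector.\<close>

lemma grid_integral_closed:
  assumes zero: "Q (\<lambda>x. 0)" and add: "\<And>F G. Q F \<Longrightarrow> Q G \<Longrightarrow> Q (\<lambda>x. F x + G x)"
    and diff: "\<And>F G. Q F \<Longrightarrow> Q G \<Longrightarrow> Q (\<lambda>x. F x - G x)"
    and M: "bounded M"
    and edge: "\<And>i j p q. (i, j) \<in> msq k M \<Longrightarrow> closed_segment p q \<subseteq> gsq k i j - M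
        \<Longrightarrow> Q (\<lambda>x. contour_integral (linepath p q) (g x))"
  shows "Q (\<lambda>x. grid_integral k M (g x))"
proof -
  have h: "Q (\<lambda>x. mask M (hseg k) (hint k (g x)) i j)" if "(i', j') \<in> msq k M" "hseg k i j \<subseteq> gsq k i' j'" for i j i' j'
  proof (cases "hseg k i j \<inter> M = {}")
    case True
    then have "hseg k i j \<subseteq> gsq k i' j' - M" using that by blast
    then show ?thesis using edge[OF that(1)] True by (simp add: mask_def hint_def hseg_def)
  qed (simp add: mask_def zero)
  have v: "Q (\<lambda>x. mask M (vseg k) (vint k (g x)) i j)" if "(i', j') \<in> msq k M" "vseg k i j \<subseteq> gsq k i' j'" for i j i' j'
  proof (cases "vseg k i j \<inter> M = {}")
    case True
    then have "vseg k i j \<subseteq> gsq k i' j' - M" using that by blast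
    then show ?thesis using edge[OF that(1)] True by (simp add: mask_def vint_def vseg_def)
  qed (simp add: mask_def zero)
  have b: "Q (\<lambda>x. bdry (mask M (hseg k) (hint k (g x))) (mask M (vseg k) (vint k (g x))) i j)"
    if "(i, j) \<in> msq k M" for i j
    unfolding bdry_def by (intro add diff h[OF that] v[OF that] hseg_subset vseg_subset)
  have "Q (\<lambda>x. \<Sum>(i, j)\<in>S. bdry (mask M (hseg k) (hint k (g x))) (mask M (vseg k) (vint k (g x))) i j)"
    if "finite S" "S \<subseteq> msq k M" for S
    using that
  proof (induction S)
    case (insert p S)
    obtain i j where p: "p = (i, j)" by (cases p)
    show ?case using insert by (simp add: p add b)
  qed (simp add: zero)
  then show ?thesis unfolding grid_integral_def using finite_msq[OF M] by blast
qed

section \<open>Admissible grids and the extension as a Cauchy integral\<close>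

locale hartogs_configuration = complex_vector_space sX
  for sX :: "complex \<Rightarrow> 'a \<Rightarrow> 'a::ab_group_add" +
  fixes K \<Omega> :: "'a set" and u :: 'a
  assumes K_subset: "K \<subseteq> \<Omega>"
    and open_\<Omega>: "two_open sX \<Omega>"
    and open_diff: "two_open sX (\<Omega> - K)"
    and connected_diff: "polygonally_connected sX (\<Omega> - K)"
    and u_nonzero: "u \<noteq> 0"
    and compact_slab: "\<And>a v. a \<in> \<Omega> \<Longrightarrow> \<exists>e>0. compact_in_plane sX a u v (K \<inter> planeL_eps sX a u v e)"
    and free_line: "\<exists>c\<in>\<Omega>. K \<inter> lineL sX c u = {}"
begin

text \<open>\<open>compact_in_plane\<close> only provides some compact set of parameters with the
  right image. For independent directions the parametrisation is injective and this set is the full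
  preimage. For \<open>v = t u\<close> the slab is the whole line, and the preimage is a sheared
  product of a compact set with a disc.\<close>

lemma compact_slab_coordinates:
  assumes a: "a \<in> \<Omega>"
  obtains e where "e > 0" "compact {p. cmod (snd p) \<le> e \<and> a + sX (fst p) u + sX (snd p) v \<in> K}"
proof -
  obtain e C where e: "e > 0" and C: "compact C"
    and eq: "K \<inter> planeL_eps sX a u v e = (\<lambda>p. a + sX (fst p) u + sX (snd p) v) ` C"
    using compact_slab[OF a, of v] unfolding compact_in_plane_def by auto
  show thesis
  proof (rule collinear_or_independent[OF u_nonzero, of v])
    fix t assume collinear: "v = sX t u"
    have pt: "a + sX l u + sX m v = a + sX (l + m * t) u" for l m
      by (simp add: collinear scale_left_distrib add.assoc)
    define B where "B = (\<lambda>p. fst p + snd p * t) ` C"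
    have B: "compact B" unfolding B_def
      by (intro compact_continuous_image C continuous_intros)
    have KB: "a + sX l u \<in> K \<longleftrightarrow> l \<in> B" for l
    proof
      assume "a + sX l u \<in> K"
      moreover have "a + sX l u \<in> planeL_eps sX a u v e"
        unfolding planeL_eps_def by (intro CollectI exI[of _ l] exI[of _ 0]) (use e in simp)
      ultimately obtain p where p: "p \<in> C" "a + sX l u = a + sX (fst p) u + sX (snd p) v" using eq by blast
      then have "sX (l - (fst p + snd p * t)) u = 0" by (simp add: pt scale_left_diff_distrib)
      then have "l = fst p + snd p * t" using u_nonzero by simp
      then show "l \<in> B" using p by (auto simp: B_def)
    next
      assume "l \<in> B"
      then obtain p where p: "p \<in> C" "l = fst p + snd p * t" by (auto simp: B_def)
      then have "a + sX (fst p) u + sX (snd p) v \<in> K" using eq by blast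
      then show "a + sX l u \<in> K" using p by (simp add: pt)
    qed
    have "{p. cmod (snd p) \<le> e \<and> a + sX (fst p) u + sX (snd p) v \<in> K}
        = (\<lambda>(x, m). (x - m * t, m)) ` (B \<times> cball 0 e)"
      unfolding pt KB by (force simp: image_iff)
    moreover have "compact ((\<lambda>(x, m). (x - m * t, m)) ` (B \<times> cball 0 e))"
      unfolding case_prod_unfold by (intro compact_continuous_image compact_Times B compact_cball continuous_intros)
    ultimately have "compact {p. cmod (snd p) \<le> e \<and> a + sX (fst p) u + sX (snd p) v \<in> K}"
      by (simp only:)
    then show thesis by (rule that[OF e])
  next
    assume independent: "u \<noteq> v" "\<not> dependent {u, v}"
    have inj: "p = q" if "a + sX (fst p) u + sX (snd p) v = a + sX (fst q) u + sX (snd q) v" for p q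
    proof -
      have "sX (snd q - snd p) v = sX (fst p - fst q) u"
        using that by (simp add: scale_left_diff_distrib algebra_simps)
      then have lin: "sX (snd q - snd p) v \<in> span {u}" by (metis span_base span_scale singletonI)
      have "v \<notin> span {u}"
        using independent by (metis insert_commute independent_insert singletonD)
      then have "snd q = snd p"
        using lin by (metis right_minus_eq span_scale scale_scale left_inverse scale_one)
      moreover from this that have "sX (fst p - fst q) u = 0" by (simp add: scale_left_diff_distrib)
      then have "fst p = fst q" using u_nonzero by simp
      ultimately show ?thesis by (simp add: prod_eq_iff)
    qed
    have "{p. cmod (snd p) \<le> e \<and> a + sX (fst p) u + sX (snd p) v \<in> K} = C"
    proof (intro set_eqI iffI)
      fix p assume "p \<in> {p. cmod (snd p) \<le> e \<and> a + sX (fst p) u + sX (snd p) v \<in> K}"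
      then have "a + sX (fst p) u + sX (snd p) v \<in> K \<inter> planeL_eps sX a u v e"
        by (auto simp: planeL_eps_def)
      then obtain q where "q \<in> C" "a + sX (fst p) u + sX (snd p) v = a + sX (fst q) u + sX (snd q) v"
        using eq by blast
      then show "p \<in> C" using inj by blast
    next
      fix p assume "p \<in> C"
      then have "a + sX (fst p) u + sX (snd p) v \<in> K \<inter> planeL_eps sX a u v e" using eq by blast
      then obtain l m where "a + sX (fst p) u + sX (snd p) v \<in> K" "cmod m \<le> e"
        "a + sX (fst p) u + sX (snd p) v = a + sX l u + sX m v"
        unfolding planeL_eps_def by blast
      moreover from this have "p = (l, m)" by (intro inj) simp
      ultimately show "p \<in> {p. cmod (snd p) \<le> e \<and> a + sX (fst p) u + sX (snd p) v \<in> K}" by simp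
    qed
    then have "compact {p. cmod (snd p) \<le> e \<and> a + sX (fst p) u + sX (snd p) v \<in> K}"
      using C by (simp only:)
    then show thesis by (rule that[OF e])
  qed
qed

text \<open>\<open>M\<close> may exceed the section of \<open>K\<close> together with the pole
  \<open>0\<close>, because one \<open>M\<close> has to serve all lines near a given one. Edges that
  avoid \<open>M\<close> lie in \<open>\<Omega> - K\<close>, since the squares stay in
  \<open>\<Omega>\<close>.\<close>

definition admissible :: "'a \<Rightarrow> nat \<Rightarrow> complex set \<Rightarrow> bool" where
  "admissible a k M \<longleftrightarrow> bounded M \<and> 0 \<in> M \<and> (\<forall>l. a + sX l u \<in> K \<longrightarrow> l \<in> M)
     \<and> (\<forall>(i, j)\<in>msq k M. \<forall>l\<in>gsq k i j. a + sX l u \<in> \<Omega>)"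

lemma admissible_slab:
  assumes a: "a \<in> \<Omega>"
  shows "\<exists>e>0. \<exists>k M. \<forall>m. cmod m < e \<longrightarrow> admissible (a + sX m v) k M"
proof -
  have swap: "a + sX m v + sX l u = a + sX l u + sX m v" for l m by (simp add: add_ac)
  obtain e0 where e0: "e0 > 0" and comp: "compact {p. cmod (snd p) \<le> e0 \<and> a + sX (fst p) u + sX (snd p) v \<in> K}"
    using compact_slab_coordinates[OF a] by blast
  define C where "C = {p. cmod (snd p) \<le> e0 \<and> a + sX (fst p) u + sX (snd p) v \<in> K}"
  define U where "U = {p. a + sX (fst p) u + sX (snd p) v \<in> \<Omega>}"
  have C: "compact C" using comp by (simp add: C_def)
  have U: "open U" unfolding U_def by (rule two_open_plane[OF open_\<Omega>])
  define B where "B = insert 0 (fst ` (C \<inter> {p. snd p = 0}))"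
  have "closed {p :: complex \<times> complex. snd p = 0}"
    by (intro closed_Collect_eq continuous_intros)
  then have B: "compact B"
    unfolding B_def by (intro compact_insert compact_continuous_image compact_Int_closed C continuous_intros)
  have memB: "l \<in> B" if "a + sX l u \<in> K" for l
    using that e0 unfolding B_def C_def by (auto intro!: image_eqI[where x = "(l, 0)"])
  have BU: "B \<times> {0} \<subseteq> U"
    using K_subset a by (auto simp: B_def C_def U_def)
  have "compact (B \<times> {0 :: complex})" using B by (intro compact_Times) auto
  \<comment> \<open>One fourth of \<open>d\<close> is spent on the neighbourhood \<open>M\<close> of
    \<open>B\<close>, one fourth on the diameter of the squares, and one half on the displacement
    \<open>m\<close>.\<close>
  then obtain d where d: "d > 0" and dU: "(\<Union>x\<in>B \<times> {0}. cball x d) \<subseteq> U"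
    using compact_subset_open_imp_cball_epsilon_subset[OF _ U BU] by metis
  define O' where "O' = (\<Union>b\<in>B. ball b (d / 4))"
  define M where "M = (\<Union>b\<in>B. cball b (d / 4))"
  have "bounded M"
  proof -
    obtain R where R: "\<And>b. b \<in> B \<Longrightarrow> cmod b \<le> R" using compact_imp_bounded[OF B] unfolding bounded_iff by blast
    have "cmod x \<le> R + d / 4" if xM: "x \<in> M" for x
    proof -
      obtain b where "b \<in> B" "dist b x \<le> d / 4" using xM unfolding M_def by auto
      then show ?thesis using R[of b] norm_triangle_ineq2[of x b] by (simp add: dist_norm norm_minus_commute)
    qed
    then show ?thesis unfolding bounded_iff by blast
  qed
  obtain k :: nat where k: "8 / d < 2 ^ k" using real_arch_pow[of 2 "8 / d"] by auto
  have kd: "2 / 2 ^ k < d / 4" using k d by (simp add: field_simps)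
  \<comment> \<open>Upper semicontinuity of the sections: the part of \<open>C\<close> outside
    \<open>O'\<close> is compact, its projection to \<open>m\<close> is closed and misses
    \<open>0\<close>, so for small \<open>m\<close> the section of \<open>K\<close> stays in
    \<open>O'\<close>.\<close>
  have "open (fst -` O' :: (complex \<times> complex) set)"
    unfolding O'_def by (intro open_vimage_fst open_UN ballI open_ball)
  then have "closed (snd ` (C - fst -` O'))"
    by (intro compact_imp_closed compact_continuous_image compact_diff C continuous_on_snd continuous_on_id)
  moreover have "0 \<notin> snd ` (C - fst -` O')"
  proof
    assume "0 \<in> snd ` (C - fst -` O')"
    then obtain p where p: "p \<in> C" "snd p = 0" "fst p \<notin> O'" by auto
    then have "fst p \<in> B" by (auto simp: B_def)
    then have "fst p \<in> O'" using d by (auto simp: O'_def intro!: bexI[where x = "fst p"])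
    with p show False by blast
  qed
  ultimately obtain e2 where e2: "e2 > 0" "ball 0 e2 \<subseteq> - snd ` (C - fst -` O')"
    by (metis open_Compl open_contains_ball ComplI)
  define e where "e = min e0 (min (d / 2) e2)"
  have "admissible (a + sX m v) k M" if m: "cmod m < e" for m
    unfolding admissible_def
  proof (intro conjI allI impI)
    show "bounded M" by fact
    show "0 \<in> M" using d by (auto simp: M_def B_def)
    fix l assume l: "a + sX m v + sX l u \<in> K"
    then have lmC: "(l, m) \<in> C" using m unfolding swap by (auto simp: C_def e_def)
    have "m \<in> ball 0 e2" using m by (simp add: e_def)
    then have "m \<notin> snd ` (C - fst -` O')" using e2 by blast
    then have "(l, m) \<notin> C - fst -` O'" by (metis image_eqI snd_conv)
    then have "l \<in> O'" using lmC by simp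
    moreover have "O' \<subseteq> M" unfolding O'_def M_def by (intro UN_mono ball_subset_cball) auto
    ultimately show "l \<in> M" by blast
  next
    show "\<forall>(i, j)\<in>msq k M. \<forall>l\<in>gsq k i j. a + sX m v + sX l u \<in> \<Omega>"
    proof clarify
      fix i j l assume ij: "(i, j) \<in> msq k M" and l: "l \<in> gsq k i j"
      obtain l' where l': "l' \<in> gsq k i j" "l' \<in> M" using ij by (auto simp: msq_def)
      obtain b where b: "b \<in> B" "dist b l' \<le> d / 4" using l' by (auto simp: M_def)
      have "dist b l \<le> d / 2"
        using dist_triangle[of b l l'] b dist_gsq[OF l'(1) l] kd by simp
      moreover have "dist (b, 0) (l, m) \<le> dist b l + dist 0 m"
        unfolding dist_Pair_Pair by (rule sqrt_sum_squares_le_sum) auto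
      ultimately have "(l, m) \<in> cball (b, 0) d" using m by (simp add: e_def)
      then have "(l, m) \<in> U" using dU b by blast
      then show "a + sX m v + sX l u \<in> \<Omega>" unfolding swap by (simp add: U_def)
    qed
  qed
  moreover have "e > 0" using e0 d e2 by (simp add: e_def)
  ultimately show ?thesis by blast
qed

lemma admissible_exists:
  assumes "a \<in> \<Omega>"
  shows "\<exists>k M. admissible a k M"
proof -
  obtain e k M where "e > 0" "\<And>m. cmod m < e \<Longrightarrow> admissible (a + sX m 0) k M"
    using admissible_slab[OF assms, of 0] by blast
  from this(2)[of 0] this(1) show ?thesis by auto
qed

lemma admissible_edge:
  assumes "admissible a k M" "(i, j) \<in> msq k M" "l \<in> gsq k i j - M"
  shows "a + sX l u \<in> \<Omega> - K" "l \<noteq> 0"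
  using assms by (auto simp: admissible_def)

definition extension :: "('a \<Rightarrow> complex) \<Rightarrow> 'a \<Rightarrow> complex" where
  "extension f a = (let p = (SOME p. admissible a (fst p) (snd p)) in
     grid_integral (fst p) (snd p) (\<lambda>l. f (a + sX l u) / l) / (2 * pi * \<i>))"

text \<open>Every admissible set contains the pole and the section of \<open>K\<close>, and off
  these the integrand is holomorphic on the part of the line in \<open>\<Omega>\<close>; so all
  admissible grids give the same integral.\<close>

lemma extension_eq:
  assumes f: "gateaux_holomorphic f (\<Omega> - K)" and adm: "admissible a k M"
  shows "extension f a = grid_integral k M (\<lambda>l. f (a + sX l u) / l) / (2 * pi * \<i>)"
proof -
  define p where "p = (SOME p. admissible a (fst p) (snd p))"
  have "admissible a (fst (k, M)) (snd (k, M))" using adm by simp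
  then have p: "admissible a (fst p) (snd p)" unfolding p_def by (rule someI)
  define M0 where "M0 = insert 0 {l. a + sX l u \<in> K}"
  define W where "W = {l. a + sX l u \<in> \<Omega> - K} - {0}"
  have W: "open W" unfolding W_def by (intro open_delete two_open_line[OF open_diff])
  have hol: "(\<lambda>l. f (a + sX l u) / l) holomorphic_on W"
    unfolding W_def by (intro holomorphic_intros gateaux_holomorphic_line[OF f]) auto
  have "grid_integral (fst p) (snd p) (\<lambda>l. f (a + sX l u) / l) = grid_integral k M (\<lambda>l. f (a + sX l u) / l)"
  proof (rule grid_integral_independent[OF hol W, where ?M0.0 = M0])
    show "bounded (snd p)" "M0 \<subseteq> snd p" "bounded M" "M0 \<subseteq> M"
      using p adm by (auto simp: admissible_def M0_def)
    show "gsq (fst p) i j - M0 \<subseteq> W" if "(i, j) \<in> msq (fst p) (snd p)" for i j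
      using p that by (fastforce simp: admissible_def M0_def W_def)
    show "gsq k i j - M0 \<subseteq> W" if "(i, j) \<in> msq k M" for i j
      using adm that by (fastforce simp: admissible_def M0_def W_def)
  qed
  then show ?thesis by (simp add: extension_def Let_def flip: p_def)
qed

lemma gateaux_holomorphic_extension:
  assumes f: "gateaux_holomorphic f (\<Omega> - K)"
  shows "gateaux_holomorphic (extension f) \<Omega>"
  unfolding gateaux_holomorphic_def
proof (intro ballI allI)
  fix a v assume a: "a \<in> \<Omega>"
  obtain e k M where e: "e > 0" and adm: "\<And>m. cmod m < e \<Longrightarrow> admissible (a + sX m v) k M"
    using admissible_slab[OF a, of v] by blast
  have swap: "a + sX m v + sX l u = a + sX l u + sX m v" for l m by (simp add: add_ac)
  have "(\<lambda>m. grid_integral k M (\<lambda>l. f (a + sX m v + sX l u) / l)) holomorphic_on ball 0 e"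
  proof (rule grid_integral_closed[where Q = "\<lambda>F. F holomorphic_on ball 0 e"])
    show "bounded M" using adm[of 0] e by (simp add: admissible_def)
    fix i j p q assume ij: "(i, j) \<in> msq k M" and seg: "closed_segment p q \<subseteq> gsq k i j - M"
    have dom: "a + sX l u + sX m v \<in> \<Omega> - K" "l \<noteq> 0" if "l \<in> closed_segment p q" "m \<in> ball 0 e" for l m
      using admissible_edge[OF adm ij, of m l] that seg unfolding swap by auto
    show "(\<lambda>m. contour_integral (linepath p q) (\<lambda>l. f (a + sX m v + sX l u) / l)) holomorphic_on ball 0 e"
    proof (rule contour_integral_parameter_holomorphic)
      show "continuous_on (closed_segment p q \<times> ball 0 e) (\<lambda>(l, m). f (a + sX m v + sX l u) / l)"
        unfolding case_prod_unfold swap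
        by (intro continuous_on_divide continuous_on_subset[OF gateaux_holomorphic_continuous_plane[OF open_diff f]]
             continuous_intros) (use dom in auto)
      show "(\<lambda>m. f (a + sX m v + sX l u) / l) holomorphic_on ball 0 e" if "l \<in> closed_segment p q" for l
        unfolding swap
        by (intro holomorphic_intros gateaux_holomorphic_line[OF f]) (use dom that e in \<open>auto simp: dom(2)[of l 0]\<close>)
    qed
  qed (auto intro: holomorphic_intros)
  then have "(\<lambda>m. grid_integral k M (\<lambda>l. f (a + sX m v + sX l u) / l) / (2 * pi * \<i>)) holomorphic_on ball 0 e"
    by (intro holomorphic_intros) auto
  then have "(\<lambda>m. extension f (a + sX m v)) holomorphic_on ball 0 e"
    by (rule holomorphic_transform) (simp add: extension_eq[OF f adm])
  with e show "\<exists>r>0. (\<lambda>m. extension f (a + sX m v)) holomorphic_on ball 0 r" by blast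
qed

text \<open>All edges lie in \<open>\<Omega> - K\<close>, where \<open>f\<close> may be replaced by
  \<open>h\<close>, and Cauchy's formula evaluates the integral of \<open>h\<close>. Since only the
  line through \<open>a\<close> enters, this serves lines that avoid \<open>K\<close>, with
  \<open>h = f\<close>, as well as uniqueness.\<close>

lemma extension_unique:
  assumes a: "a \<in> \<Omega>" and hol: "(\<lambda>l. h (a + sX l u)) holomorphic_on {l. a + sX l u \<in> \<Omega>}"
    and eq: "\<And>l. a + sX l u \<in> \<Omega> - K \<Longrightarrow> h (a + sX l u) = f (a + sX l u)"
  shows "extension f a = h a"
proof -
  define p where "p = (SOME p. admissible a (fst p) (snd p))"
  obtain k M where "admissible a k M" using admissible_exists[OF a] by blast
  then have "admissible a (fst (k, M)) (snd (k, M))" by simp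
  then have p: "admissible a (fst p) (snd p)" unfolding p_def by (rule someI)
  \<comment> \<open>A Boolean parameter turns equality of two grid integrals into a property of one
    family, to which the induction principle applies.\<close>
  have "(\<lambda>b. grid_integral (fst p) (snd p) (\<lambda>l. (if b then f else h) (a + sX l u) / l)) True
      = (\<lambda>b. grid_integral (fst p) (snd p) (\<lambda>l. (if b then f else h) (a + sX l u) / l)) False"
  proof (rule grid_integral_closed[where Q = "\<lambda>F. F True = F False"])
    show "bounded (snd p)" using p by (simp add: admissible_def)
    fix i j x y assume ij: "(i, j) \<in> msq (fst p) (snd p)" and seg: "closed_segment x y \<subseteq> gsq (fst p) i j - snd p"
    have "f (a + sX l u) = h (a + sX l u)" if "l \<in> closed_segment x y" for l
      using eq admissible_edge[OF p ij] that seg by auto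
    then show "contour_integral (linepath x y) (\<lambda>l. (if True then f else h) (a + sX l u) / l)
      = contour_integral (linepath x y) (\<lambda>l. (if False then f else h) (a + sX l u) / l)"
      by (intro contour_integral_cong) auto
  qed simp_all
  then have "extension f a = grid_integral (fst p) (snd p) (\<lambda>l. h (a + sX l u) / l) / (2 * pi * \<i>)"
    by (simp add: extension_def Let_def flip: p_def)
  also have "grid_integral (fst p) (snd p) (\<lambda>l. h (a + sX l u) / l) = 2 * pi * \<i> * h (a + sX 0 u)"
    by (rule grid_cauchy_formula[OF hol two_open_line[OF open_\<Omega>]]) (use p in \<open>auto simp: admissible_def\<close>)
  finally show ?thesis by simp
qed

lemma extension_of_holomorphic:
  assumes h: "gateaux_holomorphic h \<Omega>" and eq: "\<And>x. x \<in> \<Omega> - K \<Longrightarrow> h x = f x" and a: "a \<in> \<Omega>"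
  shows "extension f a = h a"
  by (rule extension_unique[OF a gateaux_holomorphic_line[OF h]]) (use eq in auto)

lemma extension_extends:
  assumes f: "gateaux_holomorphic f (\<Omega> - K)" and x: "x \<in> \<Omega> - K"
  shows "extension f x = f x"
proof -
  obtain c where c: "c \<in> \<Omega>" "K \<inter> lineL sX c u = {}" using free_line by blast
  have cK: "c + sX l u \<notin> K" for l using c(2) by (auto simp: lineL_def)
  have cd: "c \<in> \<Omega> - K" using cK[of 0] c by simp
  have "gateaux_holomorphic (\<lambda>x. extension f x - f x) (\<Omega> - K)"
  proof (rule gateaux_holomorphic_diff[OF _ f])
    show "gateaux_holomorphic (extension f) (\<Omega> - K)"
      using gateaux_holomorphic_extension[OF f] by (simp add: gateaux_holomorphic_def)
  qed
  then have "extension f x - f x = 0"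
  proof (rule gateaux_identity[OF open_diff connected_diff _ cd _ x])
    fix v
    obtain e where e: "e > 0" and comp: "compact {p. cmod (snd p) \<le> e \<and> c + sX (fst p) u + sX (snd p) v \<in> K}"
      using compact_slab_coordinates[OF c(1)] by blast
    \<comment> \<open>The projection of this compact set to \<open>m\<close> is closed and misses
      \<open>0\<close>, so the lines parallel to the free one and close to it avoid \<open>K\<close>
      as well.\<close>
    define C where "C = {p. cmod (snd p) \<le> e \<and> c + sX (fst p) u + sX (snd p) v \<in> K}"
    have "closed (snd ` C)"
      using comp unfolding C_def[symmetric] by (intro compact_imp_closed compact_continuous_image continuous_intros)
    moreover have "0 \<notin> snd ` C" using cK by (auto simp: C_def)
    moreover have "open {m. c + sX m v \<in> \<Omega>}" by (rule two_open_line[OF open_\<Omega>])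
    ultimately have nb: "open ({m. c + sX m v \<in> \<Omega>} - snd ` C)" "0 \<in> {m. c + sX m v \<in> \<Omega>} - snd ` C"
      using c by (auto intro: open_Diff)
    obtain d where d: "d > 0" "ball 0 d \<subseteq> {m. c + sX m v \<in> \<Omega>} - snd ` C"
      by (rule openE[OF nb])
    have "extension f (c + sX m v) - f (c + sX m v) = 0" if m: "cmod m < min d e" for m
    proof -
      have "m \<in> ball 0 d" using m by simp
      then have md: "m \<in> {m. c + sX m v \<in> \<Omega>} - snd ` C" using d by blast
      have nK: "c + sX m v + sX l u \<notin> K" for l
      proof
        assume "c + sX m v + sX l u \<in> K"
        then have "(l, m) \<in> C" using m by (simp add: C_def add_ac)
        then show False using md by (metis DiffD2 image_eqI snd_conv)
      qed
      have "extension f (c + sX m v) = f (c + sX m v)"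
        by (rule extension_unique[OF _ gateaux_holomorphic_line[OF f]]) (use md nK in auto)
      then show ?thesis by simp
    qed
    then show "\<exists>r>0. \<forall>m. cmod m < r \<longrightarrow> extension f (c + sX m v) - f (c + sX m v) = 0"
      using d e by (intro exI[of _ "min d e"]) auto
  qed
  then show ?thesis by simp
qed

lemma extension_range:
  assumes f: "gateaux_holomorphic f (\<Omega> - K)"
  shows "extension f ` \<Omega> = f ` (\<Omega> - K)"
proof
  show "f ` (\<Omega> - K) \<subseteq> extension f ` \<Omega>"
    using extension_extends[OF f] by (metis DiffD1 image_eqI image_subsetI)
  show "extension f ` \<Omega> \<subseteq> f ` (\<Omega> - K)"
  proof (rule ccontr)
    assume "\<not> ?thesis"
    then obtain a where a: "a \<in> \<Omega>" "extension f a \<notin> f ` (\<Omega> - K)" by blast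
    define w where "w = extension f a"
    have fw: "f x \<noteq> w" if "x \<in> \<Omega> - K" for x using that a by (metis image_eqI w_def)
    define g where "g = (\<lambda>x. 1 / (f x - w))"
    have g: "gateaux_holomorphic g (\<Omega> - K)"
      unfolding gateaux_holomorphic_def
    proof (intro ballI allI)
      fix b v assume b: "b \<in> \<Omega> - K"
      have "open {l. b + sX l v \<in> \<Omega> - K}" "0 \<in> {l. b + sX l v \<in> \<Omega> - K}"
        using b two_open_line[OF open_diff] by auto
      then obtain r where r: "r > 0" "ball 0 r \<subseteq> {l. b + sX l v \<in> \<Omega> - K}"
        using open_contains_ball by blast
      have dom: "b + sX l v \<in> \<Omega> - K" if "l \<in> ball 0 r" for l using that r by blast
      then have "f (b + sX l v) - w \<noteq> 0" if "l \<in> ball 0 r" for l using that fw by simp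
      then have "(\<lambda>l. g (b + sX l v)) holomorphic_on ball 0 r"
        unfolding g_def by (intro holomorphic_intros gateaux_holomorphic_line[OF f] dom)
      with r show "\<exists>r>0. (\<lambda>l. g (b + sX l v)) holomorphic_on ball 0 r" by blast
    qed
    \<comment> \<open>Off \<open>K\<close> the product is \<open>1\<close>, so by uniqueness it is
      the extension of the constant \<open>1\<close> and equals \<open>1\<close> everywhere; yet its
      second factor vanishes at \<open>a\<close>.\<close>
    define h where "h = (\<lambda>x. extension g x * (extension f x - w))"
    have "gateaux_holomorphic h \<Omega>"
      unfolding h_def by (intro gateaux_holomorphic_mult gateaux_holomorphic_diff
          gateaux_holomorphic_extension g f gateaux_holomorphic_const)
    then have "extension (\<lambda>x. 1) a = h a"
    proof (rule extension_of_holomorphic[OF _ _ a(1)])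
      fix x assume x: "x \<in> \<Omega> - K"
      then show "h x = 1"
        unfolding h_def extension_extends[OF g x] extension_extends[OF f x] using fw[OF x] by (simp add: g_def)
    qed
    moreover have "extension (\<lambda>x. 1) a = 1"
      by (rule extension_of_holomorphic[OF gateaux_holomorphic_const _ a(1)]) simp
    ultimately show False by (simp add: h_def w_def)
  qed
qed

end

section \<open>Vector-valued extension\<close>

context seminormed_space
begin

text \<open>\<open>L\<close> is evaluation at some vector: for an integral depending on
  \<open>\<phi>\<close> this says that the weak integral exists in the space.\<close>

definition representable :: "(('b \<Rightarrow> complex) \<Rightarrow> complex) \<Rightarrow> bool" where
  "representable L \<longleftrightarrow> (\<exists>y. \<forall>\<phi>\<in>dual. \<phi> y = L \<phi>)"

lemma representable_zero: "representable (\<lambda>\<phi>. 0)"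
  unfolding representable_def using dual_zero by blast

lemma representable_add:
  assumes "representable L" "representable L'"
  shows "representable (\<lambda>\<phi>. L \<phi> + L' \<phi>)"
proof -
  obtain y y' where "\<forall>\<phi>\<in>dual. \<phi> y = L \<phi>" "\<forall>\<phi>\<in>dual. \<phi> y' = L' \<phi>"
    using assms unfolding representable_def by blast
  then have "\<forall>\<phi>\<in>dual. \<phi> (y + y') = L \<phi> + L' \<phi>" by (simp add: dual_add)
  then show ?thesis unfolding representable_def by blast
qed

lemma representable_scale:
  assumes "representable L"
  shows "representable (\<lambda>\<phi>. c * L \<phi>)"
proof -
  obtain y where "\<forall>\<phi>\<in>dual. \<phi> y = L \<phi>"
    using assms unfolding representable_def by blast
  then have "\<forall>\<phi>\<in>dual. \<phi> (sY c y) = c * L \<phi>" by (simp add: dual_scale)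
  then show ?thesis unfolding representable_def by blast
qed

lemma representable_diff:
  assumes "representable L" "representable L'"
  shows "representable (\<lambda>\<phi>. L \<phi> - L' \<phi>)"
  using representable_add[OF assms(1) representable_scale[OF assms(2), of "- 1"]] by simp

text \<open>The Riemann sums with \<open>2 ^ n\<close> nodes are vectors, and tested against any
  functional they converge at the rate \<open>1 / 2 ^ n\<close>, with a constant that may depend on
  the functional.\<close>

lemma representable_contour_integral:
  assumes compl: "lc_seq_complete P" and W: "open W" and sub: "closed_segment p q \<subseteq> W"
    and hol: "\<And>\<phi>. \<phi> \<in> dual \<Longrightarrow> (\<lambda>l. \<phi> (F l)) holomorphic_on W"
  shows "representable (\<lambda>\<phi>. contour_integral (linepath p q) (\<lambda>l. \<phi> (F l)))"
  unfolding representable_def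
proof (rule weak_limit_exists[OF compl])
  fix \<phi> assume \<phi>: "\<phi> \<in> dual"
  define y where "y = (\<lambda>n::nat. sY ((q - p) / of_nat (2 ^ n)) (\<Sum>j<2 ^ n. F (linepath p q (real j / real (2 ^ n)))))"
  obtain C where C: "\<And>N. N > 0 \<Longrightarrow>
      cmod (contour_integral (linepath p q) (\<lambda>l. \<phi> (F l)) - riemann_sum N p q (\<lambda>l. \<phi> (F l))) \<le> C / real N"
    using linepath_riemann_rate[OF hol[OF \<phi>] W sub] by blast
  have "\<phi> (y n) = riemann_sum (2 ^ n) p q (\<lambda>l. \<phi> (F l))" for n
    by (simp add: y_def riemann_sum_def dual_scale[OF \<phi>] dual_sum[OF \<phi>])
  then have "cmod (\<phi> (y n) - contour_integral (linepath p q) (\<lambda>l. \<phi> (F l))) \<le> C / 2 ^ n" for n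
    using C[of "2 ^ n"] by (simp add: norm_minus_commute)
  then show "\<exists>C. \<forall>n. cmod (\<phi> (sY ((q - p) / of_nat (2 ^ n)) (\<Sum>j<2 ^ n. F (linepath p q (real j / real (2 ^ n)))))
      - contour_integral (linepath p q) (\<lambda>l. \<phi> (F l))) \<le> C / 2 ^ n"
    unfolding y_def by blast
qed

end

lemma (in complex_vector_space) H_G_iff:
  "f \<in> H_G sc sY P U \<longleftrightarrow> (\<forall>\<phi>\<in>lc_dual sY P. gateaux_holomorphic (\<lambda>x. \<phi> (f x)) U)"
  by (auto simp: H_G_def gateaux_holomorphic_def)

lemma (in complex_vector_space) scalar_H_G_iff:
  "f \<in> H_G sc (*) (\<lambda>_::unit. cmod) U \<longleftrightarrow> gateaux_holomorphic f U"
proof -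
  have vs: "vector_space ((*) :: complex \<Rightarrow> complex \<Rightarrow> complex)"
    by unfold_locales (auto simp: algebra_simps)
  have id: "(\<lambda>z. z) \<in> lc_dual (*) (\<lambda>_::unit. cmod)"
    unfolding lc_dual_def lc_nbhd_def
    by (auto simp: Vector_Spaces.linear_iff vs intro!: exI[of _ UNIV])
  have mult: "\<phi> z = z * \<phi> 1" if "\<phi> \<in> lc_dual (*) (\<lambda>_::unit. cmod)" for \<phi> z
  proof -
    have "\<phi> (z * 1) = z * \<phi> 1" using that unfolding lc_dual_def Vector_Spaces.linear_iff by blast
    then show ?thesis by simp
  qed
  show ?thesis
  proof
    assume "f \<in> H_G sc (*) (\<lambda>_::unit. cmod) U"
    then show "gateaux_holomorphic f U" unfolding H_G_iff using id by fastforce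
  next
    assume f: "gateaux_holomorphic f U"
    show "f \<in> H_G sc (*) (\<lambda>_::unit. cmod) U"
      unfolding H_G_iff
    proof
      fix \<phi> assume "\<phi> \<in> lc_dual (*) (\<lambda>_::unit. cmod)"
      then have "(\<lambda>x. \<phi> (f x)) = (\<lambda>x. f x * \<phi> 1)" using mult by blast
      then show "gateaux_holomorphic (\<lambda>x. \<phi> (f x)) U"
        using gateaux_holomorphic_mult[OF f gateaux_holomorphic_const] by simp
    qed
  qed
qed

section \<open>The extension of vector-valued functions\<close>

locale hartogs_vector_configuration =
  hartogs_configuration sX K \<Omega> u + Y: seminormed_space sY P
  for sX :: "complex \<Rightarrow> 'a \<Rightarrow> 'a::ab_group_add" and K \<Omega> u
    and sY :: "complex \<Rightarrow> 'b \<Rightarrow> 'b::ab_group_add" and P :: "'i \<Rightarrow> 'b \<Rightarrow> real" +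
  assumes hausdorff: "lc_hausdorff P" and complete: "lc_seq_complete P"
begin

text \<open>The grid depends only on \<open>a\<close> and \<open>K\<close>, hence can be the same
  for all functionals; so the scalar extensions are finite combinations of weak integrals over
  common edges.\<close>

lemma representable_extension:
  assumes f: "f \<in> H_G sX sY P (\<Omega> - K)" and a: "a \<in> \<Omega>"
  shows "Y.representable (\<lambda>\<phi>. extension (\<lambda>x. \<phi> (f x)) a)"
proof -
  have f\<phi>: "gateaux_holomorphic (\<lambda>x. \<phi> (f x)) (\<Omega> - K)" if "\<phi> \<in> Y.dual" for \<phi>
    using f that by (simp add: H_G_iff)
  obtain k M where adm: "admissible a k M" using admissible_exists[OF a] by blast
  define W where "W = {l. a + sX l u \<in> \<Omega> - K} - {0}"
  have W: "open W" unfolding W_def by (intro open_delete two_open_line[OF open_diff])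
  define F where "F = (\<lambda>l. sY (1 / l) (f (a + sX l u)))"
  have F: "\<phi> (F l) = \<phi> (f (a + sX l u)) / l" if "\<phi> \<in> Y.dual" for \<phi> l
    by (simp add: F_def Y.dual_scale[OF that])
  have "Y.representable (\<lambda>\<phi>. grid_integral k M (\<lambda>l. \<phi> (F l)))"
  proof (rule grid_integral_closed[where Q = Y.representable])
    show "bounded M" using adm by (simp add: admissible_def)
    fix i j p q assume ij: "(i, j) \<in> msq k M" and seg: "closed_segment p q \<subseteq> gsq k i j - M"
    show "Y.representable (\<lambda>\<phi>. contour_integral (linepath p q) (\<lambda>l. \<phi> (F l)))"
    proof (rule Y.representable_contour_integral[OF complete W])
      show "closed_segment p q \<subseteq> W"
        using admissible_edge[OF adm ij] seg by (auto simp: W_def)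
      fix \<phi> assume \<phi>: "\<phi> \<in> Y.dual"
      show "(\<lambda>l. \<phi> (F l)) holomorphic_on W"
        unfolding F[OF \<phi>] W_def by (intro holomorphic_intros gateaux_holomorphic_line[OF f\<phi>[OF \<phi>]]) auto
    qed
  qed (intro Y.representable_zero Y.representable_add Y.representable_diff; assumption)+
  then have "Y.representable (\<lambda>\<phi>. 1 / (2 * pi * \<i>) * grid_integral k M (\<lambda>l. \<phi> (F l)))"
    by (rule Y.representable_scale)
  then obtain y where y: "\<And>\<phi>. \<phi> \<in> Y.dual \<Longrightarrow> \<phi> y = 1 / (2 * pi * \<i>) * grid_integral k M (\<lambda>l. \<phi> (F l))"
    unfolding Y.representable_def by blast
  have "\<phi> y = extension (\<lambda>x. \<phi> (f x)) a" if "\<phi> \<in> Y.dual" for \<phi>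
    unfolding extension_eq[OF f\<phi>[OF that] adm] y[OF that] F[OF that] by simp
  then show ?thesis unfolding Y.representable_def by blast
qed

theorem vector_extension:
  assumes f: "f \<in> H_G sX sY P (\<Omega> - K)"
  obtains g where "g \<in> H_G sX sY P \<Omega>" "\<And>x. x \<in> \<Omega> - K \<Longrightarrow> g x = f x"
    "\<And>h x. h \<in> H_G sX sY P \<Omega> \<Longrightarrow> (\<And>x. x \<in> \<Omega> - K \<Longrightarrow> h x = f x) \<Longrightarrow> x \<in> \<Omega> \<Longrightarrow> h x = g x"
    "g ` \<Omega> \<subseteq> closed_convex_hull sY P (f ` (\<Omega> - K))"
proof -
  have f\<phi>: "gateaux_holomorphic (\<lambda>x. \<phi> (f x)) (\<Omega> - K)" if "\<phi> \<in> Y.dual" for \<phi>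
    using f that by (simp add: H_G_iff)
  have "\<forall>a\<in>\<Omega>. \<exists>y. \<forall>\<phi>\<in>Y.dual. \<phi> y = extension (\<lambda>x. \<phi> (f x)) a"
    using representable_extension[OF f] unfolding Y.representable_def by blast
  then obtain g where g: "\<And>a \<phi>. a \<in> \<Omega> \<Longrightarrow> \<phi> \<in> Y.dual \<Longrightarrow> \<phi> (g a) = extension (\<lambda>x. \<phi> (f x)) a"
    by metis
  show thesis
  proof (rule that)
    show "g \<in> H_G sX sY P \<Omega>"
      unfolding H_G_iff
    proof
      fix \<phi> assume \<phi>: "\<phi> \<in> Y.dual"
      show "gateaux_holomorphic (\<lambda>x. \<phi> (g x)) \<Omega>"
        unfolding gateaux_holomorphic_def
      proof (intro ballI allI)
        fix a v assume a: "a \<in> \<Omega>"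
        obtain r where r: "r > 0" "(\<lambda>l. extension (\<lambda>x. \<phi> (f x)) (a + sX l v)) holomorphic_on ball 0 r"
          using gateaux_holomorphic_extension[OF f\<phi>[OF \<phi>]] a unfolding gateaux_holomorphic_def by blast
        \<comment> \<open>\<open>g\<close> is prescribed only on \<open>\<Omega>\<close>, so the
          disc is shrunk until it stays there.\<close>
        have "open {l. a + sX l v \<in> \<Omega>}" "0 \<in> {l. a + sX l v \<in> \<Omega>}"
          using two_open_line[OF open_\<Omega>] a by auto
        then obtain r' where r': "r' > 0" "ball 0 r' \<subseteq> {l. a + sX l v \<in> \<Omega>}" by (rule openE)
        have "(\<lambda>l. \<phi> (g (a + sX l v))) holomorphic_on ball 0 (min r r')"
        proof (rule holomorphic_transform)
          show "(\<lambda>l. extension (\<lambda>x. \<phi> (f x)) (a + sX l v)) holomorphic_on ball 0 (min r r')"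
            by (rule holomorphic_on_subset[OF r(2)]) auto
          fix l :: complex assume "l \<in> ball 0 (min r r')"
          then have "l \<in> ball 0 r'" by simp
          then have "a + sX l v \<in> \<Omega>" using r' by blast
          then show "extension (\<lambda>x. \<phi> (f x)) (a + sX l v) = \<phi> (g (a + sX l v))" by (simp add: g \<phi>)
        qed
        then show "\<exists>r>0. (\<lambda>l. \<phi> (g (a + sX l v))) holomorphic_on ball 0 r"
          using r r' by (metis min_less_iff_conj)
      qed
    qed
  next
    fix x assume x: "x \<in> \<Omega> - K"
    show "g x = f x"
    proof (rule Y.dual_separates[OF hausdorff])
      fix \<phi> assume \<phi>: "\<phi> \<in> Y.dual"
      then have "\<phi> (g x) = extension (\<lambda>x. \<phi> (f x)) x" using x by (intro g) auto
      then show "\<phi> (g x) = \<phi> (f x)" using extension_extends[OF f\<phi>[OF \<phi>] x] by simp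
    qed
  next
    fix h x assume h: "h \<in> H_G sX sY P \<Omega>" and eq: "\<And>x. x \<in> \<Omega> - K \<Longrightarrow> h x = f x" and x: "x \<in> \<Omega>"
    show "h x = g x"
    proof (rule Y.dual_separates[OF hausdorff])
      fix \<phi> assume \<phi>: "\<phi> \<in> Y.dual"
      have "gateaux_holomorphic (\<lambda>x. \<phi> (h x)) \<Omega>" using h \<phi> by (simp add: H_G_iff)
      then have "extension (\<lambda>x. \<phi> (f x)) x = \<phi> (h x)"
        by (rule extension_of_holomorphic[OF _ _ x]) (simp add: eq)
      then show "\<phi> (h x) = \<phi> (g x)" by (simp add: g x \<phi>)
    qed
  next
    \<comment> \<open>Separation needs a point of the convex set; \<open>f c\<close> provides one,
      as the free line contains \<open>c\<close> itself.\<close>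
    obtain c where "c \<in> \<Omega>" "K \<inter> lineL sX c u = {}" using free_line by blast
    moreover have "c + sX 0 u \<in> lineL sX c u" unfolding lineL_def by blast
    ultimately have c: "c \<in> \<Omega> - K" by auto
    show "g ` \<Omega> \<subseteq> closed_convex_hull sY P (f ` (\<Omega> - K))"
      unfolding closed_convex_hull_def
    proof (intro subsetI InterI)
      fix y C assume y: "y \<in> g ` \<Omega>"
        and C: "C \<in> {C. f ` (\<Omega> - K) \<subseteq> C \<and> convexY sY C \<and> lc_closed P C}"
      obtain a where a: "a \<in> \<Omega>" "y = g a" using y by blast
      show "y \<in> C"
      proof (rule ccontr)
        assume nC: "y \<notin> C"
        have "f c \<in> C" using C c by blast
        then obtain \<psi> b where \<psi>: "\<psi> \<in> Y.dual" "\<And>z. z \<in> C \<Longrightarrow> Re (\<psi> z) \<le> b" "Re (\<psi> y) > b"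
          using Y.closed_convex_separation[of C "f c" y] C nC by blast
        \<comment> \<open>Equality of the scalar ranges shows that \<open>\<psi> y\<close> is a
          value of \<open>\<psi>\<close> on \<open>f\<close>, which contradicts the strict
          separation from \<open>C\<close>.\<close>
        have "\<psi> y \<in> extension (\<lambda>x. \<psi> (f x)) ` \<Omega>" using a g[OF a(1) \<psi>(1)] by auto
        also have "\<dots> = (\<lambda>x. \<psi> (f x)) ` (\<Omega> - K)" by (rule extension_range[OF f\<phi>[OF \<psi>(1)]])
        finally obtain x where "x \<in> \<Omega> - K" "\<psi> y = \<psi> (f x)" by blast
        then show False using \<psi>(2)[of "f x"] \<psi>(3) C by auto
      qed
    qed
  qed
qed

end

theorem mainTheorem19:
  fixes sX :: "complex \<Rightarrow> 'a \<Rightarrow> 'a::ab_group_add"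
    and sY :: "complex \<Rightarrow> 'b \<Rightarrow> 'b::ab_group_add"
    and P :: "'i \<Rightarrow> 'b \<Rightarrow> real"
    and K \<Omega> :: "'a set"
  assumes X_vs: "vector_space sX"
    and X_dim: "\<exists>x1 x2. x1 \<noteq> x2 \<and> \<not> module.dependent sX {x1, x2}"
    and Y_vs: "vector_space sY"
    and Y_semi: "seminorm_family sY P"
    and Y_haus: "lc_hausdorff P"
    and Y_compl: "lc_seq_complete P"
    and Y_nontriv: "\<exists>y::'b. y \<noteq> 0"
    and KO: "K \<subseteq> \<Omega>"
    and O_open: "two_open sX \<Omega>"
    and OK_open: "two_open sX (\<Omega> - K)"
    and OK_conn: "polygonally_connected sX (\<Omega> - K)"
    and u_ex: "\<exists>u. u \<noteq> 0 \<and>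
       (\<forall>a\<in>\<Omega>. \<forall>v. \<exists>e>0. compact_in_plane sX a u v (K \<inter> planeL_eps sX a u v e)) \<and>
       (\<exists>c\<in>\<Omega>. K \<inter> lineL sX c u = {})"
  shows "(\<forall>f \<in> H_G sX sY P (\<Omega> - K).
            \<exists>g. g \<in> H_G sX sY P \<Omega> \<and> (\<forall>x\<in>\<Omega> - K. g x = f x)
              \<and> (\<forall>h. h \<in> H_G sX sY P \<Omega> \<and> (\<forall>x\<in>\<Omega> - K. h x = f x) \<longrightarrow> (\<forall>x\<in>\<Omega>. h x = g x))
              \<and> g ` \<Omega> \<subseteq> closed_convex_hull sY P (f ` (\<Omega> - K)))
       \<and> (\<forall>f \<in> H_G sX (*) (\<lambda>_::unit. cmod) (\<Omega> - K).
            \<exists>g. g \<in> H_G sX (*) (\<lambda>_::unit. cmod) \<Omega> \<and> (\<forall>x\<in>\<Omega> - K. g x = f x)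
              \<and> g ` \<Omega> = f ` (\<Omega> - K))"
proof -
  obtain u where u: "u \<noteq> 0" "\<And>a v. a \<in> \<Omega> \<Longrightarrow> \<exists>e>0. compact_in_plane sX a u v (K \<inter> planeL_eps sX a u v e)"
    "\<exists>c\<in>\<Omega>. K \<inter> lineL sX c u = {}"
    using u_ex by blast
  interpret X: vector_space sX by (rule X_vs)
  interpret Y: vector_space sY by (rule Y_vs)
  interpret hartogs_vector_configuration sX K \<Omega> u sY P
    by unfold_locales (use KO O_open OK_open OK_conn u Y_semi Y_haus Y_compl in blast)+
  show ?thesis
  proof (intro conjI ballI)
    fix f assume "f \<in> H_G sX sY P (\<Omega> - K)"
    from vector_extension[OF this] obtain g where
      "g \<in> H_G sX sY P \<Omega>" "\<And>x. x \<in> \<Omega> - K \<Longrightarrow> g x = f x"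
      "\<And>h x. h \<in> H_G sX sY P \<Omega> \<Longrightarrow> (\<And>x. x \<in> \<Omega> - K \<Longrightarrow> h x = f x) \<Longrightarrow> x \<in> \<Omega> \<Longrightarrow> h x = g x"
      "g ` \<Omega> \<subseteq> closed_convex_hull sY P (f ` (\<Omega> - K))"
      by blast
    then show "\<exists>g. g \<in> H_G sX sY P \<Omega> \<and> (\<forall>x\<in>\<Omega> - K. g x = f x)
              \<and> (\<forall>h. h \<in> H_G sX sY P \<Omega> \<and> (\<forall>x\<in>\<Omega> - K. h x = f x) \<longrightarrow> (\<forall>x\<in>\<Omega>. h x = g x))
              \<and> g ` \<Omega> \<subseteq> closed_convex_hull sY P (f ` (\<Omega> - K))"
      by (intro exI[of _ g]) blast
  next
    fix f assume "f \<in> H_G sX (*) (\<lambda>_::unit. cmod) (\<Omega> - K)"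
    \<comment> \<open>The scalar case goes directly through \<open>extension\<close>, because
      \<open>extension_range\<close> gives equality of the ranges, which a closed convex hull would
      not.\<close>
    then have f: "gateaux_holomorphic f (\<Omega> - K)" by (simp only: scalar_H_G_iff)
    show "\<exists>g. g \<in> H_G sX (*) (\<lambda>_::unit. cmod) \<Omega> \<and> (\<forall>x\<in>\<Omega> - K. g x = f x)
              \<and> g ` \<Omega> = f ` (\<Omega> - K)"
      using gateaux_holomorphic_extension[OF f] extension_extends[OF f] extension_range[OF f]
      by (intro exI[of _ "extension f"]) (simp only: scalar_H_G_iff simp_thms ball_simps, blast)
  qed
qed

end
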